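(* For every $n$, let $\theta_n$ be a noncrossing tree with $n$ vertices and shape $\tau_n$. Denote by $\varnothing=u^{(n)}_0\prec u^{(n)}_1\prec\dots\prec u^{(n)}_{n-1}$ the vertices of $\tau_n$ listed in lexicographical order, let $k^{(n)}_i$ be the number of children of $u^{(n)}_i$ and let $L^{(n)}_i$ be the number of children of $u^{(n)}_i$ lying to the left of $u^{(n)}_i$ in $\theta_n$. Let $Z\in\mathbb{D}([0,1],\mathbb{R})$ be a càdlàg function with $Z(0)=Z(1)=0$, $Z(t)>0$ for $t\in(0,1)$ and $\Delta Z(t)\ge0$ for $t\in(0,1]$, satisfying: (1) for every $0\le s<t\le1$, there exists at most one value $r\in(s,t)$ such that $Z(r)=\inf_{[s,t]}Z$; (2) for every $t\in(0,1)$ such that $\Delta Z(t)>0$, $\inf_{[t,t+\varepsilon]}Z<Z(t)$ for every $0<\varepsilon\le1-t$; (3) for every $t\in(0,1)$ such that $\Delta Z(t)>0$, $\inf_{[t-\varepsilon,t]}Z<Z(t-)$ for every $0<\varepsilon\le t$; (4) for every $t\in(0,1)$ such that $Z$ attains a local minimum at $t$ (which implies $\Delta Z(t)=0$), if $s=\sup\{u\in[0,t]:Z(u)<Z(t)\}$, then $\Delta Z(s)>0$ and $Z(s-)<Z(t)<Z(s)$. Assume that there exist a sequence $B_n\to\infty$ and a jumps labelling $\boldsymbol\ell=(\ell_s:s\in J(Z))$ of $Z$ such that: (i) $\mathsf{H}(\tau_n)/n\to0$ as $n\to\infty$; (ii) the convergence $\mathcal{W}(\tau_n)/B_n\to Z$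 holds for the Skorokhod topology, i.e. $(\mathcal{W}_{\lfloor ns\rfloor}(\tau_n)/B_n)_{s\in[0,1]}\to Z$ in $\mathbb{D}([0,1],\mathbb{R})$ with the $J_1$ topology; (iii) for every $s\in(0,1)$, if $i_n\in\{0,1,\dots,n-1\}$ is such that $\lim_{n\to\infty}k^{(n)}_{i_n}/B_n>0$ and $i_n/n\to s$, then $L^{(n)}_{i_n}/k^{(n)}_{i_n}\to\ell_s$; (iv) for every $s\in J(Z)$, $Z$ does not attain a local minimum at $p_s(\boldsymbol\ell)$. Then $\theta_n\to L(Z,\boldsymbol\ell)$ for the Hausdorff topology on compact subsets of the closed unit disk.
   Context: **Noncrossing trees and shapes.** A noncrossing tree with $n$ vertices is a tree drawn in the closed unit disk whose vertices are the $n$-th roots of unity and whose edges are straight line segments which do not cross (distinct edges may only meet at a common endpoint). It is viewed as a compact subset of the disk (the union of its edges). Its shape is the plane (rooted ordered) tree it carries, rooted at the vertex $1\in\mathbb{C}$; explicitly, giving the vertex $e^{-2i\pi p/n}$ the label $p\in\{0,\dots,n-1\}$, the children of each vertex are ordered by increasing label. The children of $u$ lying to the left of $u$ are those lying in the left half-plane bounded by the line joining $u$ to $1$, i.e. those with a label smaller than that of $u$. **Plane trees.** For a plane tree $\tau$, $|u|$ is the generation of $u$, $k_u(\tau)$ its number of children, and $\mathsf{H}(\tau)=\max_{u\in\tau}|u|$. If $u(0)\prec\dots\prec u(n-1)$ are the vertices of $\tau$ in lexicographical (depth-first) order, the Łukasiewicz path is $\mathcal{W}_0(\tau)=0$, $\mathcal{W}_{j+1}(\tau)=\mathcal{W}_j(\tau)+k_{u(j)}(\tau)-1$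 for $0\le j\le n-1$. **Triangulated laminations.** Set $\Delta Z(t)=Z(t)-Z(t-)$, with $Z(0-)=Z(0)$. For $0\le s<t\le1$ write $s\simeq^Z t$ if $t=\inf\{u>s:Z(u)\le Z(s-)\}$; extend symmetrically and set $s\simeq^Z s$ for all $s$. Set $L(Z)=\bigcup_{s\simeq^Z t}[e^{-2i\pi s},e^{-2i\pi t}]$. Let $J(Z)=\{u\in[0,1]:\Delta Z(u)>0\}$. A jumps labelling of $Z$ is a family $\boldsymbol\ell=(\ell_u;u\in J(Z))$ with $0\le\ell_u\le1$; by convention $\ell_u=0$ if $u\notin J(Z)$. For $u\in J(Z)$ set $t_u=\inf\{v>u:Z(v)=Z(u-)\}$, $B_u=\{r\in[u,t_u]:Z(r)=\inf_{[u,r]}Z\}$, $p_u(\boldsymbol\ell)=\inf\{r\ge u:Z(r)=Z(u)-\Delta Z(u)\cdot\ell_u\}$ and $C_u(\boldsymbol\ell)=\bigcup_{r\in B_u}[e^{-2i\pi p_u(\boldsymbol\ell)},e^{-2i\pi r}]$. Finally $L(Z,\boldsymbol\ell)=L(Z)\cup\bigcup_{u\in J(Z)}C_u(\boldsymbol\ell)$. *)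

theory Defs
  imports "HOL-Analysis.Analysis" "HOL-Library.List_Lexorder"
begin

section \<open>Noncrossing trees and their shapes\<close>

text \<open>
  A noncrossing tree with \<open>n\<close> vertices is given by its edge set: a set of two-element sets of
  labels \<open>p < n\<close>, the label \<open>p\<close> standing for the root of unity \<^term>\<open>cis (- 2 * pi * p / n)\<close>.
\<close>

definition unity_vertex :: "nat \<Rightarrow> nat \<Rightarrow> complex" where
  "unity_vertex n p = cis (- 2 * pi * real p / real n)"

definition adjacent :: "nat set set \<Rightarrow> (nat \<times> nat) set" where
  "adjacent E = {(p, q). {p, q} \<in> E}"

definition graph_tree :: "nat \<Rightarrow> nat set set \<Rightarrow> bool" where
  "graph_tree n E \<longleftrightarrow>
     0 < n \<and>
     E \<subseteq> {{p, q} | p q. p < n \<and> q < n \<and> p \<noteq> q} \<and>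
     (\<forall>p<n. \<forall>q<n. (p, q) \<in> (adjacent E)\<^sup>*) \<and>
     \<not> (\<exists>c. 3 \<le> length c \<and> distinct c \<and>
           (\<forall>i<length c. {c ! i, c ! (Suc i mod length c)} \<in> E))"

definition edge_segment :: "nat \<Rightarrow> nat \<Rightarrow> nat \<Rightarrow> complex set" where
  "edge_segment n p q = closed_segment (unity_vertex n p) (unity_vertex n q)"

definition noncrossing_tree :: "nat \<Rightarrow> nat set set \<Rightarrow> bool" where
  "noncrossing_tree n E \<longleftrightarrow>
     graph_tree n E \<and>
     (\<forall>p q r s. {p, q} \<in> E \<and> {r, s} \<in> E \<and> {p, q} \<noteq> {r, s} \<longrightarrow>
        edge_segment n p q \<inter> edge_segment n r s \<subseteq> unity_vertex n ` ({p, q} \<inter> {r, s}))"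

definition drawing :: "nat \<Rightarrow> nat set set \<Rightarrow> complex set" where
  "drawing n E = (\<Union>(p, q)\<in>adjacent E. edge_segment n p q)"

definition root_distance :: "nat set set \<Rightarrow> nat \<Rightarrow> nat" where
  "root_distance E p = (LEAST d. (0, p) \<in> adjacent E ^^ d)"

definition children_labels :: "nat set set \<Rightarrow> nat \<Rightarrow> nat set" where
  "children_labels E p = {q. {p, q} \<in> E \<and> root_distance E q = Suc (root_distance E p)}"

text \<open>
  A plane tree is a set of words of naturals: the root is \<^term>\<open>[]\<close>, and \<open>u @ [j]\<close> is the
  child of \<open>u\<close> with \<open>j\<close> elder siblings (so children are numbered from 0).
  \<open>label_of E u\<close> is the label of the vertex of the noncrossing tree represented by the word \<open>u\<close>
  of its shape.
\<close>

definition label_of :: "nat set set \<Rightarrow> nat list \<Rightarrow> nat" where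
  "label_of E u = foldl (\<lambda>p j. sorted_list_of_set (children_labels E p) ! j) 0 u"

definition shape :: "nat set set \<Rightarrow> nat list set" where
  "shape E = {u. \<forall>i<length u. u ! i < card (children_labels E (label_of E (take i u)))}"

definition num_children :: "nat list set \<Rightarrow> nat list \<Rightarrow> nat" where
  "num_children \<tau> u = card {j. u @ [j] \<in> \<tau>}"

definition height :: "nat list set \<Rightarrow> nat" where
  "height \<tau> = Max (length ` \<tau>)"

text \<open>The linear order on words used here is the lexicographical one of List_Lexorder.\<close>

definition lex_vertex :: "nat list set \<Rightarrow> nat \<Rightarrow> nat list" where
  "lex_vertex \<tau> i = sorted_list_of_set \<tau> ! i"

primrec luka_path :: "nat list set \<Rightarrow> nat \<Rightarrow> int" where
  "luka_path \<tau> 0 = 0"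
| "luka_path \<tau> (Suc j) = luka_path \<tau> j + int (num_children \<tau> (lex_vertex \<tau> j)) - 1"

definition num_left_children :: "nat set set \<Rightarrow> nat list \<Rightarrow> nat" where
  "num_left_children E u = card {q \<in> children_labels E (label_of E u). q < label_of E u}"


section \<open>Cadlag functions on the unit interval\<close>

text \<open>
  Functions on \<open>[0,1]\<close> are represented by functions on the reals whose values outside \<open>[0,1]\<close>
  are irrelevant.
\<close>

definition cadlag :: "(real \<Rightarrow> real) \<Rightarrow> bool" where
  "cadlag Z \<longleftrightarrow>
     (\<forall>t\<in>{0..<1}. (Z \<longlongrightarrow> Z t) (at_right t)) \<and>
     (\<forall>t\<in>{0<..1}. \<exists>l. (Z \<longlongrightarrow> l) (at_left t))"

definition left_lim :: "(real \<Rightarrow> real) \<Rightarrow> real \<Rightarrow> real" where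
  "left_lim Z t = (if t = 0 then Z 0 else Lim (at_left t) Z)"

definition jump :: "(real \<Rightarrow> real) \<Rightarrow> real \<Rightarrow> real" where
  "jump Z t = Z t - left_lim Z t"

definition local_min_at :: "(real \<Rightarrow> real) \<Rightarrow> real \<Rightarrow> bool" where
  "local_min_at Z t \<longleftrightarrow> t \<in> {0..1} \<and> (\<exists>\<delta>>0. \<forall>r\<in>{0..1}. \<bar>r - t\<bar> < \<delta> \<longrightarrow> Z t \<le> Z r)"

definition time_changes :: "(real \<Rightarrow> real) set" where
  "time_changes =
     {\<phi>. continuous_on {0..1} \<phi> \<and> strict_mono_on {0..1} \<phi> \<and> \<phi> ` {0..1} = {0..1}}"

text \<open>The metric of Skorokhod's J1 topology.\<close>

definition skorokhod_dist :: "(real \<Rightarrow> real) \<Rightarrow> (real \<Rightarrow> real) \<Rightarrow> real" where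
  "skorokhod_dist X Y =
     Inf {\<epsilon>. 0 < \<epsilon> \<and> (\<exists>\<phi>\<in>time_changes. \<forall>t\<in>{0..1}. \<bar>\<phi> t - t\<bar> \<le> \<epsilon> \<and> \<bar>X (\<phi> t) - Y t\<bar> \<le> \<epsilon>)}"


section \<open>Triangulated laminations\<close>

definition circle_pt :: "real \<Rightarrow> complex" where
  "circle_pt s = cis (- 2 * pi * s)"

definition chord :: "real \<Rightarrow> real \<Rightarrow> complex set" where
  "chord s t = closed_segment (circle_pt s) (circle_pt t)"

definition lam_less :: "(real \<Rightarrow> real) \<Rightarrow> real \<Rightarrow> real \<Rightarrow> bool" where
  "lam_less Z s t \<longleftrightarrow> 0 \<le> s \<and> s < t \<and> t \<le> 1 \<and> t = Inf {u. s < u \<and> u \<le> 1 \<and> Z u \<le> left_lim Z s}"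

definition lam_rel :: "(real \<Rightarrow> real) \<Rightarrow> real \<Rightarrow> real \<Rightarrow> bool" where
  "lam_rel Z s t \<longleftrightarrow> lam_less Z s t \<or> lam_less Z t s \<or> (s = t \<and> s \<in> {0..1})"

definition lamination :: "(real \<Rightarrow> real) \<Rightarrow> complex set" where
  "lamination Z = (\<Union>(s, t)\<in>{(s, t). lam_rel Z s t}. chord s t)"

definition jump_times :: "(real \<Rightarrow> real) \<Rightarrow> real set" where
  "jump_times Z = {u\<in>{0..1}. jump Z u > 0}"

definition jumps_labelling :: "(real \<Rightarrow> real) \<Rightarrow> (real \<Rightarrow> real) \<Rightarrow> bool" where
  "jumps_labelling Z lab \<longleftrightarrow>
     (\<forall>u\<in>jump_times Z. 0 \<le> lab u \<and> lab u \<le> 1) \<and> (\<forall>u. u \<notin> jump_times Z \<longrightarrow> lab u = 0)"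

definition face_end :: "(real \<Rightarrow> real) \<Rightarrow> real \<Rightarrow> real" where
  "face_end Z u = Inf {v. u < v \<and> v \<le> 1 \<and> Z v = left_lim Z u}"

definition face_times :: "(real \<Rightarrow> real) \<Rightarrow> real \<Rightarrow> real set" where
  "face_times Z u = {r\<in>{u..face_end Z u}. Z r = Inf (Z ` {u..r})}"

definition face_apex :: "(real \<Rightarrow> real) \<Rightarrow> (real \<Rightarrow> real) \<Rightarrow> real \<Rightarrow> real" where
  "face_apex Z lab u = Inf {r. u \<le> r \<and> r \<le> 1 \<and> Z r = Z u - jump Z u * lab u}"

definition face_chords :: "(real \<Rightarrow> real) \<Rightarrow> (real \<Rightarrow> real) \<Rightarrow> real \<Rightarrow> complex set" where
  "face_chords Z lab u = (\<Union>r\<in>face_times Z u. chord (face_apex Z lab u) r)"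

definition triangulated_lamination :: "(real \<Rightarrow> real) \<Rightarrow> (real \<Rightarrow> real) \<Rightarrow> complex set" where
  "triangulated_lamination Z lab = lamination Z \<union> (\<Union>u\<in>jump_times Z. face_chords Z lab u)"


section \<open>Hausdorff distance\<close>

text \<open>Meaningful for nonempty bounded sets; a metric on the nonempty compact ones.\<close>

definition hausdorff_dist :: "'a::metric_space set \<Rightarrow> 'a set \<Rightarrow> real" where
  "hausdorff_dist A B = max (SUP x\<in>A. infdist x B) (SUP y\<in>B. infdist y A)"

end

theory Submission
  imports Defs "HOL-Library.Sublist"
begin

text \<open>
  In the depth-first order the descendants of a vertex of rank \<open>i\<close> are an interval of ranks,
  ending when the Lukasiewicz path first goes below its value at \<open>i\<close>. Since the tree is
  noncrossing, their labels form an interval as well, and the two intervals differ by at most the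
  height, which is negligible. Hence every edge can be located, up to \<open>o(n)\<close>, from first passage
  times of the path and from the numbers of left children.

  Every chord of the triangulated lamination is a limit of edges. For a chord between the apex of a
  jump \<open>u\<close> and a time \<open>r\<close> of its face, take the edge between the vertex of large degree
  coding the jump and one of its children whose whole subtree lies close to \<open>r\<close>. For a chord of
  \<open>lamination Z\<close>, take two nested subtrees whose rank intervals are close to the chord, without
  common end points: removing the inner one from the outer one leaves a connected set of
  vertices close to one of the two ends of the chord, so some edge joins the two sides.

  Conversely, a limit of edges does not cross a limit of edges, and the hypotheses on \<open>Z\<close> make the
  lamination maximal: a chord crossing none of its chords belongs to it. So the limits of edges are
  exactly the chords of the lamination, which gives both its compactness and the Hausdorff
  convergence.
\<close>

text \<open>Chords are defined by equalities between values of \<open>Z\<close>, but only strict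
  inequalities pass to the walks under Skorokhod convergence: the value at one time, or the minimum
  over a closed range of times, lies strictly on one side of a level. So each chord must first be
  surrounded by times at which \<open>Z\<close> is strictly above or strictly below suitable levels.
  A local minimum in the wrong place would prevent this; \<open>H4\<close> and the condition on the
  apexes exclude it, \<open>H1\<close> excludes repeated minima, and \<open>H2\<close>,
  \<open>H3\<close> supply lower values on both sides of a jump. Passing from ranks to labels costs
  at most the height because the only earlier vertices whose label may exceed those of a subtree are
  the ancestors of its first vertex. An edge of a large tree is never located by itself in the
  converse direction. It is enough that it cannot cross the edges already known to approximate the
  chords, so that only the maximality of the limiting family remains to be shown.\<close>

lemma ex_elem_with_rank:
  fixes C :: "'a::linorder set"
  assumes "finite C" "j < card C"
  obtains c where "c \<in> C" "card {d \<in> C. d < c} = j"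
proof -
  let ?l = "sorted_list_of_set C"
  have len: "length ?l = card C" using assms by simp
  have "bij_betw ((!) ?l) {..<card C} C"
    using bij_betw_nth[of ?l "{..<card C}" C] len assms(1) by (auto simp: set_sorted_list_of_set)
  then have img: "(!) ?l ` {..<card C} = C" and inj: "inj_on ((!) ?l) {..<card C}"
    by (auto simp: bij_betw_def)
  have less: "?l ! a < ?l ! b \<longleftrightarrow> a < b" if "a < card C" "b < card C" for a b
    using that sorted_list_of_set.strict_sorted_key_list_of_set[of C]
    by (metis assms(1) len linorder_neqE_nat not_less_iff_gr_or_eq sorted_wrt_nth_less)
  have "{d \<in> C. d < ?l ! j} = (!) ?l ` {..<j}"
  proof (rule set_eqI)
    fix d
    show "d \<in> {d \<in> C. d < ?l ! j} \<longleftrightarrow> d \<in> (!) ?l ` {..<j}"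
    proof (cases "d \<in> C")
      case True
      then obtain a where "a < card C" "d = ?l ! a" using img by auto
      then show ?thesis using True less[of a j] less[of _ j] assms(2)
        by (smt (verit, best) image_iff lessThan_iff less_trans mem_Collect_eq)
    next
      case False
      then show ?thesis using img assms(2) by auto
    qed
  qed
  moreover have "inj_on ((!) ?l) {..<j}"
    by (rule inj_on_subset[OF inj]) (use assms(2) in auto)
  ultimately have "card {d \<in> C. d < ?l ! j} = j" by (simp add: card_image)
  moreover have "?l ! j \<in> C" using assms img by blast
  ultimately show thesis using that by blast
qed

lemma convex_nat_set_eq_interval:
  fixes P :: "nat set"
  assumes "finite P" "P \<noteq> {}" and conv: "\<And>a b c. a \<in> P \<Longrightarrow> c \<in> P \<Longrightarrow> a < b \<Longrightarrow> b < c \<Longrightarrow> b \<in> P"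
  shows "P = {Min P..<Min P + card P}"
proof -
  have 1: "P = {Min P..Max P}"
  proof (rule set_eqI)
    fix x
    have "x \<in> P" if "Min P \<le> x" "x \<le> Max P"
      using conv[of "Min P" "Max P" x] Min_in[OF assms(1,2)] Max_in[OF assms(1,2)] that
      by (cases "x = Min P"; cases "x = Max P") auto
    then show "x \<in> P \<longleftrightarrow> x \<in> {Min P..Max P}" using assms(1,2) by auto
  qed
  have "card P = Suc (Max P) - Min P" using arg_cong[OF 1, of card] by simp
  moreover have "Min P \<le> Max P" using assms(1,2) by simp
  ultimately have "{Min P..<Min P + card P} = {Min P..Max P}" by auto
  with 1 show ?thesis by simp
qed

section \<open>Plane trees in depth-first order\<close>

text \<open>Vertices are replaced by their ranks in depth-first order: \<open>par i\<close> is the parent of \<open>i\<close>,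
  the descendants of \<open>i\<close> (itself included) are \<open>i, \<dots>, i + sz i - 1\<close>, and \<open>lab\<close> maps ranks to the
  labels on the circle.\<close>

locale ranked_tree =
  fixes n :: nat and par sz lab :: "nat \<Rightarrow> nat" and E :: "nat set set" and H :: nat
  assumes n_pos: "0 < n"
    and par_less: "\<And>j. 0 < j \<Longrightarrow> j < n \<Longrightarrow> par j < j"
    and sz_pos: "\<And>i. i < n \<Longrightarrow> 0 < sz i"
    and sz_le: "\<And>i. i < n \<Longrightarrow> i + sz i \<le> n"
    and sub_par: "\<And>i j. i < n \<Longrightarrow> j < n \<Longrightarrow> 0 < j \<Longrightarrow> i \<noteq> j \<Longrightarrow>
                    j \<in> {i..<i + sz i} \<longleftrightarrow> par j \<in> {i..<i + sz i}"
    and lab_bij: "bij_betw lab {..<n} {..<n}"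
    and lab_0: "lab 0 = 0"
    and edge: "\<And>j. 0 < j \<Longrightarrow> j < n \<Longrightarrow> {lab j, lab (par j)} \<in> E"
    and nocross: "\<And>a b c d. {a, b} \<in> E \<Longrightarrow> {c, d} \<in> E \<Longrightarrow> a < c \<Longrightarrow> c < b \<Longrightarrow> b < d \<Longrightarrow> False"
    and siblings: "\<And>c c'. 0 < c \<Longrightarrow> c < c' \<Longrightarrow> c' < n \<Longrightarrow> par c = par c' \<Longrightarrow> lab c < lab c'"
    and ancestors: "\<And>i. i < n \<Longrightarrow> card {a. a < i \<and> i < a + sz a} \<le> H"
begin

abbreviation sub :: "nat \<Rightarrow> nat set" where "sub i \<equiv> {i..<i + sz i}"

definition ch :: "nat \<Rightarrow> nat set" where "ch i = {c. 0 < c \<and> c < n \<and> par c = i}"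

text \<open>The vertices waiting to be explored at time \<open>i\<close> of the depth-first search.\<close>

definition stack :: "nat \<Rightarrow> nat set" where "stack i = {j. i \<le> j \<and> j < n \<and> (j = 0 \<or> par j < i)}"

text \<open>This is the Lukasiewicz path (see \<open>luka_path_walk\<close>), written as a count of
  waiting vertices so that its values can be compared without summing increments.\<close>

definition walk :: "nat \<Rightarrow> int" where "walk i = int (card (stack i)) - 1"

lemma lab_less: "i < n \<Longrightarrow> lab i < n"
  using lab_bij by (auto simp: bij_betw_def)

lemma lab_inj: "i < n \<Longrightarrow> j < n \<Longrightarrow> lab i = lab j \<Longrightarrow> i = j"
  using lab_bij by (auto simp: bij_betw_def inj_on_def)

lemma lab_surj:
  assumes "q < n" obtains k where "k < n" "lab k = q"
proof -
  have "q \<in> lab ` {..<n}" using lab_bij assms by (simp add: bij_betw_def)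
  then show thesis using that by auto
qed

lemma lab_image_iff: "i < n \<Longrightarrow> k < n \<Longrightarrow> lab k \<in> lab ` sub i \<longleftrightarrow> k \<in> sub i"
  using lab_inj[of k] sz_le[of i] by (metis atLeastLessThan_iff image_iff less_le_trans)

lemma sub_self: "i < n \<Longrightarrow> i \<in> sub i"
  using sz_pos by auto

lemma sub_0: "m < n \<Longrightarrow> m \<in> sub 0"
proof (induction m rule: less_induct)
  case (less m)
  then show ?case using sub_self[OF n_pos] sub_par[of 0 m] par_less[of m] n_pos by (cases "m = 0") auto
qed

lemma sub_trans:
  assumes "i < n" "j \<in> sub i" shows "sub j \<subseteq> sub i"
proof -
  have jn: "j < n" using assms sz_le[of i] by auto
  have "m < n \<Longrightarrow> m \<in> sub j \<Longrightarrow> m \<in> sub i" for m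
  proof (induction m rule: less_induct)
    case (less m)
    show ?case
    proof (cases "m = j \<or> m = i")
      case True then show ?thesis using assms sub_self by auto
    next
      case False
      then have m0: "0 < m" using less.prems by auto
      have "par m \<in> sub j" using sub_par[of j m] False less.prems jn m0 by auto
      then have "par m \<in> sub i" using less.IH[of "par m"] par_less[of m] m0 less.prems by auto
      then show ?thesis using sub_par[of i m] False less.prems m0 assms by auto
    qed
  qed
  then show ?thesis using sz_le[OF jn] by fastforce
qed

lemma sub_ch: "i < n \<Longrightarrow> c \<in> ch i \<Longrightarrow> c \<in> sub i \<and> c \<noteq> i"
  using sub_par[of i c] sub_self[of i] par_less[of c] by (auto simp: ch_def)

lemma finite_ch [simp]: "finite (ch i)"
  unfolding ch_def by (rule finite_subset[of _ "{..<n}"]) auto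

lemma finite_stack [simp]: "finite (stack i)"
  unfolding stack_def by (rule finite_subset[of _ "{..<n}"]) auto

section \<open>Values of the walk at the ends of subtrees and at children\<close>

lemma walk_0: "walk 0 = 0"
proof -
  have "stack 0 = {0}" using n_pos by (auto simp: stack_def)
  then show ?thesis by (simp add: walk_def)
qed

lemma walk_Suc:
  assumes "i < n" shows "walk (Suc i) = walk i + int (card (ch i)) - 1"
proof -
  have "i \<in> stack i" using assms par_less[of i] by (auto simp: stack_def)
  have eq: "stack (Suc i) = (stack i - {i}) \<union> ch i"
  proof (rule set_eqI)
    fix q
    show "q \<in> stack (Suc i) \<longleftrightarrow> q \<in> (stack i - {i}) \<union> ch i"
      using par_less[of q] by (cases "q = 0"; cases "q = i") (auto simp: stack_def ch_def less_Suc_eq)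
  qed
  have dis: "(stack i - {i}) \<inter> ch i = {}"
    by (auto simp: stack_def ch_def)
  have "card (stack (Suc i)) = card (stack i - {i}) + card (ch i)"
    unfolding eq by (rule card_Un_disjoint) (use dis in auto)
  moreover have "card (stack i) = Suc (card (stack i - {i}))"
    by (rule card.remove) (use \<open>i \<in> stack i\<close> in auto)
  ultimately show ?thesis by (simp add: walk_def)
qed

text \<open>At a time \<open>T\<close> at which the descendants of \<open>i\<close> explored so far form complete subtrees of
  children of \<open>i\<close>, the stack consists of the stack before \<open>i\<close> and of the remaining children.\<close>

lemma walk_at_cut:
  assumes "i < n" "i < T" "T \<le> i + sz i" and cut: "\<And>m. T \<le> m \<Longrightarrow> m < n \<Longrightarrow> i < par m \<Longrightarrow> par m < T \<Longrightarrow> False"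
  shows "walk T = walk (Suc i) - int (card {c \<in> ch i. c < T})"
    and "i < m \<Longrightarrow> m < T \<Longrightarrow> walk T < walk m"
proof -
  have eq: "stack T = (stack i - sub i) \<union> {c \<in> ch i. T \<le> c}"
  proof (rule set_eqI, rule iffI)
    fix q assume q: "q \<in> stack T"
    then have "q \<noteq> 0" using assms by (auto simp: stack_def)
    then have q': "T \<le> q" "q < n" "par q < T" using q by (auto simp: stack_def)
    then have "par q \<le> i" using cut by force
    then show "q \<in> (stack i - sub i) \<union> {c \<in> ch i. T \<le> c}"
    proof (cases "par q = i")
      case False
      then have "q \<notin> sub i" using sub_par[of i q] assms q' \<open>q \<noteq> 0\<close> \<open>par q \<le> i\<close> by auto
      then show ?thesis using q' False \<open>par q \<le> i\<close> assms by (auto simp: stack_def)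
    qed (use q' \<open>q \<noteq> 0\<close> in \<open>auto simp: ch_def\<close>)
  next
    fix q assume q: "q \<in> (stack i - sub i) \<union> {c \<in> ch i. T \<le> c}"
    then show "q \<in> stack T" using assms by (auto simp: stack_def ch_def)
  qed
  have "stack i \<inter> sub i = {i}"
  proof
    show "{i} \<subseteq> stack i \<inter> sub i"
      using assms sub_self[of i] par_less[of i] by (auto simp: stack_def)
    show "stack i \<inter> sub i \<subseteq> {i}"
    proof
      fix q assume q: "q \<in> stack i \<inter> sub i"
      then show "q \<in> {i}" using sub_par[of i q] assms(1) by (cases "q = i") (auto simp: stack_def)
    qed
  qed
  then have "stack i - sub i = stack i - {i}" by blast
  have dis: "(stack i - sub i) \<inter> {c \<in> ch i. T \<le> c} = {}"
    by (auto simp: stack_def ch_def)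
  have "i \<in> stack i" using \<open>stack i \<inter> sub i = {i}\<close> by blast
  then have "card (stack i) = Suc (card (stack i - sub i))"
    unfolding \<open>stack i - sub i = stack i - {i}\<close> by (intro card.remove) auto
  moreover have "card (stack T) = card (stack i - sub i) + card {c \<in> ch i. T \<le> c}"
    unfolding eq by (rule card_Un_disjoint) (use dis in auto)
  moreover have "card (ch i) = card {c \<in> ch i. c < T} + card {c \<in> ch i. T \<le> c}"
    by (subst card_Un_disjoint[symmetric]) (auto intro!: arg_cong[of _ _ card])
  ultimately show "walk T = walk (Suc i) - int (card {c \<in> ch i. c < T})"
    using walk_Suc[OF assms(1)] by (simp add: walk_def)
  assume m: "i < m" "m < T"
  \<comment> \<open>Whatever waits at \<open>T\<close> was already waiting at \<open>m\<close>, and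
    \<open>m\<close> itself has been explored in between; this makes the inequality strict.\<close>
  have "stack T \<subseteq> stack m"
    unfolding eq using m assms by (auto simp: stack_def ch_def)
  moreover have "m \<notin> stack T" using m by (auto simp: stack_def)
  moreover have "m \<in> stack m" using m assms sz_le[of i] par_less[of m] by (auto simp: stack_def)
  ultimately have "stack T \<subset> stack m" by blast
  then show "walk T < walk m" unfolding walk_def by (simp add: psubset_card_mono)
qed

text \<open>The end of the subtree is a cut at which all children have been used up. It is therefore
  the first time at which the walk is below its value at \<open>i\<close>.\<close>

lemma walk_subtree_end:
  assumes "i < n"
  shows "walk (i + sz i) = walk i - 1" and "m \<in> sub i \<Longrightarrow> walk i \<le> walk m"
proof -
  have cut: False if "i + sz i \<le> m" "m < n" "i < par m" "par m < i + sz i" for m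
    using sub_par[of i m] that assms by auto
  have sp: "i < i + sz i" using sz_pos[OF assms] by simp
  have w1: "walk (i + sz i) = walk (Suc i) - int (card {c \<in> ch i. c < i + sz i})"
    by (rule walk_at_cut(1)[OF assms sp order.refl]) (rule cut)
  have w2: "walk (i + sz i) < walk m" if "i < m" "m < i + sz i" for m
    by (rule walk_at_cut(2)[OF assms sp order.refl _ that]) (rule cut)
  have "{c \<in> ch i. c < i + sz i} = ch i" using sub_ch[OF assms] by auto
  then show 1: "walk (i + sz i) = walk i - 1" using w1 walk_Suc[OF assms] by simp
  show "walk i \<le> walk m" if "m \<in> sub i"
    using w2[of m] 1 that by (cases "m = i") auto
qed

text \<open>Makes every child an admissible time in \<open>walk_at_cut\<close>. A vertex strictly
  between \<open>i\<close> and \<open>c\<close> with a child at or after \<open>c\<close> would be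
  an ancestor of \<open>c\<close>, its subtree being an interval, hence also of
  \<open>par c = i\<close>, although it comes after \<open>i\<close>.\<close>

lemma child_is_cut:
  assumes "i < n" "c \<in> ch i" "c \<le> m" "m < n" "i < par m" "par m < c"
  shows False
proof -
  have c: "c < n" "0 < c" "par c = i" using assms by (auto simp: ch_def)
  have ms: "m \<noteq> 0" using assms by auto
  show False
  proof -
    have "par m \<in> sub i" using assms sub_ch[of i c] by auto
    define a where "a = par m"
    have a: "a \<in> sub i" "i < a" "a < c" "m \<in> sub a"
      using assms \<open>par m \<in> sub i\<close> sub_par[of a m] sub_self[of a] c ms by (auto simp: a_def)
    have "c \<in> sub a" using a assms by auto
    then have "i \<in> sub a" using sub_par[of a c] a c by auto
    then show False using a by auto
  qed
qed

text \<open>Prescribing a level between the values of the walk around a large step thus amounts to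
  choosing a child, found as a first passage.\<close>

lemma nth_child:
  assumes "i < n" "j < card (ch i)"
  obtains c where "i < c" "c < n" "c \<in> ch i" "walk c = walk (Suc i) - int j"
    "\<And>m. i < m \<Longrightarrow> m < c \<Longrightarrow> walk c < walk m"
proof -
  obtain c where c: "c \<in> ch i" "card {d \<in> ch i. d < c} = j"
    using ex_elem_with_rank[OF finite_ch assms(2)] by blast
  have "i < c" "c \<le> i + sz i" "c < n" using sub_ch[OF assms(1) c(1)] c by (auto simp: ch_def)
  with walk_at_cut[OF assms(1), of c] child_is_cut[OF assms(1) c(1)] c that show thesis by blast
qed

lemma child_above:
  assumes "i < n" "m \<in> sub i" "m \<noteq> i"
  obtains c where "c \<in> ch i" "m \<in> sub c" "c \<le> m"
proof -
  have "\<exists>c\<in>ch i. m \<in> sub c"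
    using assms(2,3)
  proof (induction m rule: less_induct)
    case (less m)
    have m: "m < n" "0 < m" using less.prems assms sz_le[of i] by auto
    have pm: "par m \<in> sub i" using sub_par[of i m] assms m less.prems by auto
    show ?case
    proof (cases "par m = i")
      case True
      then show ?thesis using m sub_self[of m] by (auto simp: ch_def)
    next
      case False
      then obtain c where c: "c \<in> ch i" "par m \<in> sub c"
        using less.IH[of "par m"] pm par_less m by blast
      then have "m \<in> sub c" using sub_par[of c m] m par_less[of m] by (auto simp: ch_def)
      then show ?thesis using c by blast
    qed
  qed
  then show thesis using that by auto
qed

section \<open>Labels of subtrees\<close>

lemma edge_between:
  assumes "r \<in> A" "\<And>m. m \<in> A \<Longrightarrow> m \<noteq> r \<Longrightarrow> 0 < m \<and> m < n \<and> par m \<in> A"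
    and "j \<in> A" "Q j \<noteq> Q r"
  obtains m where "m \<in> A" "m \<noteq> r" "Q m \<noteq> Q (par m)"
proof -
  \<comment> \<open>Following \<open>par\<close> from \<open>j\<close> stays in \<open>A\<close>
    until \<open>r\<close> is reached, so the truth value of \<open>Q\<close> changes along some
    edge on the way.\<close>
  have "\<exists>m\<in>A. m \<noteq> r \<and> Q m \<noteq> Q (par m)"
    using assms(3,4)
  proof (induction j rule: less_induct)
    case (less j)
    then have j: "j \<noteq> r" by auto
    with assms(2)[OF less.prems(1)] par_less[of j] less show ?case by metis
  qed
  then show thesis using that by blast
qed

text \<open>If \<open>b\<close> were the label of an outside vertex, some edge of the subtree would
  pass over \<open>b\<close>. The complement of the subtree is connected too; it contains that
  vertex and the root, whose label 0 is not passed over. Hence some outside edge would cross the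
  inside one.\<close>

lemma convex_lab_sub:
  assumes "i < n" "a \<in> lab ` sub i" "c \<in> lab ` sub i" "a < b" "b < c"
  shows "b \<in> lab ` sub i"
proof (rule ccontr)
  assume nb: "b \<notin> lab ` sub i"
  have subn: "sub i \<subseteq> {..<n}" using sz_le[OF assms(1)] by auto
  have "b < n" using assms lab_less subn by fastforce
  then obtain jb where jb: "jb < n" "lab jb = b" by (rule lab_surj)
  have jbn: "jb \<notin> sub i" using nb jb by auto
  have step1: "0 < m \<and> m < n \<and> par m \<in> sub i" if "m \<in> sub i" "m \<noteq> i" for m
    using that subn sub_par[of i m] assms(1) by auto
  obtain ja jc where ja: "ja \<in> sub i" "lab ja = a" and jc: "jc \<in> sub i" "lab jc = c"
    using assms by auto
  let ?Q = "\<lambda>m. lab m < b"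
  have "?Q ja \<noteq> ?Q i \<or> ?Q jc \<noteq> ?Q i" using ja jc assms by auto
  then obtain m where m: "m \<in> sub i" "m \<noteq> i" "?Q m \<noteq> ?Q (par m)"
    using edge_between[of i "sub i" ja ?Q] edge_between[of i "sub i" jc ?Q]
      sub_self[OF assms(1)] step1 ja jc by metis
  define s s' where "s = min (lab m) (lab (par m))" and "s' = max (lab m) (lab (par m))"
  have pm: "par m \<in> sub i" "m < n" "0 < m" using step1 m by auto
  have ss: "s \<in> lab ` sub i" "s' \<in> lab ` sub i" "{s, s'} \<in> E"
    using m pm edge[of m] by (auto simp: s_def s'_def min_def max_def insert_commute)
  have "s < b" "b < s'" using m nb pm ss
    by (auto simp: s_def s'_def min_def max_def not_less le_eq_less_or_eq split: if_splits)
  let ?T = "{..<n} - sub i"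
  have i0: "i \<noteq> 0"
  proof
    assume "i = 0"
    then show False using jb jbn sub_0 by auto
  qed
  have step2: "0 < m \<and> m < n \<and> par m \<in> ?T" if "m \<in> ?T" "m \<noteq> 0" for m
    using that sub_par[of i m] assms(1) sub_self[of i] par_less[of m] by auto
  let ?R = "\<lambda>m. s < lab m \<and> lab m < s'"
  have "?R jb \<noteq> ?R 0" using jb \<open>s < b\<close> \<open>b < s'\<close> lab_0 by auto
  moreover have "0 \<in> ?T" using i0 n_pos by auto
  ultimately obtain k where k: "k \<in> ?T" "k \<noteq> 0" "?R k \<noteq> ?R (par k)"
    using edge_between[of 0 ?T jb ?R] step2 jb jbn by blast
  have k': "k < n" "0 < k" "par k \<in> ?T" using step2 k by auto
  have ek: "{lab k, lab (par k)} \<in> E" "{lab (par k), lab k} \<in> E"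
    using edge[of k] k' by (auto simp: insert_commute)
  have ne: "lab k \<noteq> s" "lab k \<noteq> s'" "lab (par k) \<noteq> s" "lab (par k) \<noteq> s'"
    using ss(1,2) k(1) k'(1,3) lab_image_iff[OF assms(1), of k] lab_image_iff[OF assms(1), of "par k"]
    by (metis DiffD1 DiffD2 lessThan_iff)+
  define x y where "x = (if ?R k then lab k else lab (par k))" and "y = (if ?R k then lab (par k) else lab k)"
  have xy: "{x, y} \<in> E" "{y, x} \<in> E" using ek by (auto simp: x_def y_def)
  have "s < x" "x < s'" using k by (auto simp: x_def)
  moreover have "y < s \<or> s' < y" using k ne by (auto simp: y_def not_less le_eq_less_or_eq split: if_splits)
  ultimately show False using nocross[OF ss(3) xy(1)] nocross[OF xy(2) ss(3)] by blast
qed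

definition lo :: "nat \<Rightarrow> nat" where "lo i = Min (lab ` sub i)"

lemma lab_sub: assumes "i < n" shows "lab ` sub i = {lo i..<lo i + sz i}"
proof -
  have "inj_on lab (sub i)" using lab_inj sz_le[OF assms] by (auto simp: inj_on_def)
  then have "card (lab ` sub i) = sz i" by (simp add: card_image)
  moreover have "lab ` sub i = {Min (lab ` sub i)..<Min (lab ` sub i) + card (lab ` sub i)}"
  proof (rule convex_nat_set_eq_interval)
    show "lab ` sub i \<noteq> {}" using sub_self[OF assms] by blast
  qed (rule finite_imageI, simp, rule convex_lab_sub[OF assms])
  ultimately show ?thesis unfolding lo_def by simp
qed

lemma lab_convex_sep:
  assumes "i < n" "k < n" "k \<notin> sub i" "lab k < lab i" "m \<in> sub i" shows "lab k < lab m"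
proof (rule ccontr)
  assume "\<not> lab k < lab m"
  moreover have "lab k \<noteq> lab m" using lab_inj[of k m] assms sz_le[of i] by auto
  ultimately have "lab m < lab k" by simp
  then have "lab k \<in> lab ` sub i"
    using convex_lab_sub[OF assms(1), of "lab m" "lab i" "lab k"] assms(4,5) sub_self[OF assms(1)] by blast
  then show False using lab_image_iff[OF assms(1,2)] assms(3) by simp
qed

lemma lab_convex_sep':
  assumes "i < n" "k < n" "k \<notin> sub i" "lab i < lab k" "m \<in> sub i" shows "lab m < lab k"
proof (rule ccontr)
  assume "\<not> lab m < lab k"
  moreover have "lab k \<noteq> lab m" using lab_inj[of k m] assms sz_le[of i] by auto
  ultimately have "lab k < lab m" by simp
  then have "lab k \<in> lab ` sub i"
    using convex_lab_sub[OF assms(1), of "lab i" "lab m" "lab k"] assms(4,5) sub_self[OF assms(1)] by blast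
  then show False using lab_image_iff[OF assms(1,2)] assms(3) by simp
qed

lemma sub_disjoint:
  assumes "i < n" "j < n" "j \<notin> sub i" "i \<notin> sub j" shows "sub i \<inter> sub j = {}"
  using assms by auto

text \<open>Induction that replaces the vertex with the later parent by this parent, until the two
  vertices are siblings; there the order of the labels is given by \<open>siblings\<close> and
  convexity extends it to the subtrees. Ancestors are excluded because a parent may be labelled
  between its children.\<close>

lemma lab_sub_less:
  assumes "j < i" "i < n" "i \<notin> sub j" "b \<in> sub j" "a \<in> sub i"
  shows "lab b < lab a"
  using assms
proof (induction "i + j" arbitrary: i j a b rule: less_induct)
  case less
  have j0: "0 < j"
  proof (rule ccontr)
    assume "\<not> 0 < j"
    then have "j = 0" by simp
    then show False using less.prems sub_0[of i] by auto
  qed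
  have i: "0 < i" "par i < i" "par i < n" using less.prems par_less[of i] by auto
  have j: "j < n" "par j < j" "par j < n" using less.prems par_less[of j] j0 by auto
  have pin: "par i \<noteq> j" using sub_par[of j i] less.prems j sub_self[of j] i by auto
  have isub: "i \<in> sub (par i)" using sub_par[of "par i" i] sub_self[of "par i"] i less.prems by auto
  consider "j < par i" | "par i < j" "par j = par i" | "par i < j" "par j \<noteq> par i"
    using pin by linarith
  then show ?case
  proof cases
    case 1
    have "par i \<notin> sub j" using sub_par[of j i] less.prems j i by auto
    moreover have "a \<in> sub (par i)" using sub_trans[of "par i" i] isub i less.prems by auto
    ultimately show ?thesis using less.hyps[of "par i" j b a] 1 i j less.prems by auto
  next
    case 2
    have lt: "lab j < lab i" using siblings[of j i] 2 j0 less.prems by simp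
    have ji: "j \<notin> sub i" using less.prems by auto
    have "b \<notin> sub i" using sub_disjoint[OF less.prems(2) j(1) ji less.prems(3)] less.prems by auto
    have "lab b < lab i" using lab_convex_sep'[of j i b] lt less.prems j by auto
    then show ?thesis using lab_convex_sep[of i b a] less.prems \<open>b \<notin> sub i\<close> j sz_le[of j] by auto
  next
    case 3
    have js: "j \<in> sub (par i)" using isub 3 less.prems by auto
    then have pj: "par j \<in> sub (par i)" using sub_par[of "par i" j] i j 3 j0 by auto
    have lt: "par i < par j" using pj 3 by auto
    have "i \<notin> sub (par j)"
    proof
      assume "i \<in> sub (par j)"
      then have "par i \<in> sub (par j)" using sub_par[of "par j" i] j i less.prems by auto
      then show False using lt by auto
    qed
    moreover have "j \<in> sub (par j)" using sub_par[of "par j" j] sub_self[of "par j"] j j0 by auto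
    then have "b \<in> sub (par j)" using sub_trans[of "par j" j] j less.prems by auto
    ultimately show ?thesis using less.hyps[of i "par j" b a] j less.prems by auto
  qed
qed

text \<open>The labels below \<open>lo i\<close> belong to vertices of rank less than
  \<open>i\<close>, and include those of all such vertices that are not ancestors of
  \<open>i\<close>. So \<open>lo i\<close> is between \<open>i\<close> minus the number of ancestors
  and \<open>i\<close>.\<close>

lemma lo_bounds:
  assumes "i < n" shows "lo i \<le> i" "i \<le> lo i + H"
proof -
  define A where "A = {a. a < i \<and> i < a + sz a}"
  have finA: "finite A" unfolding A_def by (rule finite_subset[of _ "{..<i}"]) auto
  have loin: "lo i \<in> lab ` sub i" using lab_sub[OF assms] sz_pos[OF assms] by simp
  then obtain m0 where m0: "m0 \<in> sub i" "lab m0 = lo i" by auto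
  have 1: "lab ` ({..<i} - A) \<subseteq> {..<lo i}"
  proof safe
    fix a assume "a < i" "a \<notin> A"
    then show "lab a < lo i"
      using lab_sub_less[of a i a m0] assms m0 sub_self[of a] by (auto simp: A_def)
  qed
  have "inj_on lab ({..<i} - A)" using lab_inj assms by (auto simp: inj_on_def)
  then have "card ({..<i} - A) \<le> lo i" using card_mono[OF _ 1] by (simp add: card_image)
  moreover have "card ({..<i} - A) = i - card A"
    using finA by (subst card_Diff_subset) (auto simp: A_def)
  ultimately show "i \<le> lo i + H" using ancestors[OF assms] by (auto simp: A_def)
  have 2: "{..<lo i} \<subseteq> lab ` {..<i}"
  proof
    fix q assume q: "q \<in> {..<lo i}"
    have "lo i < n" using loin lab_less sz_le[OF assms] by auto
    with q have "q < n" by simp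
    then obtain k where k: "k < n" "lab k = q" by (rule lab_surj)
    have "k \<notin> sub i"
    proof
      assume "k \<in> sub i"
      then have "q \<in> {lo i..<lo i + sz i}" using k lab_sub[OF assms] by blast
      then show False using q by simp
    qed
    moreover have False if "i < k"
      using lab_sub_less[of i k m0 k] that k q m0 calculation sub_self[of k] by auto
    ultimately show "q \<in> lab ` {..<i}" using k sub_self[OF assms]
      by (metis image_eqI lessThan_iff linorder_neqE_nat)
  qed
  have "lo i \<le> card (lab ` {..<i})" using card_mono[OF _ 2] by simp
  also have "\<dots> \<le> i" using card_image_le[of "{..<i}" lab] by simp
  finally show "lo i \<le> i" .
qed

text \<open>Here \<open>T\<close> is the first right child, or the end of the subtree if there is
  none. The vertices of \<open>sub i\<close> labelled below \<open>lab i\<close> are those of the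
  subtrees of left children, that is the ranks from \<open>Suc i\<close> to \<open>T - 1\<close>.
  Counting them gives \<open>lab i - lo i = T - Suc i\<close>, and \<open>lo_bounds\<close> turns
  this into an estimate of \<open>lab i\<close> by a first passage time.\<close>

lemma lab_between_children:
  assumes "i < n"
  defines "L \<equiv> card {c \<in> ch i. lab c < lab i}"
  obtains T where "i < T" "T \<le> n" "walk T = walk (Suc i) - int L"
    "\<And>m. i < m \<Longrightarrow> m < T \<Longrightarrow> walk T < walk m" "lab i < T" "T \<le> Suc (lab i + H)"
proof -
  define R where "R = {c \<in> ch i. lab i < lab c}"
  define T where "T = (if R = {} then i + sz i else Min R)"
  have finR: "finite R" by (auto simp: R_def)
  have TR: "T \<in> R" if "R \<noteq> {}" using that finR by (simp add: T_def)
  have labne: "lab c \<noteq> lab i" if "c \<in> ch i" for c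
    using that lab_inj[of c i] assms(1) sub_ch[of i c] by (auto simp: ch_def)
  have iT: "i < T" "T \<le> i + sz i"
    using TR sub_ch[OF assms(1), of T] sz_pos[OF assms(1)]
    by (cases "R = {}"; auto simp: T_def R_def)+
  have cut: False if "T \<le> m" "m < n" "i < par m" "par m < T" for m
  proof (cases "R = {}")
    case True
    then show False using sub_par[of i m] that assms(1) by (auto simp: T_def)
  next
    case False
    then show False using child_is_cut[OF assms(1), of T m] TR that by (auto simp: R_def)
  qed
  have ltT: "lab c < lab i \<longleftrightarrow> c < T" if c: "c \<in> ch i" for c
  proof
    assume l: "lab c < lab i"
    show "c < T"
    proof (cases "R = {}")
      case True
      then show ?thesis using sub_ch[OF assms(1) c] by (auto simp: T_def)
    next
      case False
      have T: "T \<in> ch i" "lab i < lab T" using TR[OF False] by (auto simp: R_def)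
      show ?thesis
      proof (rule ccontr)
        assume "\<not> c < T"
        then have "T < c \<or> T = c" by auto
        then have "lab T \<le> lab c" using siblings[of T c] T c by (auto simp: ch_def)
        then show False using T l by simp
      qed
    qed
  next
    assume "c < T"
    show "lab c < lab i"
    proof (rule ccontr)
      assume "\<not> lab c < lab i"
      then have "c \<in> R" using labne[OF c] c by (auto simp: R_def)
      then show False using \<open>c < T\<close> finR Min_le[of R c] by (auto simp: T_def split: if_splits)
    qed
  qed
  have eqL: "{c \<in> ch i. lab c < lab i} = {c \<in> ch i. c < T}" using ltT by auto
  have w1: "walk T = walk (Suc i) - int (card {c \<in> ch i. c < T})"
    by (rule walk_at_cut(1)[OF assms(1) iT]) (rule cut)
  have w2: "walk T < walk m" if "i < m" "m < T" for m
    by (rule walk_at_cut(2)[OF assms(1) iT _ that]) (rule cut)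
  have subn: "sub i \<subseteq> {..<n}" using sz_le[OF assms(1)] by auto
  have key: "lab m < lab i \<longleftrightarrow> m < T" if m: "m \<in> sub i" "m \<noteq> i" for m
  proof -
    obtain c where c: "c \<in> ch i" "m \<in> sub c" "c \<le> m" using child_above[OF assms(1) m] .
    have cn: "c < n" using c by (auto simp: ch_def)
    have ic: "i \<notin> sub c" using sub_ch[OF assms(1) c(1)] by auto
    have "lab m < lab i \<longleftrightarrow> lab c < lab i"
      using lab_convex_sep[OF cn assms(1) ic _ c(2)] lab_convex_sep'[OF cn assms(1) ic _ c(2)]
        labne[OF c(1)] by force
    also have "\<dots> \<longleftrightarrow> c < T" using ltT c by simp
    also have "\<dots> \<longleftrightarrow> m < T"
    proof
      assume cT: "c < T"
      show "m < T"
      proof (cases "R = {}")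
        case True then show ?thesis using m by (simp add: T_def)
      next
        case False
        have T: "T \<in> ch i" "T < n" "0 < T" using TR[OF False] by (auto simp: R_def ch_def)
        have "T \<notin> sub c" using sub_par[of c T] T cT cn ic by (auto simp: ch_def)
        then show ?thesis using c cT by auto
      qed
    qed (use c in auto)
    finally show ?thesis .
  qed
  have "{lo i..<lab i} = lab ` {Suc i..<T}"
  proof (rule set_eqI, rule iffI)
    fix q assume "q \<in> {lo i..<lab i}"
    moreover have "lab i \<in> {lo i..<lo i + sz i}" using lab_sub[OF assms(1)] sub_self[OF assms(1)] by blast
    ultimately have "q \<in> lab ` sub i" "q < lab i" using lab_sub[OF assms(1)] by auto
    then obtain m where m: "m \<in> sub i" "lab m = q" by auto
    then have "m \<noteq> i" using \<open>q < lab i\<close> by auto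
    then show "q \<in> lab ` {Suc i..<T}" using key[OF m(1)] m \<open>q < lab i\<close>
      by (metis Suc_leI atLeastLessThan_iff image_eqI le_neq_implies_less)
  next
    fix q assume "q \<in> lab ` {Suc i..<T}"
    then obtain m where m: "m \<in> {Suc i..<T}" "q = lab m" by auto
    then have "m \<in> sub i" "m \<noteq> i" using iT by auto
    then have "q \<in> {lo i..<lo i + sz i}" using m lab_sub[OF assms(1)] by blast
    then show "q \<in> {lo i..<lab i}" using key[OF \<open>m \<in> sub i\<close> \<open>m \<noteq> i\<close>] m by auto
  qed
  moreover have "inj_on lab {Suc i..<T}" using lab_inj iT sz_le[OF assms(1)] by (auto simp: inj_on_def)
  ultimately have "lab i - lo i = T - Suc i" by (metis card_atLeastLessThan card_image)
  moreover have "lo i \<le> lab i" using lab_sub[OF assms(1)] sub_self[OF assms(1)]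
    by (metis atLeastLessThan_iff image_eqI)
  ultimately have "lab i + Suc i = lo i + T" using iT by simp
  then have "lab i < T" "T \<le> Suc (lab i + H)" using lo_bounds[OF assms(1)] by auto
  then show thesis using that[of T] w1 w2 iT sz_le[OF assms(1)] eqL by (auto simp: L_def)
qed

text \<open>The labels of \<open>sub i - sub j\<close> fill the two gaps on either side of the inner
  interval, and both are nonempty. Since \<open>par\<close> maps this set, except \<open>i\<close>,
  into itself, \<open>edge_between\<close> finds an edge from one gap to the other.\<close>

lemma connecting_edge:
  assumes "i < j" "j < n" "j + sz j < i + sz i" "lo i < lo j" "lo j + sz j < lo i + sz i"
  obtains q r where "{q, r} \<in> E" "lo i \<le> q" "q < lo j" "lo j + sz j \<le> r" "r < lo i + sz i"
proof -
  let ?A = "sub i - sub j"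
  have i: "i < n" using assms by simp
  have step: "0 < m \<and> m < n \<and> par m \<in> ?A" if m: "m \<in> ?A" "m \<noteq> i" for m
  proof -
    have "0 < m" "m < n" using m sz_le[OF i] by auto
    moreover have "m \<noteq> j" using m sub_self[of j] assms by auto
    ultimately show ?thesis using m sub_par[of i m] sub_par[of j m] i assms by auto
  qed
  have inj: "lab ` ?A = {lo i..<lo i + sz i} - {lo j..<lo j + sz j}"
  proof -
    have "inj_on lab (sub i)" using lab_inj sz_le[OF i] by (auto simp: inj_on_def)
    moreover have "sub j \<subseteq> sub i" using assms by auto
    ultimately show ?thesis using lab_sub i assms by (subst inj_on_image_set_diff[of _ "sub i"]) auto
  qed
  have "lo i \<in> lab ` ?A" unfolding inj using assms by auto
  then obtain m1 where m1: "m1 \<in> ?A" "lab m1 = lo i" by (metis imageE)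
  have "lo j + sz j \<in> lab ` ?A" unfolding inj using assms by auto
  then obtain m2 where m2: "m2 \<in> ?A" "lab m2 = lo j + sz j" by (metis imageE)
  let ?Q = "\<lambda>m. lab m < lo j"
  have "?Q m1 \<noteq> ?Q i \<or> ?Q m2 \<noteq> ?Q i" using m1 m2 assms by auto
  moreover have "i \<in> ?A" using assms sub_self[OF i] by auto
  ultimately obtain m where m: "m \<in> ?A" "m \<noteq> i" "?Q m \<noteq> ?Q (par m)"
    using edge_between[of i ?A m1 ?Q] edge_between[of i ?A m2 ?Q] step m1 m2 by metis
  have pm: "par m \<in> ?A" "0 < m" "m < n" using step m by auto
  have "lab m \<in> {lo i..<lo i + sz i} - {lo j..<lo j + sz j}"
    "lab (par m) \<in> {lo i..<lo i + sz i} - {lo j..<lo j + sz j}"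
    using m pm inj by blast+
  moreover have "{lab m, lab (par m)} \<in> E" "{lab (par m), lab m} \<in> E"
    using edge[of m] pm by (auto simp: insert_commute)
  ultimately show thesis using m(3) that[of "lab m" "lab (par m)"] that[of "lab (par m)" "lab m"]
    by (cases "lab m < lo j") auto
qed

end

section \<open>Chords of the circle\<close>

text \<open>The expression is twice the area of the triangle inscribed in the unit circle with
  consecutive arcs \<open>p\<close> and \<open>q\<close>.\<close>

lemma sin_triple_pos:
  fixes p q :: real
  assumes "0 < p" "0 < q" "p + q < 2 * pi"
  shows "0 < sin p + sin q - sin (p + q)"
proof -
  have pq: "p / 2 + q / 2 = (p + q) / 2" by simp
  have "sin p + sin q - sin (p + q) = 4 * sin (p / 2) * sin (q / 2) * sin (p / 2 + q / 2)"
  proof -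
    have 1: "sin p = 2 * sin (p/2) * cos (p/2)" "sin q = 2 * sin (q/2) * cos (q/2)"
      "cos p = 1 - 2 * (sin (p/2))\<^sup>2" "cos q = 1 - 2 * (sin (q/2))\<^sup>2"
      using sin_double[of "p/2"] sin_double[of "q/2"] cos_double_sin[of "p/2"] cos_double_sin[of "q/2"] by auto
    show ?thesis unfolding sin_add 1 by (simp add: algebra_simps power2_eq_square)
  qed
  moreover have "0 < sin (p / 2)" "0 < sin (q / 2)" "0 < sin (p / 2 + q / 2)"
    unfolding pq by (rule sin_gt_zero; use assms in simp)+
  ultimately show ?thesis by simp
qed

lemma convex_comb_in_segment:
  fixes x y :: "'a::real_vector"
  assumes "a + b = 1" "0 \<le> a" "0 \<le> b" shows "a *\<^sub>R x + b *\<^sub>R y \<in> closed_segment x y"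
proof -
  have "a = 1 - b" using assms by simp
  then show ?thesis unfolding closed_segment_def using assms by (intro CollectI exI[of _ b]) auto
qed

lemma chords_cross:
  fixes a b c d :: real
  assumes "a < b" "b < c" "c < d" "d < a + 2 * pi"
  shows "closed_segment (cis a) (cis c) \<inter> closed_segment (cis b) (cis d) \<noteq> {}"
proof -
  \<comment> \<open>Twice the signed area of the triangle with these angles. The quadrilateral has
    two splittings by a diagonal, hence the two expressions for \<open>w\<close>; the affine
    relation \<open>bary\<close> between its corners has the triangle areas as coefficients and
    gives the crossing point.\<close>
  define tri where "tri x y z = sin (y - x) + sin (z - y) + sin (x - z)" for x y z :: real
  have pos: "0 < tri x y z" if "x < y" "y < z" "z < x + 2 * pi" for x y z
    using sin_triple_pos[of "y - x" "z - y"] sin_minus[of "z - x"] that by (simp add: tri_def)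
  define w where "w = tri b c d + tri a b d"
  have w: "w = tri a c d + tri a b c"
    unfolding w_def tri_def by (simp add: sin_diff algebra_simps)
  have p: "0 < tri b c d" "0 < tri a b d" "0 < tri a c d" "0 < tri a b c"
    using assms by (auto intro!: pos)
  then have w0: "0 < w" by (simp add: w_def)
  have bary: "tri b c d *\<^sub>R cis a + tri a b d *\<^sub>R cis c = tri a c d *\<^sub>R cis b + tri a b c *\<^sub>R cis d"
    by (rule complex_eqI) (simp_all add: tri_def sin_diff algebra_simps)
  define z where "z = (1 / w) *\<^sub>R (tri b c d *\<^sub>R cis a + tri a b d *\<^sub>R cis c)"
  have "z = (tri b c d / w) *\<^sub>R cis a + (tri a b d / w) *\<^sub>R cis c"
    by (simp add: z_def scaleR_add_right)
  moreover have "tri b c d / w + tri a b d / w = 1" using w0 by (simp add: w_def flip: add_divide_distrib)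
  ultimately have "z \<in> closed_segment (cis a) (cis c)"
    using p w0 by (simp add: convex_comb_in_segment)
  moreover have "z = (tri a c d / w) *\<^sub>R cis b + (tri a b c / w) *\<^sub>R cis d"
    unfolding z_def bary by (simp add: scaleR_add_right)
  moreover have "tri a c d / w + tri a b c / w = 1" using w0 w by (simp flip: add_divide_distrib)
  ultimately have "z \<in> closed_segment (cis a) (cis c) \<inter> closed_segment (cis b) (cis d)"
    using p w0 by (simp add: convex_comb_in_segment)
  then show ?thesis by blast
qed

section \<open>The shape of a noncrossing tree\<close>

text \<open>Acyclicity in \<open>graph_tree\<close> speaks of distinct vertices, so loops have to be
  cut out: when the new head already occurs in the path, the part before its occurrence is
  dropped.\<close>

lemma rtrancl_distinct_path:
  assumes "(x, y) \<in> R\<^sup>*"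
  obtains c where "c \<noteq> []" "distinct c" "hd c = x" "last c = y"
    "\<And>i. Suc i < length c \<Longrightarrow> (c ! i, c ! Suc i) \<in> R"
proof -
  have "\<exists>c. c \<noteq> [] \<and> distinct c \<and> hd c = x \<and> last c = y \<and> (\<forall>i. Suc i < length c \<longrightarrow> (c ! i, c ! Suc i) \<in> R)"
    using assms
  proof (induction rule: converse_rtrancl_induct)
    case base
    show ?case by (intro exI[of _ "[y]"]) simp
  next
    case (step x z)
    then obtain c where c: "c \<noteq> []" "distinct c" "hd c = z" "last c = y"
      "\<forall>i. Suc i < length c \<longrightarrow> (c ! i, c ! Suc i) \<in> R" by blast
    show ?case
    proof (cases "x \<in> set c")
      case True
      then obtain k where k: "k < length c" "c ! k = x" by (auto simp: in_set_conv_nth)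
      show ?thesis
        by (intro exI[of _ "drop k c"]) (use c k in \<open>auto simp: hd_drop_conv_nth\<close>)
    next
      case False
      have "(((x # c) ! i), ((x # c) ! Suc i)) \<in> R" if "Suc i < length (x # c)" for i
        using c step.hyps(1) that by (cases i) (auto simp: hd_conv_nth)
      then show ?thesis using c False by (intro exI[of _ "x # c"]) auto
    qed
  qed
  then show thesis using that by blast
qed

lemma prefix_le_list: "prefix u v \<Longrightarrow> u \<le> (v :: nat list)"
proof (induction u arbitrary: v)
  case (Cons a u)
  then show ?case by (cases v) auto
qed simp

lemma append_less_of_not_prefix: "u < v \<Longrightarrow> \<not> prefix u v \<Longrightarrow> u @ x < (v :: nat list)"
proof (induction u arbitrary: v)
  case (Cons a u)
  then show ?case by (cases v) auto
qed simp

locale nc_tree =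
  fixes n :: nat and E :: "nat set set"
  assumes nc: "noncrossing_tree n E"
begin

abbreviation "depth \<equiv> root_distance E"
abbreviation "kids \<equiv> children_labels E"
abbreviation "tree \<equiv> shape E"
abbreviation "lbl \<equiv> label_of E"

lemma n_pos: "0 < n" and edges: "E \<subseteq> {{p, q} | p q. p < n \<and> q < n \<and> p \<noteq> q}"
  and conn: "p < n \<Longrightarrow> q < n \<Longrightarrow> (p, q) \<in> (adjacent E)\<^sup>*"
  and acyc: "3 \<le> length c \<Longrightarrow> distinct c \<Longrightarrow>
    (\<And>i. i < length c \<Longrightarrow> {c ! i, c ! (Suc i mod length c)} \<in> E) \<Longrightarrow> False"
  and disj: "{p, q} \<in> E \<Longrightarrow> {r, s} \<in> E \<Longrightarrow> {p, q} \<noteq> {r, s} \<Longrightarrow>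
    edge_segment n p q \<inter> edge_segment n r s \<subseteq> unity_vertex n ` ({p, q} \<inter> {r, s})"
  using nc unfolding noncrossing_tree_def graph_tree_def by blast+

lemma edgeD: assumes "{p, q} \<in> E" shows "p < n" "q < n" "p \<noteq> q"
  using edges assms by (auto simp: doubleton_eq_iff)

lemma adjacent_iff: "(p, q) \<in> adjacent E \<longleftrightarrow> {p, q} \<in> E"
  by (simp add: adjacent_def)

lemma depth_path: assumes "p < n" shows "(0, p) \<in> adjacent E ^^ depth p"
proof -
  have "\<exists>d. (0, p) \<in> adjacent E ^^ d" using conn[OF n_pos assms] by (simp add: rtrancl_power)
  then show ?thesis unfolding root_distance_def by (rule LeastI_ex)
qed

lemma depth_le: "(0, p) \<in> adjacent E ^^ d \<Longrightarrow> depth p \<le> d"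
  unfolding root_distance_def by (rule Least_le)

lemma depth_0 [simp]: "depth 0 = 0"
  using depth_le[of 0 0] by simp

lemma depth_eq_0: assumes "p < n" shows "depth p = 0 \<longleftrightarrow> p = 0"
proof
  assume "depth p = 0"
  then have "(0, p) \<in> adjacent E ^^ 0" using depth_path[OF assms] by metis
  then show "p = 0" by simp
qed simp

lemma depth_edge: assumes "{p, q} \<in> E" shows "depth q \<le> Suc (depth p)"
proof (rule depth_le)
  have "(p, q) \<in> adjacent E" using assms by (simp add: adjacent_iff)
  with depth_path[OF edgeD(1)[OF assms]] show "(0, q) \<in> adjacent E ^^ Suc (depth p)"
    by (rule relpow_Suc_I)
qed

lemma parent_exists:
  assumes "p < n" "p \<noteq> 0"
  obtains q where "{q, p} \<in> E" "depth p = Suc (depth q)"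
proof -
  obtain d where d: "depth p = Suc d" using assms depth_eq_0 by (metis not0_implies_Suc)
  then obtain q where q: "(0, q) \<in> adjacent E ^^ d" "{q, p} \<in> E"
    using depth_path[OF assms(1)] by (auto simp: adjacent_iff)
  then have "depth q \<le> d" "depth p \<le> Suc (depth q)" using depth_le depth_edge by auto
  then show thesis using that q d by auto
qed

text \<open>Both neighbours can go to the root through vertices of smaller depth, which avoids
  \<open>p\<close>. So they are joined by a path avoiding \<open>p\<close>, and closing it at
  \<open>p\<close> gives a cycle with at least three vertices. Equal depths are allowed.\<close>

lemma parent_unique:
  assumes e: "{q, p} \<in> E" "{q', p} \<in> E" and d: "depth q \<le> depth p" "depth q' \<le> depth p"
  shows "q = q'"
proof (rule ccontr)
  assume ne: "q \<noteq> q'"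
  define R where "R = {(a, b). {a, b} \<in> E \<and> a \<noteq> p \<and> b \<noteq> p}"
  have "depth v \<le> depth p \<Longrightarrow> v \<noteq> p \<Longrightarrow> v < n \<Longrightarrow> (v, 0) \<in> R\<^sup>*" for v
  proof (induction "depth v" arbitrary: v rule: less_induct)
    case less
    show ?case
    proof (cases "v = 0")
      case False
      then obtain w where w: "{w, v} \<in> E" "depth v = Suc (depth w)"
        using parent_exists less.prems by blast
      then have "w < n" "w \<noteq> p" using edgeD[OF w(1)] less.prems by auto
      then have "(w, 0) \<in> R\<^sup>*" using less.hyps[of w] w less.prems by simp
      moreover have "(v, w) \<in> R" using w less.prems \<open>w \<noteq> p\<close> by (simp add: R_def insert_commute)
      ultimately show ?thesis by (metis converse_rtrancl_into_rtrancl)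
    qed simp
  qed
  then have q0: "(q, 0) \<in> R\<^sup>*" "(q', 0) \<in> R\<^sup>*" using e d edgeD by blast+
  have "sym R" by (auto simp: R_def sym_def insert_commute)
  then have "(0, q') \<in> R\<^sup>*" using q0 sym_rtrancl by (blast dest: symD)
  with q0 have "(q, q') \<in> R\<^sup>*" by simp
  then obtain c where c: "c \<noteq> []" "distinct c" "hd c = q" "last c = q'"
    and cR: "\<And>i. Suc i < length c \<Longrightarrow> (c ! i, c ! Suc i) \<in> R"
    by (rule rtrancl_distinct_path) blast
  have len: "2 \<le> length c"
    using c ne by (cases c; cases "tl c") auto
  have "c ! i \<noteq> p" if "i < length c" for i
    using that cR[of i] cR[of "i - 1"] len by (cases "Suc i < length c"; cases i) (auto simp: R_def)
  then have "p \<notin> set c" by (metis in_set_conv_nth)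
  have "{(p # c) ! i, (p # c) ! (Suc i mod length (p # c))} \<in> E" if i: "i < length (p # c)" for i
  proof -
    consider "i = 0" | k where "i = Suc k" "Suc k < length c" | k where "i = Suc k" "Suc k = length c"
      using i by (cases i) (auto simp: less_Suc_eq)
    then show ?thesis
    proof cases
      case 1 then show ?thesis using c e len by (simp add: hd_conv_nth insert_commute)
    next
      case 2 then show ?thesis using cR[of k] by (simp add: R_def)
    next
      case 3
      then have "c ! k = q'" using c(1,4) last_conv_nth[of c] by (metis 3(2) diff_Suc_1)
      moreover have "(p # c) ! i = c ! k" "Suc i mod length (p # c) = 0"
        by (simp_all add: 3(1) flip: 3(2))
      ultimately show ?thesis using e by simp
    qed
  qed
  then show False using acyc[of "p # c"] len c \<open>p \<notin> set c\<close> by auto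
qed

lemma kids_iff: "q \<in> kids p \<longleftrightarrow> {p, q} \<in> E \<and> depth q = Suc (depth p)"
  by (simp add: children_labels_def)

lemma kids_less: "q \<in> kids p \<Longrightarrow> q < n"
  using edgeD(2)[of p q] by (simp add: kids_iff)

lemma finite_kids [simp]: "finite (kids p)"
  by (rule finite_subset[of _ "{..<n}"]) (use kids_less in auto)

lemma lbl_Nil [simp]: "lbl [] = 0" by (simp add: label_of_def)

lemma lbl_snoc [simp]: "lbl (u @ [j]) = sorted_list_of_set (kids (lbl u)) ! j"
  by (simp add: label_of_def)

lemma Nil_in_tree [simp]: "[] \<in> tree" by (simp add: shape_def)

lemma snoc_in_tree: "u @ [j] \<in> tree \<longleftrightarrow> u \<in> tree \<and> j < card (kids (lbl u))"
  by (auto simp: shape_def nth_append less_Suc_eq)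

lemma lbl_kid: "u @ [j] \<in> tree \<Longrightarrow> lbl (u @ [j]) \<in> kids (lbl u)"
  using nth_mem[of j "sorted_list_of_set (kids (lbl u))"]
  by (simp add: snoc_in_tree del: nth_mem)

lemma lbl_less_depth: "u \<in> tree \<Longrightarrow> lbl u < n \<and> depth (lbl u) = length u"
proof (induction u rule: rev_induct)
  case (snoc j u)
  then have "lbl (u @ [j]) \<in> kids (lbl u)" by (intro lbl_kid)
  then show ?case using snoc by (auto simp: kids_iff snoc_in_tree dest: edgeD)
qed (simp add: n_pos)

lemma lbl_inj: "u \<in> tree \<Longrightarrow> v \<in> tree \<Longrightarrow> lbl u = lbl v \<Longrightarrow> u = v"
proof (induction u arbitrary: v rule: rev_induct)
  case Nil
  then show ?case using lbl_less_depth[of v] by simp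
next
  case (snoc j u)
  have "length v = Suc (length u)" using lbl_less_depth[OF snoc.prems(1)] lbl_less_depth[OF snoc.prems(2)] snoc.prems(3)
    by simp
  then obtain v' k where v: "v = v' @ [k]" by (cases v rule: rev_cases) auto
  have kd: "lbl (u @ [j]) \<in> kids (lbl u)" "lbl (u @ [j]) \<in> kids (lbl v')"
    using lbl_kid snoc.prems v by metis+
  have "lbl u = lbl v'"
    using parent_unique[of "lbl u" "lbl (u @ [j])" "lbl v'"] kd unfolding kids_iff by simp
  moreover have "u \<in> tree" "v' \<in> tree" using snoc.prems v by (auto simp: snoc_in_tree)
  ultimately have "u = v'" using snoc.IH by blast
  then show ?case using snoc.prems v distinct_sorted_list_of_set[of "kids (lbl u)"]
    by (simp add: snoc_in_tree nth_eq_iff_index_eq)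
qed

lemma lbl_surj: "q < n \<Longrightarrow> \<exists>u\<in>tree. lbl u = q"
proof (induction "depth q" arbitrary: q)
  case 0
  then have "q = 0" using depth_eq_0 by auto
  then show ?case by (intro bexI[of _ "[]"]) auto
next
  case (Suc d)
  then have "q \<noteq> 0" by (metis depth_0 nat.distinct(1))
  then obtain p where p: "{p, q} \<in> E" "depth q = Suc (depth p)" using parent_exists Suc.prems by blast
  then obtain u where u: "u \<in> tree" "lbl u = p" using Suc edgeD[OF p(1)] by auto
  have "q \<in> set (sorted_list_of_set (kids p))" using p by (simp add: kids_iff)
  then obtain j where "j < card (kids p)" "sorted_list_of_set (kids p) ! j = q"
    by (metis in_set_conv_nth length_sorted_list_of_set)
  then show ?case using u by (intro bexI[of _ "u @ [j]"]) (auto simp: snoc_in_tree)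
qed

lemma lbl_bij: "bij_betw lbl tree {..<n}"
  unfolding bij_betw_def inj_on_def using lbl_inj lbl_surj lbl_less_depth by (fastforce simp: image_iff)

lemma finite_tree [simp]: "finite tree" and card_tree: "card tree = n"
  using bij_betw_finite[OF lbl_bij] bij_betw_same_card[OF lbl_bij] by auto

lemma num_children_eq: "u \<in> tree \<Longrightarrow> num_children tree u = card (kids (lbl u))"
  unfolding num_children_def by (simp add: snoc_in_tree)


section \<open>Depth-first ranks of the vertices of the shape\<close>

abbreviation "vx \<equiv> lex_vertex tree"

lemma lex_bij: "bij_betw (vx) {..<n} tree"
  using bij_betw_nth[of "sorted_list_of_set tree" "{..<n}" tree] card_tree
  by (simp add: lex_vertex_def[abs_def])

lemma lex_in_tree: "i < n \<Longrightarrow> vx i \<in> tree"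
  using lex_bij by (auto simp: bij_betw_def)

lemma lex_less_iff: "i < n \<Longrightarrow> j < n \<Longrightarrow> vx i < vx j \<longleftrightarrow> i < j"
  using strict_sorted_list_of_set[of tree] card_tree unfolding lex_vertex_def
  by (metis length_sorted_list_of_set linorder_neqE_nat not_less_iff_gr_or_eq sorted_wrt_nth_less)

lemma lex_le_iff: "i < n \<Longrightarrow> j < n \<Longrightarrow> vx i \<le> vx j \<longleftrightarrow> i \<le> j"
  using lex_less_iff[of j i] by (simp flip: not_less)

definition lex_rank :: "nat list \<Rightarrow> nat" where "lex_rank = inv_into {..<n} (vx)"

lemma lex_rank: assumes "u \<in> tree" shows "lex_rank u < n" "vx (lex_rank u) = u"
proof -
  have u: "u \<in> vx ` {..<n}" using lex_bij assms by (simp add: bij_betw_def)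
  show "lex_rank u < n" "vx (lex_rank u) = u"
    using inv_into_into[OF u] f_inv_into_f[OF u] by (auto simp: lex_rank_def)
qed

lemma lex_0: "vx 0 = []"
proof -
  have "lex_rank [] = 0 \<or> vx 0 < []"
    using lex_rank[OF Nil_in_tree] lex_less_iff[of 0 "lex_rank []"] n_pos by auto
  then show ?thesis using lex_rank[OF Nil_in_tree] by auto
qed

definition lex_parent :: "nat \<Rightarrow> nat" where
  "lex_parent j = lex_rank (butlast (vx j))"

definition sub_size :: "nat \<Rightarrow> nat" where
  "sub_size i = card {j. j < n \<and> prefix (vx i) (vx j)}"

lemma lex_nonroot:
  assumes "0 < j" "j < n"
  obtains u k where "vx j = u @ [k]" "u \<in> tree" "vx (lex_parent j) = u"
    "lex_parent j < n"
proof -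
  have "vx j \<noteq> []" using lex_less_iff[of 0 j] assms lex_0 by auto
  then obtain u k where u: "vx j = u @ [k]" by (cases "vx j" rule: rev_cases) auto
  moreover have "u \<in> tree" using lex_in_tree[OF assms(2)] u by (simp add: snoc_in_tree)
  ultimately show thesis using that lex_rank[of u] by (simp add: lex_parent_def)
qed

text \<open>A word lying lexicographically between \<open>u\<close> and an extension of
  \<open>u\<close> is itself an extension of \<open>u\<close>.\<close>

lemma subtree_interval:
  assumes "i < n"
  shows "{j. j < n \<and> prefix (vx i) (vx j)} = {i..<i + sub_size i}"
proof -
  let ?P = "{j. j < n \<and> prefix (vx i) (vx j)}"
  have iP: "i \<in> ?P" using assms by simp
  have ge: "i \<le> j" if "j \<in> ?P" for j
    using that lex_le_iff[OF assms, of j] prefix_le_list by auto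
  have "?P = {Min ?P..<Min ?P + card ?P}"
  proof (rule convex_nat_set_eq_interval)
    fix a b c assume abc: "a \<in> ?P" "c \<in> ?P" "a < b" "b < c"
    obtain x where x: "vx c = vx i @ x" using abc by (auto simp: prefix_def)
    have "vx i < vx b" "vx b < vx c"
      using lex_less_iff[OF assms, of b] lex_less_iff[of b c] ge[OF abc(1)] abc by auto
    then show "b \<in> ?P" using append_less_of_not_prefix[of "vx i" "vx b" x] abc x
      by (auto dest: less_asym)
  qed (use iP in auto)
  moreover have "Min ?P = i" by (rule Min_eqI) (use ge iP in auto)
  ultimately show ?thesis by (simp add: sub_size_def)
qed

lemma subtree_iff:
  "i < n \<Longrightarrow> j < n \<Longrightarrow> j \<in> {i..<i + sub_size i} \<longleftrightarrow> prefix (vx i) (vx j)"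
  using subtree_interval[of i] by blast

abbreviation vlab :: "nat \<Rightarrow> nat" where "vlab i \<equiv> lbl (vx i)"

lemma vlab_kid: assumes "0 < j" "j < n" shows "vlab j \<in> kids (vlab (lex_parent j))"
  using lex_nonroot[OF assms] lbl_kid lex_in_tree[OF assms(2)] by metis

lemma edges_not_crossing:
  assumes "{a, b} \<in> E" "{c, d} \<in> E" "a < c" "c < b" "b < d" shows False
proof -
  define f where "f p = - 2 * pi * real p / real n" for p
  have mono: "f q < f p" if "p < q" for p q
    using that n_pos by (simp add: f_def divide_strict_right_mono)
  have "f a < f d + 2 * pi"
  proof -
    have "real d / real n < 1 + real a / real n"
      using edgeD[OF assms(2)] n_pos by (simp add: divide_simps)
    then have "2 * pi * (real d / real n) < 2 * pi * (1 + real a / real n)"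
      by (intro mult_strict_left_mono) auto
    then show ?thesis by (simp add: f_def algebra_simps)
  qed
  \<comment> \<open>The angles decrease as the labels grow, so the four points are passed in the
    order \<open>d\<close>, \<open>c\<close>, \<open>b\<close>, \<open>a\<close>.\<close>
  then have "closed_segment (cis (f d)) (cis (f c)) \<inter> closed_segment (cis (f b)) (cis (f a)) \<noteq> {}"
    using mono assms by (intro chords_cross) auto
  then have "edge_segment n a b \<inter> edge_segment n c d \<noteq> {}"
    by (auto simp: edge_segment_def unity_vertex_def f_def closed_segment_commute)
  moreover have "{a, b} \<inter> {c, d} = {}" "{a, b} \<noteq> {c, d}" using assms by auto
  ultimately show False using disj[OF assms(1,2)] by auto
qed

sublocale rt: ranked_tree n lex_parent sub_size vlab E "height tree"
proof
  show "0 < n" by (rule n_pos)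
next
  fix j assume j: "0 < j" "j < n"
  obtain u k where u: "vx j = u @ [k]" "u \<in> tree" "vx (lex_parent j) = u"
    "lex_parent j < n" using lex_nonroot[OF j] .
  have "u \<le> u @ [k]" by (rule prefix_le_list) simp
  then have "u < u @ [k]" by (simp add: less_le)
  then show "lex_parent j < j" using lex_less_iff[OF u(4) j(2)] u by simp
  show "{vlab j, vlab (lex_parent j)} \<in> E"
    using vlab_kid[OF j] by (simp add: kids_iff insert_commute)
next
  fix i assume i: "i < n"
  show "0 < sub_size i"
    unfolding sub_size_def using i by (subst card_gt_0_iff) auto
  then have "i + sub_size i - 1 \<in> {i..<i + sub_size i}" by auto
  then show "i + sub_size i \<le> n" unfolding subtree_interval[OF i, symmetric] by auto
next
  fix i j assume ij: "i < n" "j < n" "0 < j" "i \<noteq> j"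
  obtain u k where u: "vx j = u @ [k]" "u \<in> tree" "vx (lex_parent j) = u"
    "lex_parent j < n" using lex_nonroot[OF ij(3,2)] .
  have "vx i \<noteq> vx j" using lex_less_iff ij by (metis linorder_neqE_nat less_irrefl)
  then show "j \<in> {i..<i + sub_size i} \<longleftrightarrow> lex_parent j \<in> {i..<i + sub_size i}"
    using subtree_iff ij u by simp
next
  show "bij_betw vlab {..<n} {..<n}"
    using bij_betw_trans[OF lex_bij lbl_bij] by (simp add: comp_def)
  show "vlab 0 = 0" by (simp add: lex_0)
next
  fix a b c d assume "{a, b} \<in> E" "{c, d} \<in> E" "a < c" "c < b" "b < d"
  then show False by (rule edges_not_crossing)
next
  fix c c' assume c: "0 < c" "c < c'" "c' < n" "lex_parent c = lex_parent c'"
  have cn: "c < n" "0 < c'" using c by auto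
  obtain u k where u: "vx c = u @ [k]" "u \<in> tree" "vx (lex_parent c) = u"
    using lex_nonroot[OF c(1) cn(1)] by blast
  obtain u' k' where u': "vx c' = u' @ [k']" "vx (lex_parent c') = u'"
    using lex_nonroot[OF cn(2) c(3)] by blast
  have "u' = u" using u u' c by simp
  have "u @ [k] < u @ [k']" using lex_less_iff[OF cn(1) c(3)] u u' c \<open>u' = u\<close> by simp
  then have "k < k'" by (induction u) auto
  moreover have "k' < card (kids (lbl u))"
    using lex_in_tree[OF c(3)] u' \<open>u' = u\<close> by (simp add: snoc_in_tree)
  ultimately show "vlab c < vlab c'"
    using u u' \<open>u' = u\<close> strict_sorted_list_of_set[of "kids (lbl u)"] by (simp add: sorted_wrt_nth_less)
next
  fix i assume i: "i < n"
  let ?A = "{a. a < i \<and> i < a + sub_size a}"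
  have pre: "prefix (vx a) (vx i)" "a < n" "a \<noteq> i" if "a \<in> ?A" for a
    using that i subtree_iff[of a i] by auto
  \<comment> \<open>An ancestor is a prefix of the word of \<open>i\<close>, hence determined by its
    length; the number of ancestors is at most the generation of \<open>i\<close>.\<close>
  have inj: "inj_on (\<lambda>a. length (vx a)) ?A"
  proof (rule inj_onI)
    fix a b assume ab: "a \<in> ?A" "b \<in> ?A" "length (vx a) = length (vx b)"
    then have "vx a = vx b"
      using pre(1)[OF ab(1)] pre(1)[OF ab(2)] by (metis append_eq_conv_conj prefix_def)
    then show "a = b" using lex_less_iff pre(2) ab by (metis linorder_neqE_nat less_irrefl)
  qed
  have "(\<lambda>a. length (vx a)) ` ?A \<subseteq> {..<length (vx i)}"
  proof safe
    fix a assume a: "a < i" "i < a + sub_size a"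
    then have "vx a \<noteq> vx i" using lex_less_iff[of a i] i by auto
    then show "length (vx a) < length (vx i)"
      using pre(1)[of a] a prefix_length_less[of "vx a" "vx i"]
      by (simp add: strict_prefix_def)
  qed
  then have "card ((\<lambda>a. length (vx a)) ` ?A) \<le> card {..<length (vx i)}"
    by (rule card_mono[OF finite_lessThan])
  then have "card ?A \<le> length (vx i)"
    by (simp add: card_image[OF inj])
  also have "\<dots> \<le> height tree"
    unfolding height_def using lex_in_tree[OF i] by (intro Max_ge) auto
  finally show "card ?A \<le> height tree" .
qed

lemma kids_eq: assumes "i < n" shows "kids (vlab i) = vlab ` rt.ch i"
proof
  show "vlab ` rt.ch i \<subseteq> kids (vlab i)" using vlab_kid by (auto simp: rt.ch_def)
  show "kids (vlab i) \<subseteq> vlab ` rt.ch i"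
  proof
    fix q assume q: "q \<in> kids (vlab i)"
    then obtain c where c: "c < n" "vlab c = q" using rt.lab_surj[OF kids_less[OF q]] by blast
    have "c \<noteq> 0"
    proof
      assume "c = 0"
      then have "q = 0" using c lex_0 by simp
      then show False using q by (simp add: kids_iff)
    qed
    have k: "q \<in> kids (vlab (lex_parent c))" using vlab_kid[of c] c \<open>c \<noteq> 0\<close> by simp
    have e: "{vlab (lex_parent c), q} \<in> E" "{vlab i, q} \<in> E" using k q by (simp_all only: kids_iff)
    have "depth (vlab (lex_parent c)) \<le> depth q" "depth (vlab i) \<le> depth q"
      using k q unfolding kids_iff by linarith+
    with e have "vlab (lex_parent c) = vlab i" by (rule parent_unique)
    then have "lex_parent c = i"
      using rt.lab_inj[of "lex_parent c" i] rt.par_less[of c] c \<open>c \<noteq> 0\<close> assms by simp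
    then show "q \<in> vlab ` rt.ch i" using c \<open>c \<noteq> 0\<close> by (auto simp: rt.ch_def)
  qed
qed

lemma vlab_inj_ch: "inj_on vlab (rt.ch i)"
  using rt.lab_inj by (auto simp: inj_on_def rt.ch_def)

lemma num_children_rank: assumes "i < n" shows "num_children tree (vx i) = card (rt.ch i)"
  using num_children_eq[OF lex_in_tree[OF assms]] card_image[OF vlab_inj_ch]
  by (simp add: kids_eq[OF assms])

lemma num_left_children_rank:
  assumes "i < n"
  shows "num_left_children E (vx i) = card {c \<in> rt.ch i. vlab c < vlab i}"
proof -
  have "{q \<in> kids (vlab i). q < vlab i} = vlab ` {c \<in> rt.ch i. vlab c < vlab i}"
    unfolding kids_eq[OF assms] by auto
  moreover have "inj_on vlab {c \<in> rt.ch i. vlab c < vlab i}"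
    by (rule inj_on_subset[OF vlab_inj_ch]) auto
  ultimately show ?thesis by (simp add: num_left_children_def card_image)
qed

lemma luka_path_walk: "i \<le> n \<Longrightarrow> luka_path tree i = rt.walk i"
proof (induction i)
  case (Suc i)
  then show ?case using rt.walk_Suc[of i] num_children_rank[of i] by simp
qed (simp add: rt.walk_0)

end

section \<open>Excursions without negative jumps\<close>

text \<open>Compactness by bisection. Bounds are required only on the open sides of each point, as
  one-sided limits provide them; the value at the point itself is added in the proof.\<close>

lemma locally_bounded_imp_bounded:
  fixes f :: "real \<Rightarrow> real"
  assumes "s \<le> t"
    and R: "\<And>x. s \<le> x \<Longrightarrow> x < t \<Longrightarrow> \<exists>b>x. \<exists>M. \<forall>v\<in>{x<..<b}. f v \<le> M"
    and L: "\<And>x. s < x \<Longrightarrow> x \<le> t \<Longrightarrow> \<exists>a<x. \<exists>M. \<forall>v\<in>{a<..<x}. f v \<le> M"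
  shows "\<exists>M. \<forall>v\<in>{s..t}. f v \<le> M"
proof -
  define P where "P a b \<longleftrightarrow> (\<exists>M. \<forall>v\<in>{a..b} \<inter> {s..t}. f v \<le> M)" for a b
  have "P s t"
    using assms(1)
  proof (induction rule: Bolzano)
    case (trans a b c)
    then obtain M M' where M: "\<forall>v\<in>{a..b} \<inter> {s..t}. f v \<le> M" "\<forall>v\<in>{b..c} \<inter> {s..t}. f v \<le> M'"
      by (auto simp: P_def)
    have "f v \<le> max M M'" if "v \<in> {a..c} \<inter> {s..t}" for v
      using M[THEN bspec, of v] that by (cases "v \<le> b") auto
    then show ?case unfolding P_def by blast
  next
    case (local x)
    have "\<exists>b>x. \<exists>M. \<forall>v\<in>{x<..<b} \<inter> {s..t}. f v \<le> M"
    proof (cases "x < t")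
      case True
      then show ?thesis using R[OF local(1)] by (meson IntD1)
    qed (use local in \<open>auto intro!: exI[of _ "x + 1"]\<close>)
    then obtain b M where b: "x < b" "\<forall>v\<in>{x<..<b} \<inter> {s..t}. f v \<le> M" by blast
    have "\<exists>a<x. \<exists>M. \<forall>v\<in>{a<..<x} \<inter> {s..t}. f v \<le> M"
    proof (cases "s < x")
      case True
      then show ?thesis using L[OF _ local(2)] by (meson IntD1)
    qed (use local in \<open>auto intro!: exI[of _ "x - 1"]\<close>)
    then obtain a M' where a: "a < x" "\<forall>v\<in>{a<..<x} \<inter> {s..t}. f v \<le> M'" by blast
    have "P a' b'" if ab: "a' \<le> x" "x \<le> b'" "b' - a' < min (b - x) (x - a)" for a' b'
    proof -
      have "f v \<le> max (f x) (max M M')" if v: "v \<in> {a'..b'} \<inter> {s..t}" for v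
      proof (cases v x rule: linorder_cases)
        case less
        then have "v \<in> {a<..<x} \<inter> {s..t}" using v ab by auto
        then show ?thesis using a(2) by force
      next
        case greater
        then have "v \<in> {x<..<b} \<inter> {s..t}" using v ab by auto
        then show ?thesis using b(2) by force
      qed simp
      then show ?thesis unfolding P_def by blast
    qed
    then show ?case using a(1) b(1) by (intro exI[of _ "min (b - x) (x - a)"]) auto
  qed
  then show ?thesis by (auto simp: P_def)
qed

locale excursion =
  fixes Z :: "real \<Rightarrow> real"
  assumes Z_cadlag: "cadlag Z"
    and Z_0: "Z 0 = 0" and Z_1: "Z 1 = 0"
    and Z_pos: "\<And>t. t \<in> {0<..<1} \<Longrightarrow> Z t > 0"
    and Z_jumps: "\<And>t. t \<in> {0<..1} \<Longrightarrow> jump Z t \<ge> 0"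
    and H1: "\<And>s t. 0 \<le> s \<Longrightarrow> s < t \<Longrightarrow> t \<le> 1 \<Longrightarrow>
               \<exists>\<^sub>\<le>\<^sub>1 r. r \<in> {s<..<t} \<and> Z r = Inf (Z ` {s..t})"
    and H2: "\<And>t \<epsilon>. t \<in> {0<..<1} \<Longrightarrow> jump Z t > 0 \<Longrightarrow> 0 < \<epsilon> \<Longrightarrow> \<epsilon> \<le> 1 - t \<Longrightarrow>
               Inf (Z ` {t..t + \<epsilon>}) < Z t"
    and H3: "\<And>t \<epsilon>. t \<in> {0<..<1} \<Longrightarrow> jump Z t > 0 \<Longrightarrow> 0 < \<epsilon> \<Longrightarrow> \<epsilon> \<le> t \<Longrightarrow>
               Inf (Z ` {t - \<epsilon>..t}) < left_lim Z t"
    and H4: "\<And>t s. t \<in> {0<..<1} \<Longrightarrow> local_min_at Z t \<Longrightarrow> s = Sup {u\<in>{0..t}. Z u < Z t} \<Longrightarrow>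
               jump Z s > 0 \<and> left_lim Z s < Z t \<and> Z t < Z s"
begin

abbreviation zl :: "real \<Rightarrow> real" where "zl \<equiv> left_lim Z"

lemma tendsto_right: "t \<in> {0..<1} \<Longrightarrow> (Z \<longlongrightarrow> Z t) (at_right t)"
  using Z_cadlag by (simp add: cadlag_def)

lemma tendsto_left: assumes "t \<in> {0<..1}" shows "(Z \<longlongrightarrow> zl t) (at_left t)"
proof -
  obtain l where l: "(Z \<longlongrightarrow> l) (at_left t)" using Z_cadlag assms unfolding cadlag_def by blast
  then have "Lim (at_left t) Z = l" by (intro tendsto_Lim) auto
  then show ?thesis using l assms by (simp add: left_lim_def)
qed

lemma zl_le: "t \<in> {0..1} \<Longrightarrow> zl t \<le> Z t"
  using Z_jumps[of t] by (cases "t = 0") (auto simp: jump_def left_lim_def)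

lemma Z_nonneg: "t \<in> {0..1} \<Longrightarrow> 0 \<le> Z t"
  using Z_pos[of t] Z_0 Z_1 by (cases "t = 0 \<or> t = 1") auto

lemma near_right:
  assumes "t \<in> {0..<1}"
  shows "Z t < l \<Longrightarrow> \<exists>b. t < b \<and> b \<le> 1 \<and> (\<forall>v\<in>{t..<b}. Z v < l)"
    and "l < Z t \<Longrightarrow> \<exists>b. t < b \<and> b \<le> 1 \<and> (\<forall>v\<in>{t..<b}. l < Z v)"
proof -
  have ex: "\<exists>b. t < b \<and> b \<le> 1 \<and> (\<forall>v\<in>{t..<b}. P v)" if ev: "eventually P (at_right t)" "P t" for P
  proof -
    have t: "t < 1" using assms by simp
    obtain b where "t < b" "\<And>v. t < v \<Longrightarrow> v < b \<Longrightarrow> P v"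
      using ev(1)[unfolded eventually_at_right[OF t]] by blast
    then show ?thesis using t ev(2) by (intro exI[of _ "min b 1"]) (auto simp: le_less)
  qed
  show "Z t < l \<Longrightarrow> \<exists>b. t < b \<and> b \<le> 1 \<and> (\<forall>v\<in>{t..<b}. Z v < l)"
    by (rule ex[OF order_tendstoD(2)[OF tendsto_right[OF assms]]])
  show "l < Z t \<Longrightarrow> \<exists>b. t < b \<and> b \<le> 1 \<and> (\<forall>v\<in>{t..<b}. l < Z v)"
    by (rule ex[OF order_tendstoD(1)[OF tendsto_right[OF assms]]])
qed

lemma near_left:
  assumes "t \<in> {0<..1}"
  shows "zl t < l \<Longrightarrow> \<exists>a. 0 \<le> a \<and> a < t \<and> (\<forall>v\<in>{a<..<t}. Z v < l)"
    and "l < zl t \<Longrightarrow> \<exists>a. 0 \<le> a \<and> a < t \<and> (\<forall>v\<in>{a<..<t}. l < Z v)"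
proof -
  have ex: "\<exists>a. 0 \<le> a \<and> a < t \<and> (\<forall>v\<in>{a<..<t}. P v)" if ev: "eventually P (at_left t)" for P
  proof -
    have t: "0 < t" using assms by simp
    obtain a where "a < t" "\<And>v. a < v \<Longrightarrow> v < t \<Longrightarrow> P v"
      using ev[unfolded eventually_at_left[OF t]] by blast
    then show ?thesis using t by (intro exI[of _ "max a 0"]) auto
  qed
  show "zl t < l \<Longrightarrow> \<exists>a. 0 \<le> a \<and> a < t \<and> (\<forall>v\<in>{a<..<t}. Z v < l)"
    by (rule ex[OF order_tendstoD(2)[OF tendsto_left[OF assms]]])
  show "l < zl t \<Longrightarrow> \<exists>a. 0 \<le> a \<and> a < t \<and> (\<forall>v\<in>{a<..<t}. l < Z v)"
    by (rule ex[OF order_tendstoD(1)[OF tendsto_left[OF assms]]])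
qed

lemma zl_ge:
  assumes "t \<in> {0<..1}" "0 \<le> a" "a < t" "\<And>v. a < v \<Longrightarrow> v < t \<Longrightarrow> l \<le> Z v"
  shows "l \<le> zl t"
proof (rule ccontr)
  assume "\<not> l \<le> zl t"
  then obtain a' where a': "a' < t" "\<forall>v\<in>{a'<..<t}. Z v < l" using near_left(1)[OF assms(1)] by force
  obtain v where "max a a' < v" "v < t" using dense[of "max a a'" t] a' assms(3) by auto
  then show False using a' assms(4)[of v] by force
qed

lemma zl_nonneg: "t \<in> {0..1} \<Longrightarrow> 0 \<le> zl t"
  using zl_ge[of t 0 0] Z_nonneg by (cases "t = 0") (auto simp: left_lim_def Z_0)

lemma jump_pos_iff: "0 < jump Z t \<longleftrightarrow> zl t < Z t"
  by (simp add: jump_def)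

lemma jump_time_interior: assumes "t \<in> {0..1}" "zl t < Z t" shows "t \<in> {0<..<1}"
proof -
  have "t \<noteq> 0" using assms by (auto simp: left_lim_def)
  moreover have "t \<noteq> 1" using assms zl_nonneg[of t] Z_1 by auto
  ultimately show ?thesis using assms by simp
qed

lemma below_after_jump:
  assumes "t \<in> {0..1}" "zl t < Z t" "t < b"
  obtains v where "t < v" "v < b" "v \<le> 1" "Z v < Z t"
proof -
  have t: "t \<in> {0<..<1}" using jump_time_interior assms by blast
  define e where "e = min (1 - t) ((b - t) / 2)"
  have e: "0 < e" "e \<le> 1 - t" "t + e < b" using t assms
    by (auto simp: e_def min_def field_simps split: if_splits)
  have "Inf (Z ` {t..t + e}) < Z t" using H2[OF t _ e(1,2)] assms by (simp add: jump_pos_iff)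
  then have "\<exists>v\<in>{t..t + e}. Z v < Z t" using cInf_lessD[of "Z ` {t..t + e}"] e by auto
  then obtain v where "v \<in> {t..t + e}" "Z v < Z t" by blast
  moreover then have "v \<noteq> t" by auto
  ultimately show thesis using that[of v] e by auto
qed

lemma below_before_jump:
  assumes "t \<in> {0..1}" "zl t < Z t" "a < t"
  obtains v where "a < v" "0 \<le> v" "v < t" "Z v < zl t"
proof -
  have t: "t \<in> {0<..<1}" using jump_time_interior assms by blast
  define e where "e = min t ((t - a) / 2)"
  have e: "0 < e" "e \<le> t" "a < t - e" using t assms
    by (auto simp: e_def min_def field_simps split: if_splits)
  have "Inf (Z ` {t - e..t}) < zl t" using H3[OF t _ e(1,2)] assms by (simp add: jump_pos_iff)
  then have "\<exists>v\<in>{t - e..t}. Z v < zl t" using cInf_lessD[of "Z ` {t - e..t}"] e by auto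
  then obtain v where "v \<in> {t - e..t}" "Z v < zl t" by blast
  moreover then have "v \<noteq> t" using assms by auto
  ultimately show thesis using that[of v] e by auto
qed

text \<open>Just before a jump \<open>Z\<close> takes values below the left limit, hence below
  \<open>Z t\<close>.\<close>

lemma no_jump:
  assumes "t \<in> {0..1}" "a < t" "\<And>v. a < v \<Longrightarrow> 0 \<le> v \<Longrightarrow> v < t \<Longrightarrow> Z t \<le> Z v"
  shows "zl t = Z t"
proof (rule ccontr)
  assume "zl t \<noteq> Z t"
  then have "zl t < Z t" using zl_le[OF assms(1)] by simp
  then obtain v where v: "a < v" "0 \<le> v" "v < t" "Z v < zl t"
    using assms(2) by (rule below_before_jump[OF assms(1)])
  then show False using assms(3)[OF v(1-3)] \<open>zl t < Z t\<close> by simp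
qed

lemma Inf_bdd: "0 \<le> s \<Longrightarrow> t \<le> 1 \<Longrightarrow> bdd_below (Z ` {s..t})"
  using Z_nonneg by (intro bdd_belowI2[of _ 0]) auto

text \<open>At an upward jump the infimum could be a left limit that is not a value; this is
  excluded by the lower values that \<open>below_before_jump\<close> provides. If the infimum
  \<open>m\<close> were not attained, \<open>1 / (Z v - m)\<close> would then be locally bounded,
  hence bounded, and \<open>Z\<close> would stay away from \<open>m\<close>.\<close>

lemma minimum_attained:
  assumes "0 \<le> s" "s \<le> t" "t \<le> 1"
  obtains r where "r \<in> {s..t}" "\<And>v. v \<in> {s..t} \<Longrightarrow> Z r \<le> Z v"
proof -
  define m where "m = Inf (Z ` {s..t})"
  have mle: "m \<le> Z v" if "v \<in> {s..t}" for v
    unfolding m_def by (rule cInf_lower) (use that Inf_bdd assms in auto)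
  have "\<exists>r\<in>{s..t}. Z r = m"
  proof (rule ccontr)
    assume "\<not> ?thesis"
    then have mless: "m < Z v" if "v \<in> {s..t}" for v using mle that by force
    have inv: "1 / (z - m) \<le> 1 / ((y - m) / 2)" if "m < y" "(m + y) / 2 < z" for y z
      by (rule frac_le) (use that in \<open>auto simp: field_simps\<close>)
    have "\<exists>M. \<forall>v\<in>{s..t}. 1 / (Z v - m) \<le> M"
    proof (rule locally_bounded_imp_bounded[OF assms(2)])
      fix x assume x: "s \<le> x" "x < t"
      then have "\<exists>b. x < b \<and> b \<le> 1 \<and> (\<forall>v\<in>{x..<b}. (m + Z x) / 2 < Z v)"
        using assms mless[of x] by (intro near_right(2)) auto
      then obtain b where b: "x < b" "\<forall>v\<in>{x..<b}. (m + Z x) / 2 < Z v" by blast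
      have "\<forall>v\<in>{x<..<b}. 1 / (Z v - m) \<le> 1 / ((Z x - m) / 2)"
        using b(2) mless[of x] x assms by (intro ballI inv) auto
      then show "\<exists>b>x. \<exists>M. \<forall>v\<in>{x<..<b}. 1 / (Z v - m) \<le> M" using b(1) by blast
    next
      fix x assume x: "s < x" "x \<le> t"
      have x01: "x \<in> {0..1}" using x assms by auto
      have mz: "m < zl x"
      proof (cases "zl x = Z x")
        case True then show ?thesis using mless[of x] x by simp
      next
        case False
        then have "zl x < Z x" using zl_le[OF x01] by simp
        then obtain v where v: "s < v" "0 \<le> v" "v < x" "Z v < zl x"
          using x(1) by (rule below_before_jump[OF x01])
        then show ?thesis using mle[of v] x by auto
      qed
      then have "\<exists>a. 0 \<le> a \<and> a < x \<and> (\<forall>v\<in>{a<..<x}. (m + zl x) / 2 < Z v)"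
        using x x01 assms by (intro near_left(2)) auto
      then obtain a where a: "a < x" "\<forall>v\<in>{a<..<x}. (m + zl x) / 2 < Z v" by blast
      have "\<forall>v\<in>{a<..<x}. 1 / (Z v - m) \<le> 1 / ((zl x - m) / 2)"
        using a(2) mz by (intro ballI inv) auto
      then show "\<exists>a<x. \<exists>M. \<forall>v\<in>{a<..<x}. 1 / (Z v - m) \<le> M" using a(1) by blast
    qed
    then obtain M where M: "\<And>v. v \<in> {s..t} \<Longrightarrow> 1 / (Z v - m) \<le> M" by blast
    have "0 < 1 / (Z s - m)" using mless[of s] assms(2) by simp
    then have M0: "0 < M" by (rule less_le_trans) (use M[of s] assms(2) in simp)
    have "m + 1 / M \<le> Z v" if "v \<in> {s..t}" for v
      using M[OF that] mless[OF that] M0 by (simp add: field_simps)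
    then have "m + 1 / M \<le> Inf (Z ` {s..t})" using assms by (intro cInf_greatest) auto
    then show False using M0 by (simp add: m_def)
  qed
  then show thesis using that mle by auto
qed

lemma unique_interior_minimum:
  assumes "0 \<le> s" "t \<le> 1" "r \<in> {s<..<t}" "r' \<in> {s<..<t}" "Z r = Z r'"
    and "\<And>v. v \<in> {s..t} \<Longrightarrow> Z r \<le> Z v"
  shows "r = r'"
proof -
  have "Inf (Z ` {s..t}) = Z r" by (rule cInf_eq_minimum) (use assms in auto)
  then show ?thesis using H1[of s t] assms unfolding Uniq_def by auto
qed

lemma above_after_minimum:
  assumes "0 \<le> s" "t \<le> 1" "r \<in> {s<..<t}" "\<And>v. v \<in> {s..t} \<Longrightarrow> Z r \<le> Z v" "v \<in> {s<..<t}" "v \<noteq> r"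
  shows "Z r < Z v"
proof -
  have "Z r \<noteq> Z v" using unique_interior_minimum[OF assms(1-3,5) _ assms(4)] assms(6) by blast
  moreover have "Z r \<le> Z v" using assms(4)[of v] assms(5) by auto
  ultimately show ?thesis by simp
qed

text \<open>Without negative jumps \<open>Z\<close> cannot pass below a level without taking it as a
  value: the left limit at the passage time is still at least \<open>l\<close>.\<close>

lemma first_hit:
  assumes "0 \<le> a" "a \<le> b" "b \<le> 1" "Z b \<le> l"
  obtains h where "a \<le> h" "h \<le> b" "Z h \<le> l" "\<And>v. a \<le> v \<Longrightarrow> v < h \<Longrightarrow> l < Z v" "h \<noteq> a \<Longrightarrow> Z h = l"
proof -
  define S where "S = {v\<in>{a..b}. Z v \<le> l}"
  define h where "h = Inf S"
  have bS: "b \<in> S" "S \<noteq> {}" and bdd: "bdd_below S" using assms by (auto simp: S_def bdd_below_def)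
  have hb: "h \<le> b" unfolding h_def using bS bdd by (intro cInf_lower)
  have ah: "a \<le> h" unfolding h_def using bS by (intro cInf_greatest) (auto simp: S_def)
  have before: "l < Z v" if "a \<le> v" "v < h" for v
  proof (rule ccontr)
    assume "\<not> l < Z v"
    then have "v \<in> S" using that hb by (auto simp: S_def)
    then have "h \<le> v" unfolding h_def using bdd by (intro cInf_lower)
    then show False using that by simp
  qed
  have hl: "Z h \<le> l"
  proof (rule ccontr)
    assume n: "\<not> Z h \<le> l"
    then have "h \<noteq> b" using assms by auto
    then have "h \<in> {0..<1}" using hb ah assms by auto
    then obtain c where c: "h < c" "\<forall>v\<in>{h..<c}. l < Z v" using near_right(2)[of h l] n by auto
    have "c \<le> h"
      unfolding h_def
    proof (rule cInf_greatest[OF bS(2)])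
      fix x assume x: "x \<in> S"
      then have "h \<le> x" unfolding h_def using bdd by (intro cInf_lower)
      then show "c \<le> x" using c x by (force simp: S_def)
    qed
    then show False using c by simp
  qed
  have "Z h = l" if "h \<noteq> a"
  proof -
    have h: "h \<in> {0<..1}" "a < h" using that ah hb assms by auto
    have "l \<le> zl h" by (rule zl_ge[OF h(1) assms(1) h(2)]) (use before in \<open>auto simp: less_imp_le\<close>)
    then show ?thesis using zl_le[of h] hl h by auto
  qed
  then show thesis using that hb ah before hl by blast
qed

text \<open>The infimum is a first passage and, in the absence of negative jumps, an exact one.
  Nothing is asked of \<open>Z s\<close>, so \<open>s\<close> may be a jump.\<close>

lemma lam_less_iff:
  "lam_less Z s t \<longleftrightarrow> 0 \<le> s \<and> s < t \<and> t \<le> 1 \<and> Z t = zl s \<and> (\<forall>v\<in>{s<..<t}. zl s < Z v)"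
proof
  define S where "S = {u. s < u \<and> u \<le> 1 \<and> Z u \<le> zl s}"
  have bdd: "bdd_below S" by (auto simp: S_def bdd_below_def intro!: exI[of _ s])
  { assume "lam_less Z s t"
    then have st: "0 \<le> s" "s < t" "t \<le> 1" "t = Inf S" by (auto simp: lam_less_def S_def)
    have "1 \<in> S" using st zl_nonneg[of s] Z_1 by (auto simp: S_def)
    then have ne: "S \<noteq> {}" by auto
    have before: "zl s < Z v" if "v \<in> {s<..<t}" for v
    proof (rule ccontr)
      assume "\<not> zl s < Z v"
      then have "v \<in> S" using that st by (auto simp: S_def)
      then have "t \<le> v" unfolding st(4) using bdd by (intro cInf_lower)
      then show False using that by simp
    qed
    have "Z t \<le> zl s"
    proof (rule ccontr)
      assume n: "\<not> Z t \<le> zl s"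
      then have "t \<noteq> 1" using zl_nonneg[of s] st Z_1 by auto
      then obtain c where c: "t < c" "\<forall>v\<in>{t..<c}. zl s < Z v" using near_right(2)[of t "zl s"] n st by auto
      have "c \<le> Inf S"
      proof (rule cInf_greatest[OF ne])
        fix x assume x: "x \<in> S"
        then have "t \<le> x" unfolding st(4) using bdd by (intro cInf_lower)
        then show "c \<le> x" using c x by (force simp: S_def)
      qed
      then show False using c st by simp
    qed
    moreover have "zl s \<le> zl t" by (rule zl_ge[of t s]) (use st before in \<open>auto simp: less_imp_le\<close>)
    ultimately have "Z t = zl s" using zl_le[of t] st by auto
    then show "0 \<le> s \<and> s < t \<and> t \<le> 1 \<and> Z t = zl s \<and> (\<forall>v\<in>{s<..<t}. zl s < Z v)"
      using st before by auto }
  { assume a: "0 \<le> s \<and> s < t \<and> t \<le> 1 \<and> Z t = zl s \<and> (\<forall>v\<in>{s<..<t}. zl s < Z v)"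
    have "Inf S = t"
      by (rule cInf_eq_minimum) (use a in \<open>force simp: S_def\<close>)+
    then show "lam_less Z s t" using a by (simp add: lam_less_def S_def) }
qed

text \<open>Source of chords that leave an interval: they start at \<open>w\<close> and end beyond
  \<open>b\<close>. The passage exists because \<open>Z 1 = 0\<close>, and the last clause locates
  its end before any later time at or below the level.\<close>

lemma lam_less_from_below:
  assumes "0 \<le> w" "w < b" "b \<le> 1" "\<And>v. w < v \<Longrightarrow> v \<le> b \<Longrightarrow> zl w < Z v"
  obtains h where "b < h" "h \<le> 1" "lam_less Z w h" "Z h = zl w" "\<And>v. w < v \<Longrightarrow> v < h \<Longrightarrow> zl w < Z v"
    "\<And>c. b \<le> c \<Longrightarrow> c \<le> 1 \<Longrightarrow> Z c \<le> zl w \<Longrightarrow> h \<le> c"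
proof -
  have "Z 1 \<le> zl w" using zl_nonneg[of w] assms Z_1 by auto
  then obtain h where h: "b \<le> h" "h \<le> 1" "Z h \<le> zl w" "\<And>v. b \<le> v \<Longrightarrow> v < h \<Longrightarrow> zl w < Z v"
    "h \<noteq> b \<Longrightarrow> Z h = zl w" using first_hit[of b 1 "zl w"] assms by auto
  have "h \<noteq> b" using assms(4)[of b] h(3) assms(2) by auto
  then have hh: "b < h" "Z h = zl w" using h by auto
  have all: "zl w < Z v" if "w < v" "v < h" for v
    using assms(4)[of v] h(4)[of v] that by (cases "v \<le> b") auto
  moreover have "lam_less Z w h" unfolding lam_less_iff using hh h all assms by auto
  moreover have "h \<le> c" if "b \<le> c" "c \<le> 1" "Z c \<le> zl w" for c
    using h(4)[of c] that by (cases "c < h") auto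
  ultimately show thesis using that h hh by blast
qed

text \<open>Here \<open>w\<close> is the last time at or below the level, which may be crossed by a
  jump; so only \<open>zl w\<close> and \<open>Z w\<close> are known to enclose \<open>l\<close>. It
  serves as a left end in \<open>lam_less_from_below\<close>.\<close>

lemma last_below:
  assumes "0 \<le> a" "a \<le> b" "b \<le> 1" "Z a < l" "l < Z b" "l < zl b"
  obtains w where "a < w" "w < b" "zl w \<le> l" "l \<le> Z w" "\<And>v. w < v \<Longrightarrow> v \<le> b \<Longrightarrow> l < Z v"
proof -
  define S where "S = {v\<in>{a..b}. Z v \<le> l}"
  define w where "w = Sup S"
  have aS: "a \<in> S" "S \<noteq> {}" and bdd: "bdd_above S" using assms by (auto simp: S_def bdd_above_def)
  have aw: "a \<le> w" unfolding w_def using aS bdd by (intro cSup_upper)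
  have wb: "w \<le> b" unfolding w_def using aS by (intro cSup_least) (auto simp: S_def)
  have after: "l < Z v" if "w < v" "v \<le> b" for v
  proof (rule ccontr)
    assume "\<not> l < Z v"
    then have "v \<in> S" using that aw by (auto simp: S_def)
    then have "v \<le> w" unfolding w_def using bdd by (intro cSup_upper)
    then show False using that by simp
  qed
  have ab: "a < b" using assms by (cases "a = b") auto
  have "a < w"
  proof (rule ccontr)
    assume "\<not> a < w"
    then have "w = a" using aw by simp
    obtain c where c: "a < c" "\<forall>v\<in>{a..<c}. Z v < l" using near_right(1)[of a l] assms ab by auto
    obtain v where v: "a < v" "v < min c b" using dense[of a "min c b"] c ab by auto
    then have "Z v < l" using c(2) by simp
    moreover have "l < Z v" using after[of v] v \<open>w = a\<close> by simp
    ultimately show False by simp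
  qed
  moreover have "w < b"
  proof (rule ccontr)
    assume "\<not> w < b"
    then have "w = b" using wb by simp
    obtain c where c: "c < b" "\<forall>v\<in>{c<..<b}. l < Z v" using near_left(2)[of b l] assms ab by auto
    have "w \<le> max c a" unfolding w_def
    proof (rule cSup_least[OF aS(2)])
      fix x assume "x \<in> S"
      then have "x \<le> b" "Z x \<le> l" by (auto simp: S_def)
      then show "x \<le> max c a" using c(2)[rule_format, of x] assms(5) by (cases "x = b"; cases "c < x") auto
    qed
    then show False using \<open>w = b\<close> c ab by simp
  qed
  moreover have "zl w \<le> l"
  proof (rule ccontr)
    assume n: "\<not> zl w \<le> l"
    have w: "w \<in> {0<..1}" using \<open>a < w\<close> \<open>w < b\<close> assms by auto
    obtain c where c: "c < w" "\<forall>v\<in>{c<..<w}. l < Z v" using near_left(2)[OF w, of l] n by auto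
    have "w \<notin> S" using n zl_le[of w] w by (auto simp: S_def)
    have "w \<le> max c a" unfolding w_def
    proof (rule cSup_least[OF aS(2)])
      fix x assume x: "x \<in> S"
      then have "x \<le> w" unfolding w_def using bdd by (intro cSup_upper)
      then have "x < w" using x \<open>w \<notin> S\<close> by (cases "x = w") auto
      moreover have "Z x \<le> l" using x by (simp add: S_def)
      ultimately show "x \<le> max c a" using c(2)[rule_format, of x] by (cases "c < x") auto
    qed
    then show False using c \<open>a < w\<close> by simp
  qed
  moreover have "l \<le> Z w"
  proof (rule ccontr)
    assume "\<not> l \<le> Z w"
    then obtain c where c: "w < c" "\<forall>v\<in>{w..<c}. Z v < l"
      using near_right(1)[of w l] \<open>a < w\<close> \<open>w < b\<close> assms by auto
    obtain v where v: "w < v" "v < min c b" using dense[of w "min c b"] c \<open>w < b\<close> by auto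
    then have "Z v < l" using c(2) by simp
    moreover have "l < Z v" using after[of v] v by simp
    ultimately show False by simp
  qed
  ultimately show thesis using that after by blast
qed

end

section \<open>The face of a jump and its apex\<close>

locale labelled_excursion = excursion +
  fixes lab :: "real \<Rightarrow> real"
  assumes labelling: "jumps_labelling Z lab"
    and apex: "\<And>s. s \<in> jump_times Z \<Longrightarrow> \<not> local_min_at Z (face_apex Z lab s)"
begin

abbreviation "te \<equiv> face_end Z"
abbreviation "ap \<equiv> face_apex Z lab"

lemma jump_timeD:
  assumes "u \<in> jump_times Z" shows "u \<in> {0<..<1}" "u \<in> {0..1}" "zl u < Z u"
  using assms jump_time_interior[of u] by (auto simp: jump_times_def jump_pos_iff)

lemma jump_timeI: "u \<in> {0..1} \<Longrightarrow> zl u < Z u \<Longrightarrow> u \<in> jump_times Z"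
  by (simp add: jump_times_def jump_pos_iff)

lemma zl_pos:
  assumes "u \<in> {0<..<1}" shows "0 < zl u"
proof (cases "zl u = Z u")
  case True
  then show ?thesis using Z_pos[OF assms] by simp
next
  case False
  have u: "u \<in> {0..1}" "0 < u" using assms by auto
  then have "zl u < Z u" using False zl_le[of u] by auto
  then obtain v where "0 < v" "0 \<le> v" "v < u" "Z v < zl u" using u(2) by (rule below_before_jump[OF u(1)])
  then show ?thesis using Z_pos[of v] u by auto
qed

lemma face_end:
  assumes "u \<in> jump_times Z"
  shows "u < te u" "te u < 1" "Z (te u) = zl u" "\<And>v. u \<le> v \<Longrightarrow> v < te u \<Longrightarrow> zl u < Z v"
proof -
  note u = jump_timeD[OF assms]
  have 1: "Z 1 \<le> zl u" using zl_pos[OF u(1)] Z_1 by simp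
  obtain h where h: "u \<le> h" "h \<le> 1" "Z h \<le> zl u" "\<And>v. u \<le> v \<Longrightarrow> v < h \<Longrightarrow> zl u < Z v"
    "h \<noteq> u \<Longrightarrow> Z h = zl u" using first_hit[of u 1 "zl u"] u 1 by auto
  have "h \<noteq> u" using h(3) u(3) by auto
  then have hh: "u < h" "Z h = zl u" using h by auto
  have "te u = h" unfolding face_end_def
  proof (rule cInf_eq_minimum)
    fix x assume "x \<in> {v. u < v \<and> v \<le> 1 \<and> Z v = zl u}"
    then show "h \<le> x" using h(4)[of x] by (cases "x < h") auto
  qed (use hh h in auto)
  moreover have "h \<noteq> 1" using hh zl_pos[OF u(1)] Z_1 by auto
  ultimately show "u < te u" "te u < 1" "Z (te u) = zl u" "\<And>v. u \<le> v \<Longrightarrow> v < te u \<Longrightarrow> zl u < Z v"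
    using hh h by auto
qed

lemma face_times_iff:
  assumes "u \<in> jump_times Z"
  shows "r \<in> face_times Z u \<longleftrightarrow> u \<le> r \<and> r \<le> te u \<and> (\<forall>v\<in>{u..r}. Z r \<le> Z v)"
proof -
  note u = jump_timeD[OF assms]
  have "Z r = Inf (Z ` {u..r}) \<longleftrightarrow> (\<forall>v\<in>{u..r}. Z r \<le> Z v)" if r: "u \<le> r" "r \<le> te u"
  proof
    assume eq: "Z r = Inf (Z ` {u..r})"
    have bdd: "bdd_below (Z ` {u..r})" using u r face_end(2)[OF assms] by (intro Inf_bdd) auto
    show "\<forall>v\<in>{u..r}. Z r \<le> Z v" unfolding eq by (intro ballI cInf_lower[OF _ bdd]) auto
  next
    assume "\<forall>v\<in>{u..r}. Z r \<le> Z v"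
    then have "Inf (Z ` {u..r}) = Z r" using r by (intro cInf_eq_minimum) auto
    then show "Z r = Inf (Z ` {u..r})" by simp
  qed
  then show ?thesis by (auto simp: face_times_def)
qed

lemma face_times_self: "u \<in> jump_times Z \<Longrightarrow> u \<in> face_times Z u"
  using face_end(1)[of u] by (simp add: face_times_iff)

lemma face_times_end: assumes "u \<in> jump_times Z" shows "te u \<in> face_times Z u"
proof -
  have "Z (te u) \<le> Z v" if "v \<in> {u..te u}" for v
    using face_end(3,4)[OF assms] that by (cases "v = te u") (auto simp: less_imp_le)
  then show ?thesis using face_end(1)[OF assms] by (simp add: face_times_iff[OF assms])
qed

text \<open>The bound by \<open>te u\<close> comes for free. Otherwise \<open>Z\<close> would have a
  local minimum at \<open>te u\<close>, with \<open>u\<close> as the last time below it;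
  \<open>H4\<close> would then give \<open>zl u < Z (te u)\<close>, although the two are
  equal.\<close>

lemma face_timesI:
  assumes "u \<in> jump_times Z" "u \<le> r" "zl u \<le> Z r" "\<And>v. u \<le> v \<Longrightarrow> v \<le> r \<Longrightarrow> Z r \<le> Z v"
  shows "r \<in> face_times Z u"
proof -
  have "r \<le> te u"
  proof (rule ccontr)
    assume n: "\<not> r \<le> te u"
    then have te: "Z r \<le> Z (te u)" using assms(4)[of "te u"] face_end(1)[OF assms(1)] by simp
    then have eq: "Z r = zl u" using assms(3) face_end(3)[OF assms(1)] by simp
    note u = jump_timeD[OF assms(1)]
    have "te u \<in> {0<..<1}" using face_end[OF assms(1)] u by auto
    have lm: "local_min_at Z (te u)"
      unfolding local_min_at_def
    proof (intro conjI exI[of _ "min (r - te u) (te u - u)"] ballI impI)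
      show "te u \<in> {0..1}" using \<open>te u \<in> {0<..<1}\<close> by auto
      show "0 < min (r - te u) (te u - u)" using n face_end(1)[OF assms(1)] by auto
      fix q assume "q \<in> {0..1}" "\<bar>q - te u\<bar> < min (r - te u) (te u - u)"
      then have "u \<le> q" "q \<le> r" by auto
      then show "Z (te u) \<le> Z q" using assms(4)[of q] eq face_end(3)[OF assms(1)] by simp
    qed
    define s where "s = Sup {v\<in>{0..te u}. Z v < Z (te u)}"
    have "s = u"
    proof -
      have "x \<le> u" if "x \<in> {v\<in>{0..te u}. Z v < Z (te u)}" for x
      proof (rule ccontr)
        assume "\<not> x \<le> u"
        then show False using that face_end(3)[OF assms(1)] face_end(4)[OF assms(1), of x]
          by (cases "x = te u") auto
      qed
      moreover have "u \<le> y" if y: "\<And>x. x \<in> {v\<in>{0..te u}. Z v < Z (te u)} \<Longrightarrow> x \<le> y" for y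
      proof (rule ccontr)
        assume "\<not> u \<le> y"
        then have "y < u" by simp
        obtain v where v: "y < v" "0 \<le> v" "v < u" "Z v < zl u"
          using below_before_jump[OF u(2,3) \<open>y < u\<close>] .
        then have "v \<le> y" using y[of v] face_end(1,3)[OF assms(1)] by auto
        then show False using v by simp
      qed
      moreover have "{v\<in>{0..te u}. Z v < Z (te u)} \<noteq> {}"
        using zl_pos[OF u(1)] u face_end(1,3)[OF assms(1)] Z_0 by (auto intro!: exI[of _ 0])
      ultimately show ?thesis unfolding s_def by (intro cSup_eq_non_empty) auto
    qed
    then show False using H4[OF \<open>te u \<in> {0<..<1}\<close> lm s_def] face_end(3)[OF assms(1)] by simp
  qed
  then show ?thesis using assms by (simp add: face_times_iff)
qed

text \<open>The level prescribed by the label is between \<open>zl u\<close> and \<open>Z u\<close>,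
  so it is reached exactly and no later than \<open>te u\<close>.\<close>

lemma face_apex:
  assumes "u \<in> jump_times Z"
  shows "u \<le> ap u" "ap u \<le> te u" "Z (ap u) = Z u - jump Z u * lab u" "zl u \<le> Z (ap u)"
    "\<And>v. u \<le> v \<Longrightarrow> v < ap u \<Longrightarrow> Z (ap u) < Z v" "ap u \<in> face_times Z u"
proof -
  note u = jump_timeD[OF assms]
  define l where "l = Z u - jump Z u * lab u"
  have lab: "0 \<le> lab u" "lab u \<le> 1" using labelling assms by (auto simp: jumps_labelling_def)
  have "0 \<le> jump Z u * lab u" "jump Z u * lab u \<le> jump Z u * 1"
    using lab u(3) by (auto simp: jump_pos_iff[symmetric] intro!: mult_left_mono)
  then have l: "zl u \<le> l" "l \<le> Z u" by (auto simp: l_def jump_def)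
  obtain h where h: "u \<le> h" "h \<le> te u" "Z h \<le> l" "\<And>v. u \<le> v \<Longrightarrow> v < h \<Longrightarrow> l < Z v" "h \<noteq> u \<Longrightarrow> Z h = l"
    using first_hit[of u "te u" l] face_end[OF assms] u l by auto
  have hl: "Z h = l" using h l by (cases "h = u") auto
  have "ap u = h" unfolding face_apex_def l_def[symmetric]
  proof (rule cInf_eq_minimum)
    fix x assume "x \<in> {r. u \<le> r \<and> r \<le> 1 \<and> Z r = l}"
    then show "h \<le> x" using h(4)[of x] by (cases "x < h") auto
  qed (use hl h face_end(2)[OF assms] in auto)
  then show 1: "u \<le> ap u" "ap u \<le> te u" "Z (ap u) = Z u - jump Z u * lab u" "zl u \<le> Z (ap u)"
    "\<And>v. u \<le> v \<Longrightarrow> v < ap u \<Longrightarrow> Z (ap u) < Z v"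
    using h hl l by (auto simp: l_def)
  show "ap u \<in> face_times Z u"
    unfolding face_times_iff[OF assms] using 1(1,2,5) by (force simp: less_le)
qed

lemma face_time_no_jump:
  assumes "u \<in> jump_times Z" "r \<in> face_times Z u" "u < r"
  shows "zl r = Z r"
proof (rule no_jump)
  show "r \<in> {0..1}" "u < r" using assms face_end(2)[OF assms(1)] jump_timeD(2)[OF assms(1)]
    by (auto simp: face_times_iff)
  show "Z r \<le> Z v" if "u < v" "v < r" for v using assms that by (auto simp: face_times_iff)
qed

section \<open>Maximality of the triangulated lamination\<close>

text \<open>Chords as ordered pairs. Face chords occur in both orders because the apex may lie on
  either side of the face time; the trivial pairs of \<open>lam_rel\<close> are omitted, as they
  only contribute points of the circle.\<close>

definition lam_chord :: "real \<Rightarrow> real \<Rightarrow> bool" where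
  "lam_chord a b \<longleftrightarrow> lam_less Z a b \<or>
     (\<exists>u\<in>jump_times Z. \<exists>r\<in>face_times Z u. (a = ap u \<and> b = r) \<or> (a = r \<and> b = ap u))"

lemma lam_chord_lam: "lam_less Z a b \<Longrightarrow> lam_chord a b"
  and lam_chord_face: "u \<in> jump_times Z \<Longrightarrow> r \<in> face_times Z u \<Longrightarrow> lam_chord (ap u) r"
    "u \<in> jump_times Z \<Longrightarrow> r \<in> face_times Z u \<Longrightarrow> lam_chord r (ap u)"
  unfolding lam_chord_def by blast+

text \<open>The cases depend on where \<open>Z\<close> attains its minimum over the interval from
  \<open>s\<close> to \<open>t\<close>. In each case, unless an explicit chord with exactly one end
  strictly inside and the other strictly outside appears, \<open>s\<close> and \<open>t\<close> are
  seen to be the ends of a first passage, or the apex and a face time of one jump.\<close>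

lemma lam_chord_maximal:
  assumes st: "0 \<le> s" "s < t" "t \<le> 1"
    and nx1: "\<And>a b. lam_chord a b \<Longrightarrow> a < s \<Longrightarrow> s < b \<Longrightarrow> b < t \<Longrightarrow> False"
    and nx2: "\<And>a b. lam_chord a b \<Longrightarrow> s < a \<Longrightarrow> a < t \<Longrightarrow> t < b \<Longrightarrow> False"
  shows "lam_chord s t"
proof (cases "\<exists>r\<in>{s<..<t}. \<forall>v\<in>{s..t}. Z r \<le> Z v")
  case True
  then obtain r where r: "s < r" "r < t" and rmin: "\<And>v. s \<le> v \<Longrightarrow> v \<le> t \<Longrightarrow> Z r \<le> Z v" by auto
  have r01: "r \<in> {0<..<1}" using r st by auto
  have lm: "local_min_at Z r" unfolding local_min_at_def
    by (intro conjI exI[of _ "min (r - s) (t - r)"]) (use r st rmin in auto)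
  define u where "u = Sup {u\<in>{0..r}. Z u < Z r}"
  have u: "zl u < Z u" "zl u < Z r" "Z r < Z u"
    using H4[OF r01 lm u_def] by (auto simp: jump_pos_iff)
  have bdd: "bdd_above {u\<in>{0..r}. Z u < Z r}" by (auto simp: bdd_above_def)
  have 0: "0 \<in> {u\<in>{0..r}. Z u < Z r}" using Z_pos[OF r01] r01 Z_0 by auto
  have "0 \<le> u" unfolding u_def by (rule cSup_upper[OF 0 bdd])
  have "u \<le> r" unfolding u_def by (rule cSup_least) (use 0 in auto)
  have uJ: "u \<in> jump_times Z" using \<open>0 \<le> u\<close> \<open>u \<le> r\<close> r01 u by (intro jump_timeI) auto
  have after: "Z r \<le> Z v" if "u < v" "v \<le> r" for v
  proof (rule ccontr)
    assume "\<not> Z r \<le> Z v"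
    then have "v \<in> {u\<in>{0..r}. Z u < Z r}" using that \<open>0 \<le> u\<close> by auto
    then have "v \<le> u" unfolding u_def using bdd by (intro cSup_upper)
    then show False using that by simp
  qed
  \<comment> \<open>Just before \<open>u\<close> the values are below \<open>zl u\<close>, hence
    below \<open>Z r\<close>, which is the minimum over the interval.\<close>
  have "u \<le> s"
  proof (rule ccontr)
    assume "\<not> u \<le> s"
    then obtain v where "s < v" "0 \<le> v" "v < u" "Z v < zl u"
      using below_before_jump[OF jump_timeD(2,3)[OF uJ], of s] by (metis not_le)
    then show False using rmin[of v] \<open>u \<le> r\<close> r u by auto
  qed
  have ut: "Z r \<le> Z v" if "u \<le> v" "v \<le> t" for v
    using after[of v] rmin[of v] that u r by (cases "v \<le> r"; cases "v = u") auto
  have rB: "r \<in> face_times Z u" by (rule face_timesI[OF uJ]) (use \<open>u \<le> r\<close> u ut r in auto)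
  have "t < te u"
  proof (rule ccontr)
    assume "\<not> t < te u"
    then show False using ut[of "te u"] face_end[OF uJ] u by auto
  qed
  define p where "p = ap u"
  note p = face_apex[OF uJ, folded p_def]
  \<comment> \<open>The apex is joined to \<open>r\<close>, inside the interval, and to
    \<open>te u\<close>, beyond \<open>t\<close>. As it differs from \<open>r\<close>, noncrossing
    leaves only the two ends of the interval for it.\<close>
  have "p \<noteq> r" using apex[OF uJ] lm by (auto simp: p_def)
  have c1: "lam_chord p r" "lam_chord r p" using lam_chord_face[OF uJ rB] by (auto simp: p_def)
  have c2: "lam_chord p (te u)" using lam_chord_face(1)[OF uJ face_times_end[OF uJ]] by (simp add: p_def)
  have "\<not> p < s" using nx1[OF c1(1)] r by auto
  moreover have "\<not> t < p" using nx2[OF c1(2)] r by auto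
  moreover have "\<not> (s < p \<and> p < t)" using nx2[OF c2] \<open>t < te u\<close> by auto
  ultimately consider "p = s" | "p = t" by linarith
  then show ?thesis
  proof cases
    case 2
    have "Z p < Z r" using p(5)[of r] 2 r \<open>u \<le> r\<close> by simp
    then show ?thesis using rmin[of t] 2 r by simp
  next
    case 1
    show ?thesis
    proof (cases "Z t = Z r")
      case True
      have "t \<in> face_times Z u" by (rule face_timesI[OF uJ]) (use \<open>u \<le> s\<close> st u ut True in auto)
      then show ?thesis using lam_chord_face(1)[OF uJ] 1 by (simp add: p_def)
    next
      case False
      then have "Z r < Z t" using rmin[of t] r by simp
      have zr: "zl r = Z r" by (rule no_jump[of _ s]) (use r r01 rmin in auto)
      \<comment> \<open>The interior minimum is unique, so \<open>Z\<close> stays above it up to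
        \<open>t\<close> and the first passage chord starting at \<open>r\<close> would end beyond
        \<open>t\<close>.\<close>
      have up: "zl r < Z v" if "r < v" "v \<le> t" for v
      proof (cases "v = t")
        case False
        show ?thesis unfolding zr
          by (rule above_after_minimum[of s t]) (use st r that False rmin in auto)
      qed (use \<open>Z r < Z t\<close> zr in simp)
      have "\<exists>h>t. lam_less Z r h"
        by (rule lam_less_from_below[of r t]) (use r r01 st up in auto)
      then obtain h where "t < h" "lam_less Z r h" by blast
      then show ?thesis using nx2[OF lam_chord_lam, of r h] r by blast
    qed
  qed
next
  case False
  obtain m where m: "m \<in> {s..t}" "\<And>v. v \<in> {s..t} \<Longrightarrow> Z m \<le> Z v"
    using minimum_attained[of s t] st by auto
  then have mst: "m = s \<or> m = t" using False by force
  have inner: "Z m < Z v" if "s < v" "v < t" for v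
  proof (rule ccontr)
    assume "\<not> Z m < Z v"
    then have "Z v \<le> Z m" by simp
    then have "\<forall>w\<in>{s..t}. Z v \<le> Z w" using m(2) by force
    then show False using False that by auto
  qed
  have s01: "s \<in> {0..1}" "t \<in> {0..1}" using st by auto
  consider "Z s = Z m" "Z t = Z m" | "Z s = Z m" "Z m < Z t" | "Z t = Z m" "Z m < Z s"
    using mst m(2)[of s] m(2)[of t] st by force
  then show ?thesis
  proof cases
    case 1
    have "zl s = Z s"
    proof (rule ccontr)
      assume "zl s \<noteq> Z s"
      then have "zl s < Z s" using zl_le[OF s01(1)] by simp
      then obtain v where "s < v" "v < t" "v \<le> 1" "Z v < Z s" using st(2) by (rule below_after_jump[OF s01(1)])
      then show False using inner[of v] 1 by simp
    qed
    then show ?thesis using 1 inner st by (intro lam_chord_lam) (auto simp: lam_less_iff)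
  next
    case 2
    \<comment> \<open>The minimum is at \<open>s\<close> only. A level between it and
      \<open>zl t\<close> is passed upwards for the last time at some \<open>w\<close> inside, and
      the chord starting at \<open>w\<close> ends beyond \<open>t\<close>.\<close>
    have "Z m < zl t"
    proof (cases "zl t = Z t")
      case False
      then have "zl t < Z t" using zl_le[OF s01(2)] by simp
      then obtain v where "s < v" "0 \<le> v" "v < t" "Z v < zl t"
        using st(2) by (rule below_before_jump[OF s01(2)])
      then show ?thesis using inner[of v] by simp
    qed (use 2 in simp)
    then obtain l where l: "Z m < l" "l < zl t" using dense by blast
    then have "l < Z t" using zl_le[OF s01(2)] by simp
    then obtain w where w: "s < w" "w < t" "zl w \<le> l" "\<And>v. w < v \<Longrightarrow> v \<le> t \<Longrightarrow> l < Z v"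
      using last_below[of s t l] st l 2 by auto
    have up: "zl w < Z v" if "w < v" "v \<le> t" for v using w(3) w(4)[OF that] by simp
    have "\<exists>h>t. lam_less Z w h"
      by (rule lam_less_from_below[of w t]) (use w(1,2) st up in auto)
    then obtain h where h: "t < h" "lam_less Z w h" by blast
    show ?thesis using nx2[OF lam_chord_lam[OF h(2)] w(1,2) h(1)] by simp
  next
    case 3
    have zt: "zl t = Z t" by (rule no_jump[of _ s]) (use st s01 inner 3 in \<open>auto simp: less_imp_le\<close>)
    \<comment> \<open>The minimum is at \<open>t\<close> only, and is approached without a jump:
      every level above it is passed strictly inside the interval.\<close>
    have near_t: "\<exists>v. s < v \<and> v < t \<and> Z v < l" if "Z m < l" for l
    proof -
      have "\<exists>a. 0 \<le> a \<and> a < t \<and> (\<forall>v\<in>{a<..<t}. Z v < l)"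
        using zt 3 that st by (intro near_left(1)) auto
      then obtain a where a: "a < t" "\<forall>v\<in>{a<..<t}. Z v < l" by blast
      obtain v where "max a s < v" "v < t" using dense[of "max a s" t] a st by auto
      then show ?thesis using a by auto
    qed
    consider "zl s = Z m" | "zl s < Z m" | "Z m < zl s" by linarith
    then show ?thesis
    proof cases
      case 1
      then show ?thesis using 3 inner st by (intro lam_chord_lam) (auto simp: lam_less_iff)
    next
      case 2
      then have sJ: "s \<in> jump_times Z" using 3 s01 by (intro jump_timeI) auto
      have tB: "t \<in> face_times Z s" by (rule face_timesI[OF sJ]) (use st 2 3 m in auto)
      then have "t \<le> te s" by (simp add: face_times_iff[OF sJ])
      moreover have "t \<noteq> te s" using 2 3 face_end(3)[OF sJ] by auto
      ultimately have "t < te s" by simp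
      define p where "p = ap s"
      note p = face_apex[OF sJ, folded p_def]
      consider "p = s" | "s < p" "p < t" | "p = t" | "t < p" using p(1) by linarith
      then show ?thesis
      proof cases
        case 1 then show ?thesis using lam_chord_face(1)[OF sJ tB] by (simp add: p_def)
      next
        case 2
        have "lam_chord p (te s)" using lam_chord_face(1)[OF sJ face_times_end[OF sJ]] by (simp add: p_def)
        then show ?thesis using nx2[of p "te s"] 2 \<open>t < te s\<close> by blast
      next
        case 3 then show ?thesis using lam_chord_face(2)[OF sJ face_times_self[OF sJ]] by (simp add: p_def)
      next
        case 4
        \<comment> \<open>A face time of intermediate level lies inside the interval and would be
          joined to an apex beyond \<open>t\<close>.\<close>
        obtain l where l: "Z m < l" "l < Z s" using dense[OF \<open>Z m < Z s\<close>] by blast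
        obtain v where v: "s < v" "v < t" "Z v < l" using near_t[OF l(1)] by blast
        obtain h where h: "s \<le> h" "h \<le> v" "Z h \<le> l" "\<And>v. s \<le> v \<Longrightarrow> v < h \<Longrightarrow> l < Z v" "h \<noteq> s \<Longrightarrow> Z h = l"
          using first_hit[of s v l] v st by auto
        have "h \<noteq> s" using h(3) l by auto
        then have hh: "s < h" "h < t" "Z h = l" using h v by auto
        have "h \<in> face_times Z s"
        proof (rule face_timesI[OF sJ])
          show "zl s \<le> Z h" using hh l 2 by simp
          show "Z h \<le> Z v" if "s \<le> v" "v \<le> h" for v using h(4)[of v] hh that by (cases "v = h") auto
        qed (use hh in simp)
        then have "lam_chord h p" using lam_chord_face(2)[OF sJ] by (simp add: p_def)
        then show ?thesis using nx2[of h p] hh 4 by blast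
      qed
    next
      case 3
      note ms = \<open>Z m < zl s\<close> and tm = \<open>Z t = Z m\<close>
      have s0: "0 < s" using ms tm Z_nonneg[OF s01(2)] Z_0 st by (cases "s = 0") (auto simp: left_lim_def)
      \<comment> \<open>The last passage above \<open>l\<close> before \<open>s\<close>, at
        \<open>w\<close>, turns out to be a jump that also passes over the level of
        \<open>t\<close>. The ends \<open>s\<close> and \<open>t\<close> are then to be found in the
        face of \<open>w\<close>.\<close>
      obtain l where l: "Z m < l" "l < zl s" using dense[OF ms] by blast
      have ls: "l < Z s" using l zl_le[OF s01(1)] by simp
      have l0: "0 < l" using l Z_nonneg[OF s01(2)] tm by simp
      obtain w where w: "0 < w" "w < s" "zl w \<le> l" "l \<le> Z w" "\<And>v. w < v \<Longrightarrow> v \<le> s \<Longrightarrow> l < Z v"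
        using last_below[of 0 s l] s0 s01 l ls l0 Z_0 by auto
      \<comment> \<open>A first passage chord starting before \<open>s\<close> from a level above
        the minimum would end strictly between \<open>s\<close> and \<open>t\<close>, by
        \<open>near_t\<close>.\<close>
      have cross: False if c: "c < s" "0 \<le> c" "zl c = k" "Z m < k" "\<And>v. c < v \<Longrightarrow> v \<le> s \<Longrightarrow> k < Z v" for c k
      proof -
        obtain v where v: "s < v" "v < t" "Z v < k" using near_t[OF c(4)] by blast
        have vc: "Z v \<le> zl c" "v \<le> 1" "s \<le> v" using v c st by simp_all
        obtain h where h: "s < h" "lam_less Z c h" "h \<le> v"
        proof (rule lam_less_from_below[OF c(2,1)])
          show "s \<le> 1" using s01 by simp
          show "zl c < Z v" if "c < v" "v \<le> s" for v using c(3) c(5)[OF that] by simp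
          fix h assume "s < h" "lam_less Z c h" "\<And>c'. s \<le> c' \<Longrightarrow> c' \<le> 1 \<Longrightarrow> Z c' \<le> zl c \<Longrightarrow> h \<le> c'"
          then show thesis using that[of h] vc by blast
        qed
        then show False using nx1[OF lam_chord_lam, of c h] c v by simp
      qed
      have zw: "zl w \<le> Z m"
      proof (rule ccontr)
        assume "\<not> zl w \<le> Z m"
        then have less: "Z m < zl w" by simp
        show False
          by (rule cross[OF w(2) _ refl less]) (use w(1,3,5) in \<open>auto intro: le_less_trans\<close>)
      qed
      have wJ: "w \<in> jump_times Z" using w zw l s01 by (intro jump_timeI) auto
      have wt: "Z m \<le> Z v" if vt: "w \<le> v" "v \<le> t" for v
      proof -
        consider "v = w" | "w < v" "v \<le> s" | "s \<le> v"
          using vt by (cases "v = w"; cases "v \<le> s") auto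
        then show ?thesis using w(4) w(5)[of v] l m(2)[of v] vt by cases auto
      qed
      have tB: "t \<in> face_times Z w" by (rule face_timesI[OF wJ]) (use w st zw tm wt in auto)
      obtain v where v: "s < v" "v < t" "Z v < l" using near_t[OF l(1)] by blast
      obtain h where h: "s \<le> h" "h \<le> v" "Z h \<le> l" "\<And>v. s \<le> v \<Longrightarrow> v < h \<Longrightarrow> l < Z v" "h \<noteq> s \<Longrightarrow> Z h = l"
        using first_hit[of s v l] v st by auto
      have "h \<noteq> s" using h(3) ls by auto
      then have hh: "s < h" "h < t" "Z h = l" using h v by auto
      have hB: "h \<in> face_times Z w"
      proof (rule face_timesI[OF wJ])
        show "zl w \<le> Z h" using hh l zw by simp
        show "Z h \<le> Z v" if vh: "w \<le> v" "v \<le> h" for v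
        proof -
          consider "v = w" | "w < v" "v \<le> s" | "s \<le> v" "v < h" | "v = h"
            using vh by (cases "v = w"; cases "v \<le> s"; cases "v = h") auto
          then show ?thesis using w(4) w(5)[of v] h(4)[of v] hh by cases auto
        qed
      qed (use hh w in simp)
      define p where "p = ap w"
      note p = face_apex[OF wJ, folded p_def]
      have c1: "lam_chord p h" "lam_chord h p" "lam_chord w p"
        using lam_chord_face[OF wJ hB] lam_chord_face(2)[OF wJ face_times_self[OF wJ]] by (auto simp: p_def)
      have "\<not> p < s" using nx1[OF c1(1)] hh by auto
      moreover have "\<not> t < p" using nx2[OF c1(2)] hh by auto
      moreover have "\<not> (s < p \<and> p < t)" using nx1[OF c1(3)] w by auto
      ultimately consider "p = s" | "p = t" by linarith
      then show ?thesis
      proof cases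
        case 1 then show ?thesis using lam_chord_face(1)[OF wJ tB] by (simp add: p_def)
      next
        case 2
        \<comment> \<open>With the apex at \<open>t\<close>, the other end \<open>s\<close> must be
          a face time of \<open>w\<close>. If not, the minimum between \<open>w\<close> and
          \<open>s\<close> is attained strictly inside, and the chord starting there is ruled out by
          \<open>cross\<close>.\<close>
        obtain r where r: "r \<in> {w..s}" "\<And>v. v \<in> {w..s} \<Longrightarrow> Z r \<le> Z v"
          using minimum_attained[of w s] w s01 by auto
        show ?thesis
        proof (cases "Z r = Z s")
          case True
          have "s \<in> face_times Z w"
          proof (rule face_timesI[OF wJ])
            show "zl w \<le> Z s" using zw ls l by simp
          qed (use w r True in auto)
          then show ?thesis using lam_chord_face(2)[OF wJ] 2 by (simp add: p_def)
        next
          case False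
          then have rs: "Z r < Z s" using r(2)[of s] w by auto
          then have "r \<noteq> s" by auto
          have "r \<noteq> w"
          proof
            assume "r = w"
            obtain v where "w < v" "v < s" "v \<le> 1" "Z v < Z w"
              using below_after_jump[OF jump_timeD(2,3)[OF wJ] w(2)] .
            then show False using r(2)[of v] \<open>r = w\<close> by auto
          qed
          then have rr: "w < r" "r < s" using r \<open>r \<noteq> s\<close> by auto
          have zr: "zl r = Z r" by (rule no_jump[of _ w]) (use rr r w s01 in auto)
          have lr: "l < Z r" using w(5)[of r] rr by simp
          have up: "Z r < Z v" if "r < v" "v \<le> s" for v
          proof (cases "v = s")
            case False
            show ?thesis by (rule above_after_minimum[of w s]) (use w s01 rr r that False in auto)
          qed (use rs in simp)
          have False
            by (rule cross[OF rr(2) _ zr _ up]) (use rr w(1) lr l(1) in simp_all)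
          then show ?thesis ..
        qed
      qed
    qed
  qed
qed

section \<open>Points at which the walks have to be compared\<close>

lemma lam_less_end: assumes "lam_less Z s t" "0 < s" shows "s < 1" "0 < zl s" "t < 1" "zl t = Z t"
proof -
  note st = assms(1)[unfolded lam_less_iff]
  show "s < 1" using st by simp
  then show z: "0 < zl s" using zl_pos[of s] assms by simp
  have "t \<noteq> 1" using st z Z_1 by auto
  then show "t < 1" using st by simp
  show "zl t = Z t" by (rule no_jump[of _ s]) (use st in \<open>auto simp: less_imp_le\<close>)
qed

text \<open>Otherwise \<open>t\<close> is a local minimum, and by \<open>before\<close> the supremum
  of the earlier times with smaller values is \<open>s\<close>. Then \<open>H4\<close> gives
  \<open>zl s < Z t\<close>, although the two are equal.\<close>

lemma below_after_lam_less:
  assumes "lam_less Z s t" "0 < s" and before: "\<And>a. a < s \<Longrightarrow> \<exists>v. a < v \<and> 0 \<le> v \<and> v < s \<and> Z v < zl s"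
    and "t < b"
  obtains d where "t < d" "d < b" "d \<le> 1" "Z d < Z t"
proof -
  note st = assms(1)[unfolded lam_less_iff]
  note te = lam_less_end[OF assms(1,2)]
  have "\<exists>d. t < d \<and> d < b \<and> d \<le> 1 \<and> Z d < Z t"
  proof (rule ccontr)
    assume n: "\<not> ?thesis"
    have t01: "t \<in> {0<..<1}" using st assms(2) te by auto
    have lm: "local_min_at Z t"
      unfolding local_min_at_def
    proof (intro conjI exI[of _ "min (b - t) (t - s)"] ballI impI)
      fix r assume r: "r \<in> {0..1}" "\<bar>r - t\<bar> < min (b - t) (t - s)"
      consider "r < t" | "r = t" | "t < r" by linarith
      then show "Z t \<le> Z r"
      proof cases
        case 1
        then have "r \<in> {s<..<t}" using r by auto
        then have "zl s < Z r" using st by blast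
        then show ?thesis using st by simp
      next
        case 3 then show ?thesis using n r by force
      qed simp
    qed (use t01 st assms(4) in auto)
    have "Sup {u\<in>{0..t}. Z u < Z t} = s"
    proof (rule cSup_eq_non_empty)
      obtain v where "0 \<le> v" "v < s" "Z v < zl s" using before[of 0] assms(2) by auto
      then have "v \<in> {u\<in>{0..t}. Z u < Z t}" using st by auto
      then show "{u\<in>{0..t}. Z u < Z t} \<noteq> {}" by blast
    next
      fix x assume x: "x \<in> {u\<in>{0..t}. Z u < Z t}"
      show "x \<le> s"
      proof (rule ccontr)
        assume "\<not> x \<le> s"
        then have "x \<in> {s<..<t}" using x by (cases "x = t") auto
        then show False using st x by force
      qed
    next
      fix y assume y: "\<And>x. x \<in> {u\<in>{0..t}. Z u < Z t} \<Longrightarrow> x \<le> y"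
      show "s \<le> y"
      proof (rule ccontr)
        assume "\<not> s \<le> y"
        then obtain v where "y < v" "0 \<le> v" "v < s" "Z v < zl s" using before[of y] by auto
        then show False using y[of v] st by auto
      qed
    qed
    then show False using H4[OF t01 lm refl] st by simp
  qed
  then show thesis using that by blast
qed

text \<open>For a large tree, the depth-first exploration of some subtree starts between \<open>c\<close> and \<open>a\<close> and
  ends between \<open>b\<close> and \<open>d\<close>.\<close>

definition window :: "real \<Rightarrow> real \<Rightarrow> real \<Rightarrow> real \<Rightarrow> bool" where
  "window c a b d \<longleftrightarrow> 0 \<le> c \<and> c < a \<and> a < b \<and> b < d \<and> d \<le> 1 \<and>
     (\<exists>l m. Z c < l \<and> (\<forall>v\<in>{a..b}. l < Z v) \<and> Z d < m \<and> (\<forall>v\<in>{c..b}. m < Z v))"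

lemma window_outside:
  assumes "lam_less Z s t" "0 < s" and before: "\<And>a. a < s \<Longrightarrow> \<exists>v. a < v \<and> 0 \<le> v \<and> v < s \<and> Z v < zl s"
    and "a0 < s" "t < b0"
  obtains c a b d where "window c a b d" "a0 < c" "a < s" "t < b" "d < b0"
proof -
  note st = assms(1)[unfolded lam_less_iff]
  note te = lam_less_end[OF assms(1,2)]
  obtain d where d: "t < d" "d < b0" "d \<le> 1" "Z d < Z t"
    using below_after_lam_less[OF assms(1,2) before assms(5)] .
  \<comment> \<open>The order of the choices matters: \<open>m\<close> depends on \<open>d\<close>,
    then \<open>c\<close> is taken so close to \<open>s\<close> that \<open>Z\<close> exceeds
    \<open>m\<close> from \<open>c\<close> to \<open>s\<close>, and only then are \<open>l\<close>,
    \<open>a\<close> and \<open>b\<close> fixed.\<close>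
  obtain m where m: "Z d < m" "m < zl s" using dense[of "Z d" "zl s"] d st by auto
  have s1: "s \<in> {0<..1}" using assms(2) te by simp
  obtain a1 where a1: "a1 < s" "\<forall>v\<in>{a1<..<s}. m < Z v" using near_left(2)[OF s1 m(2)] by blast
  obtain c where c: "max a0 a1 < c" "0 \<le> c" "c < s" "Z c < zl s"
    using before[of "max a0 a1"] assms(4) a1 by auto
  obtain l where l: "Z c < l" "l < zl s" using dense[OF c(4)] by blast
  obtain a2 where a2: "a2 < s" "\<forall>v\<in>{a2<..<s}. l < Z v" using near_left(2)[OF s1 l(2)] by blast
  obtain a where a: "max c a2 < a" "a < s" using dense[of "max c a2" s] c a2 by auto
  have "max l m < Z t" using l m st by simp
  moreover have "t \<in> {0..<1}" using st te by simp
  ultimately obtain b1 where b1: "t < b1" "\<forall>v\<in>{t..<b1}. max l m < Z v" using near_right(2) by blast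
  obtain b where b: "t < b" "b < min b1 d" using dense[of t "min b1 d"] b1 d by auto
  have mid: "zl s \<le> Z v" if "s \<le> v" "v \<le> t" for v
    using st zl_le[of s] s1 that by (cases "v = s"; cases "v = t") (auto simp: less_imp_le)
  have "l < Z v" if "v \<in> {a..b}" for v
  proof -
    consider "v < s" | "s \<le> v" "v \<le> t" | "t < v" by linarith
    then show ?thesis using that a2 a mid[of v] l b1 b by cases auto
  qed
  moreover have "m < Z v" if "v \<in> {c..b}" for v
  proof -
    consider "v < s" | "s \<le> v" "v \<le> t" | "t < v" by linarith
    then show ?thesis using that a1 c mid[of v] m b1 b by cases auto
  qed
  moreover have "c < a" "a < b" "b < d" using a b st by auto
  ultimately have "window c a b d" unfolding window_def using c d l m by blast
  then show thesis using that c a b d by auto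
qed

lemma window_inside:
  assumes "lam_less Z s t" "0 < s" "zl s = Z s" "s < a0" "b0 < t"
  obtains c a b d where "window c a b d" "s < c" "a < a0" "b0 < b" "d < t"
proof -
  note st = assms(1)[unfolded lam_less_iff]
  note te = lam_less_end[OF assms(1,2)]
  \<comment> \<open>The midpoint only serves to separate \<open>a\<close> from \<open>b\<close>. The
    levels then come from minima over closed intervals: \<open>l\<close> from \<open>a\<close> to
    \<open>b\<close>, and after the choice of \<open>c\<close>, \<open>m\<close> from
    \<open>c\<close> to \<open>b\<close>.\<close>
  obtain a where a: "s < a" "a < min a0 ((s + t) / 2)"
    using dense[of s "min a0 ((s + t) / 2)"] assms(4) st by auto
  obtain b where b: "max b0 ((s + t) / 2) < b" "b < t"
    using dense[of "max b0 ((s + t) / 2)" t] assms(5) st by auto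
  have ab: "a < b" using a b by simp
  obtain r where r: "r \<in> {a..b}" "\<And>v. v \<in> {a..b} \<Longrightarrow> Z r \<le> Z v"
    using minimum_attained[of a b] a b ab st by auto
  have "zl s < Z r" using r a b st by auto
  then obtain l where l: "zl s < l" "l < Z r" using dense by blast
  have "s \<in> {0..<1}" "Z s < l" using st te l assms(3) by auto
  then obtain c1 where c1: "s < c1" "\<forall>v\<in>{s..<c1}. Z v < l" using near_right(1) by blast
  obtain c where c: "s < c" "c < min c1 a" using dense[of s "min c1 a"] c1 a by auto
  obtain q where q: "q \<in> {c..b}" "\<And>v. v \<in> {c..b} \<Longrightarrow> Z q \<le> Z v"
    using minimum_attained[of c b] c a b ab st by auto
  have "zl s < Z q" using q b c st by auto
  then obtain m where m: "zl s < m" "m < Z q" using dense by blast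
  have "t \<in> {0<..1}" "zl t < m" using st te m by auto
  then obtain d1 where d1: "d1 < t" "\<forall>v\<in>{d1<..<t}. Z v < m" using near_left(1) by blast
  obtain d where d: "max d1 b < d" "d < t" using dense[of "max d1 b" t] d1 b by auto
  have "\<forall>v\<in>{a..b}. l < Z v" using r(2) l by force
  moreover have "\<forall>v\<in>{c..b}. m < Z v" using q(2) m by force
  moreover have "Z c < l" "Z d < m" using c1 c d1 d by auto
  moreover have "0 \<le> c" "c < a" "b < d" "d \<le> 1" using c d st by auto
  ultimately have "window c a b d" unfolding window_def using ab by blast
  then show thesis using that c a b d by auto
qed

text \<open>If \<open>Z\<close> goes below \<open>zl s\<close> arbitrarily close before
  \<open>s\<close>, it does so right after \<open>t\<close> as well and windows fit just outside the
  chord. Otherwise \<open>s\<close> is no jump, so \<open>Z\<close> is close to the level just after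
  \<open>s\<close> and just before \<open>t\<close>, and windows fit just inside.\<close>

lemma nested_windows:
  assumes "lam_less Z s t" "0 < s" "0 < \<delta>"
  obtains c a b d c' a' b' d' where "window c a b d" "window c' a' b' d'" "a < c'" "d' < b"
    "s - \<delta> < c" "a' < s + \<delta>" "t - \<delta> < b'" "d < t + \<delta>"
proof (cases "\<forall>a<s. \<exists>v. a < v \<and> 0 \<le> v \<and> v < s \<and> Z v < zl s")
  case True
  then have before: "\<And>a. a < s \<Longrightarrow> \<exists>v. a < v \<and> 0 \<le> v \<and> v < s \<and> Z v < zl s" by blast
  have \<delta>: "s - \<delta> < s" "t < t + \<delta>" using assms by auto
  obtain c a b d where 1: "window c a b d" "s - \<delta> < c" "a < s" "t < b" "d < t + \<delta>"
    using window_outside[OF assms(1,2) before \<delta>] by blast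
  obtain c' a' b' d' where 2: "window c' a' b' d'" "a < c'" "a' < s" "t < b'" "d' < b"
    using window_outside[OF assms(1,2) before 1(3,4)] by blast
  show ?thesis by (rule that[OF 1(1) 2(1,2,5) 1(2) _ _ 1(5)]) (use 2 \<delta> in auto)
next
  case False
  then obtain a where a: "a < s" "\<And>v. a < v \<Longrightarrow> 0 \<le> v \<Longrightarrow> v < s \<Longrightarrow> zl s \<le> Z v" by force
  have s01: "s \<in> {0..1}" using assms(2) lam_less_end(1)[OF assms(1,2)] by simp
  have zs: "zl s = Z s"
  proof (rule ccontr)
    assume "zl s \<noteq> Z s"
    then have "zl s < Z s" using zl_le[OF s01] by simp
    then obtain v where "a < v" "0 \<le> v" "v < s" "Z v < zl s" using a(1) by (rule below_before_jump[OF s01])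
    then show False using a(2)[of v] by simp
  qed
  have \<delta>: "s < s + \<delta>" "t - \<delta> < t" using assms by auto
  obtain c' a' b' d' where 2: "window c' a' b' d'" "s < c'" "a' < s + \<delta>" "t - \<delta> < b'" "d' < t"
    using window_inside[OF assms(1,2) zs \<delta>] by blast
  obtain c a b d where 1: "window c a b d" "s < c" "a < c'" "d' < b" "d < t"
    using window_inside[OF assms(1,2) zs 2(2,5)] by blast
  show ?thesis by (rule that[OF 1(1) 2(1) 1(3,4) _ 2(3,4)]) (use 1 \<delta> in auto)
qed

text \<open>Isolates a descent of \<open>Z\<close> near \<open>r\<close>, with a gap between
  \<open>l\<close> and \<open>l'\<close> that leaves room for an integer level of the walk. If
  \<open>r\<close> is a first passage at its level, the descent is seen before \<open>r\<close>.
  Otherwise \<open>r = u\<close>, where \<open>H2\<close> gives lower values, or the level was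
  already attained between \<open>u\<close> and \<open>r\<close>, and the uniqueness in
  \<open>H1\<close> gives lower values after \<open>r\<close>.\<close>

lemma face_time_descent:
  assumes "u \<in> jump_times Z" "r \<in> face_times Z u" "0 < \<delta>"
  obtains a d l l' where "u \<le> a" "a < d" "d \<le> 1" "r - \<delta> < a" "d < r + \<delta>"
    "Z d < l" "zl u < l" "l < l'" "\<And>v. u \<le> v \<Longrightarrow> v \<le> a \<Longrightarrow> l' < Z v"
proof -
  note u = jump_timeD[OF assms(1)]
  have r: "u \<le> r" "r \<le> te u" "\<And>v. u \<le> v \<Longrightarrow> v \<le> r \<Longrightarrow> Z r \<le> Z v"
    using assms(2) by (auto simp: face_times_iff[OF assms(1)])
  have r1: "r < 1" using r face_end(2)[OF assms(1)] by simp
  have zr: "zl u \<le> Z r" using r face_end(3,4)[OF assms(1)] by (cases "r = te u") (auto simp: less_imp_le)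
  note conclude = that
  have fin: thesis if ad: "u \<le> a" "a < d" "d \<le> 1" "r - \<delta> < a" "d < r + \<delta>"
    and q: "q \<in> {u..a}" "\<And>v. v \<in> {u..a} \<Longrightarrow> Z q \<le> Z v" "Z d < Z q" "zl u < Z q" for a d q
  proof -
    obtain l' where l': "max (Z d) (zl u) < l'" "l' < Z q" using dense[of "max (Z d) (zl u)" "Z q"] q by auto
    obtain l where l: "max (Z d) (zl u) < l" "l < l'" using dense[OF l'(1)] by blast
    show thesis by (rule conclude[OF ad]) (use l l' q(2) in \<open>auto intro: less_le_trans\<close>)
  qed
  show thesis
  proof (cases "u < r \<and> (\<forall>v. u \<le> v \<and> v < r \<longrightarrow> Z r < Z v)")
    case True
    obtain a where a: "max u (r - \<delta>) < a" "a < r" using dense[of "max u (r - \<delta>)" r] True assms(3) by auto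
    obtain q where q: "q \<in> {u..a}" "\<And>v. v \<in> {u..a} \<Longrightarrow> Z q \<le> Z v"
      using minimum_attained[of u a] u a r1 by auto
    have qr: "Z r < Z q" using True q a by auto
    have "r \<in> {0<..1}" "zl r < Z q" using u True r1 qr face_time_no_jump[OF assms(1,2)] by auto
    then obtain d1 where d1: "d1 < r" "\<forall>v\<in>{d1<..<r}. Z v < Z q" using near_left(1) by blast
    obtain d where d: "max d1 a < d" "d < r" using dense[of "max d1 a" r] d1 a by auto
    show thesis by (rule fin[of a d q]) (use a d q r1 d1 qr zr assms(3) in auto)
  next
    case False
    have "\<exists>d. r < d \<and> d < r + \<delta> \<and> d \<le> 1 \<and> Z d < Z r" and "zl u < Z r"
    proof -
      show "\<exists>d. r < d \<and> d < r + \<delta> \<and> d \<le> 1 \<and> Z d < Z r"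
      proof (cases "r = u")
        case True
        have "u < u + \<delta>" using assms(3) by simp
        then show ?thesis using below_after_jump[OF u(2,3)] True by metis
      next
        case ru: False
        then obtain q where q: "u \<le> q" "q < r" "Z q = Z r" using False r by force
        have "q \<noteq> u"
        proof
          assume "q = u"
          have "u < r" using q by simp
          then obtain v where "u < v" "v < r" "v \<le> 1" "Z v < Z u" by (rule below_after_jump[OF u(2,3)])
          then show False using r(3)[of v] q \<open>q = u\<close> by simp
        qed
        show ?thesis
        proof (rule ccontr)
          assume n: "\<not> ?thesis"
          obtain e where e: "r < e" "e < min (r + \<delta>) 1" using dense[of r "min (r + \<delta>) 1"] r1 assms(3) by auto
          have qm: "Z q \<le> Z v" if "v \<in> {u..e}" for v
          proof (cases "v \<le> r")
            case False
            then have "\<not> Z v < Z r" using n that e by auto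
            then show ?thesis using q by simp
          qed (use r(3)[of v] q that in simp)
          have "q = r"
            by (rule unique_interior_minimum[OF _ _ _ _ q(3) qm]) (use u(2) e q \<open>q \<noteq> u\<close> in auto)
          then show False using q by simp
        qed
      qed
      show "zl u < Z r"
      proof (cases "r = te u")
        case True
        have "u < r" using face_end(1)[OF assms(1)] True by simp
        then obtain v where "u \<le> v" "v < r" "Z v \<le> Z r" using False by force
        then show ?thesis using face_end(4)[OF assms(1), of v] True by simp
      qed (use face_end(4)[OF assms(1), of r] r in simp)
    qed
    then obtain d where "r < d" "d < r + \<delta>" "d \<le> 1" "Z d < Z r" by blast
    then show thesis by (intro fin[of r d r]) (use r \<open>zl u < Z r\<close> assms(3) in auto)
  qed
qed

text \<open>The apex is the first time at its level; without lower values just after it, it would be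
  a local minimum, unless it is the jump time itself, where \<open>H2\<close> applies.\<close>

lemma below_after_apex:
  assumes "u \<in> jump_times Z" "0 < \<delta>"
  obtains d where "ap u < d" "d < ap u + \<delta>" "d \<le> 1" "Z d < Z (ap u)"
proof -
  note u = jump_timeD[OF assms(1)]
  note p = face_apex[OF assms(1)]
  have "\<exists>d. ap u < d \<and> d < ap u + \<delta> \<and> d \<le> 1 \<and> Z d < Z (ap u)"
  proof (cases "ap u = u")
    case True
    have "u < u + \<delta>" using assms(2) by simp
    then show ?thesis using below_after_jump[OF u(2,3)] True by metis
  next
    case False
    show ?thesis
    proof (rule ccontr)
      assume n: "\<not> ?thesis"
      have "local_min_at Z (ap u)"
        unfolding local_min_at_def
      proof (intro conjI exI[of _ "min \<delta> (ap u - u)"] ballI impI)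
        show "ap u \<in> {0..1}" using p(1,2) u face_end(2)[OF assms(1)] by auto
        show "0 < min \<delta> (ap u - u)" using False p(1) assms(2) by simp
        fix r assume r: "r \<in> {0..1}" "\<bar>r - ap u\<bar> < min \<delta> (ap u - u)"
        consider "r < ap u" | "r = ap u" | "ap u < r" by linarith
        then show "Z (ap u) \<le> Z r"
        proof cases
          case 1 then show ?thesis using p(5)[of r] r by auto
        next
          case 3 then show ?thesis using n r by force
        qed simp
      qed
      then show False using apex[OF assms(1)] by simp
    qed
  qed
  then show thesis using that by blast
qed

end

section \<open>First passages of the walk and positions of edges\<close>

context nc_tree
begin

abbreviation "wk \<equiv> luka_path tree"

lemma subtree_walk:
  assumes "i < n"
  shows "0 < sub_size i" "i + sub_size i \<le> n" "wk (i + sub_size i) < wk i"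
    "\<And>m. i \<le> m \<Longrightarrow> m < i + sub_size i \<Longrightarrow> wk i \<le> wk m"
  using rt.sz_pos[OF assms] rt.sz_le[OF assms] rt.walk_subtree_end[OF assms] assms
  by (simp_all add: luka_path_walk)

text \<open>The child is number \<open>wk (Suc i) - M\<close>, counted from 0. Its subtree is
  complete before the walk goes below \<open>M\<close>, and its label is among those of its subtree;
  this bounds the label from both sides, up to the height from below.\<close>

lemma child_at_level:
  assumes "i < n" "wk i \<le> M" "M \<le> wk (Suc i)"
  obtains c q where "i < c" "wk c = M" "\<And>m. i < m \<Longrightarrow> m < c \<Longrightarrow> M < wk m"
    "{vlab i, q} \<in> E" "c \<le> q + height tree" "\<And>j. c < j \<Longrightarrow> j \<le> n \<Longrightarrow> wk j < M \<Longrightarrow> q < j"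
proof -
  have "rt.walk (Suc i) = rt.walk i + int (card (rt.ch i)) - 1" by (rule rt.walk_Suc[OF assms(1)])
  then have "nat (wk (Suc i) - M) < card (rt.ch i)" 
    using assms num_children_rank[OF assms(1)] by (simp add: luka_path_walk del: luka_path.simps)
  then obtain c where c: "i < c" "c < n" "c \<in> rt.ch i" "rt.walk c = rt.walk (Suc i) - int (nat (wk (Suc i) - M))"
    "\<And>m. i < m \<Longrightarrow> m < c \<Longrightarrow> rt.walk c < rt.walk m"
    by (rule rt.nth_child[OF assms(1)]) blast
  have wc: "wk c = M" using c assms by (simp add: luka_path_walk del: luka_path.simps)
  have before: "M < wk m" if "i < m" "m < c" for m
    using c(5)[OF that] wc that c(2) by (simp add: luka_path_walk)
  have "vlab c \<in> {rt.lo c..<rt.lo c + sub_size c}" using rt.lab_sub[OF c(2)] rt.sub_self[OF c(2)] by blast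
  moreover note rt.lo_bounds[OF c(2)]
  moreover have "c + sub_size c \<le> j" if j: "c < j" "j \<le> n" "wk j < M" for j
    using subtree_walk(4)[OF c(2), of j] j wc by (cases "c + sub_size c \<le> j") auto
  ultimately have "c \<le> vlab c + height tree" "\<And>j. c < j \<Longrightarrow> j \<le> n \<Longrightarrow> wk j < M \<Longrightarrow> vlab c < j"
    by force+
  moreover have "{vlab i, vlab c} \<in> E"
    using rt.edge[of c] c by (simp add: rt.ch_def insert_commute)
  ultimately show thesis using that[OF c(1) wc before] by blast
qed

lemma label_hitting_time:
  assumes "i < n"
  obtains T where "i < T" "T \<le> n" "wk T = wk (Suc i) - int (num_left_children E (vx i))"
    "\<And>m. i < m \<Longrightarrow> m < T \<Longrightarrow> wk T < wk m" "vlab i < T" "T \<le> Suc (vlab i + height tree)"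
proof (rule rt.lab_between_children[OF assms])
  fix T assume T: "i < T" "T \<le> n" "rt.walk T = rt.walk (Suc i) - int (card {c \<in> rt.ch i. vlab c < vlab i})"
    "\<And>m. i < m \<Longrightarrow> m < T \<Longrightarrow> rt.walk T < rt.walk m" "vlab i < T" "T \<le> Suc (vlab i + height tree)"
  show thesis
    by (rule that[OF T(1,2) _ _ T(5,6)])
      (use T assms in \<open>simp_all add: luka_path_walk num_left_children_rank del: luka_path.simps\<close>)
qed

text \<open>Gaps larger than the height ensure that the label intervals are strictly nested as
  well.\<close>

lemma edge_between_subtrees:
  assumes "i < j" "j < n" "j + sub_size j + height tree < i + sub_size i" "i + height tree < j"
  obtains q r where "{q, r} \<in> E" "i \<le> q + height tree" "q < j" "j + sub_size j \<le> r + height tree" "r < i + sub_size i"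
proof -
  have i: "i < n" using assms by simp
  note lo = rt.lo_bounds[OF i] rt.lo_bounds[OF assms(2)]
  obtain q r where "{q, r} \<in> E" "rt.lo i \<le> q" "q < rt.lo j" "rt.lo j + sub_size j \<le> r" "r < rt.lo i + sub_size i"
    by (rule rt.connecting_edge[OF assms(1,2)]) (use assms lo in auto)
  then show thesis using that[of q r] lo by simp
qed

text \<open>Two vertices are required because the tree with one vertex has no edge and its drawing
  is empty.\<close>

lemma edge_at_vertex:
  assumes "p < n" "2 \<le> n" obtains q where "{p, q} \<in> E"
proof (cases "p = 0")
  case False
  then show ?thesis using parent_exists[OF assms(1)] that by (metis insert_commute)
next
  case True
  have "1 < n" "(1::nat) \<noteq> 0" using assms by auto
  then have "(0, 1) \<in> (adjacent E)\<^sup>*" using conn[OF n_pos] by blast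
  then obtain q where "(0, q) \<in> adjacent E"
    by (metis converse_rtranclE zero_neq_one)
  then show ?thesis using that True by (simp add: adjacent_iff)
qed

end

section \<open>Convergence\<close>

lemma (in excursion) Z_bounded: "\<exists>M. \<forall>v\<in>{0..1}. Z v \<le> M"
proof (rule locally_bounded_imp_bounded[OF zero_le_one])
  fix x :: real assume "0 \<le> x" "x < 1"
  then have "\<exists>b. x < b \<and> b \<le> 1 \<and> (\<forall>v\<in>{x..<b}. Z v < Z x + 1)" by (intro near_right(1)) auto
  then show "\<exists>b>x. \<exists>M. \<forall>v\<in>{x<..<b}. Z v \<le> M"
    by (metis atLeastLessThan_iff greaterThanLessThan_iff less_imp_le)
next
  fix x :: real assume "0 < x" "x \<le> 1"
  then have "\<exists>a. 0 \<le> a \<and> a < x \<and> (\<forall>v\<in>{a<..<x}. Z v < zl x + 1)" by (intro near_left(1)) auto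
  then show "\<exists>a<x. \<exists>M. \<forall>v\<in>{a<..<x}. Z v \<le> M" by (meson less_imp_le)
qed

locale tree_limit = labelled_excursion +
  fixes \<theta> :: "nat \<Rightarrow> nat set set" and B :: "nat \<Rightarrow> real"
  assumes tree: "\<And>n. 1 \<le> n \<Longrightarrow> noncrossing_tree n (\<theta> n)"
    and B_lim: "filterlim B at_top sequentially"
    and height: "(\<lambda>n. real (height (shape (\<theta> n))) / real n) \<longlonglongrightarrow> 0"
    and luka: "(\<lambda>n. skorokhod_dist
                 (\<lambda>s. real_of_int (luka_path (shape (\<theta> n)) (nat \<lfloor>real n * s\<rfloor>)) / B n) Z) \<longlonglongrightarrow> 0"
    and left: "\<And>s i c. s \<in> {0<..<1} \<Longrightarrow> (\<And>n. 1 \<le> n \<Longrightarrow> i n < n) \<Longrightarrow>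
                 (\<lambda>n. real (num_children (shape (\<theta> n)) (lex_vertex (shape (\<theta> n)) (i n))) / B n)
                    \<longlonglongrightarrow> c \<Longrightarrow> c > 0 \<Longrightarrow>
                 (\<lambda>n. real (i n) / real n) \<longlonglongrightarrow> s \<Longrightarrow>
                 (\<lambda>n. real (num_left_children (\<theta> n) (lex_vertex (shape (\<theta> n)) (i n))) /
                      real (num_children (shape (\<theta> n)) (lex_vertex (shape (\<theta> n)) (i n))))
                    \<longlonglongrightarrow> lab s"
begin

section \<open>Comparison of the walks with the limit\<close>

abbreviation W :: "nat \<Rightarrow> nat \<Rightarrow> int" where "W n j \<equiv> luka_path (shape (\<theta> n)) j"
abbreviation Ht :: "nat \<Rightarrow> nat" where "Ht n \<equiv> Defs.height (shape (\<theta> n))"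

abbreviation Wr :: "nat \<Rightarrow> nat \<Rightarrow> real" where "Wr n j \<equiv> real_of_int (W n j)"

lemma nc: "1 \<le> n \<Longrightarrow> nc_tree n (\<theta> n)"
  using tree by (simp add: nc_tree_def)

text \<open>The Skorokhod distance is an infimum; the vanishing extra term makes it a bound that
  some time change really achieves.\<close>

definition walk_error :: "nat \<Rightarrow> real" where
  "walk_error n = skorokhod_dist (\<lambda>s. Wr n (nat \<lfloor>real n * s\<rfloor>) / B n) Z + 1 / real (Suc n)"

lemma walk_error_lim: "walk_error \<longlonglongrightarrow> 0"
  unfolding walk_error_def using tendsto_add[OF luka LIMSEQ_Suc[OF lim_1_over_n]] by simp

lemma time_change_exists:
  "\<exists>\<phi>\<in>time_changes. \<forall>t\<in>{0..1}. \<bar>\<phi> t - t\<bar> \<le> walk_error n \<and>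
     \<bar>Wr n (nat \<lfloor>real n * \<phi> t\<rfloor>) / B n - Z t\<bar> \<le> walk_error n"
proof -
  define X where "X s = Wr n (nat \<lfloor>real n * s\<rfloor>) / B n" for s
  define A where "A = {\<epsilon>. 0 < \<epsilon> \<and> (\<exists>\<phi>\<in>time_changes. \<forall>t\<in>{0..1}. \<bar>\<phi> t - t\<bar> \<le> \<epsilon> \<and> \<bar>X (\<phi> t) - Z t\<bar> \<le> \<epsilon>)}"
  obtain M where M: "\<And>v. v \<in> {0..1} \<Longrightarrow> Z v \<le> M" using Z_bounded by blast
  define C where "C = Max ((\<lambda>j. \<bar>Wr n j / B n\<bar>) ` {..n})"
  have C: "\<bar>X s\<bar> \<le> C" if "s \<in> {0..1}" for s
  proof -
    have "real n * s \<le> real n" using that by (simp add: mult_left_le)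
    then have "nat \<lfloor>real n * s\<rfloor> \<le> n" by (simp add: floor_le_iff nat_le_iff)
    then show ?thesis unfolding X_def C_def by (intro Max_ge) auto
  qed
  \<comment> \<open>The infimum is informative only if some bound is admissible: the identity with a
    crude uniform bound is one.\<close>
  have "id \<in> time_changes" by (auto simp: time_changes_def strict_mono_on_def)
  moreover have "\<bar>id t - t\<bar> \<le> C + M + 1 \<and> \<bar>X (id t) - Z t\<bar> \<le> C + M + 1" if "t \<in> {0..1}" for t
    using C[OF that] M[OF that] Z_nonneg[OF that] by simp
  moreover have "0 < C + M + 1" using C[of 0] M[of 0] Z_0 by simp
  ultimately have "C + M + 1 \<in> A" unfolding A_def by blast
  then have "A \<noteq> {}" by blast
  moreover have "Inf A < walk_error n"
    by (simp add: walk_error_def skorokhod_dist_def A_def X_def)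
  ultimately obtain e where e: "e \<in> A" "e < walk_error n" using cInf_lessD by blast
  then obtain \<phi> where "\<phi> \<in> time_changes" "\<forall>t\<in>{0..1}. \<bar>\<phi> t - t\<bar> \<le> e \<and> \<bar>X (\<phi> t) - Z t\<bar> \<le> e"
    unfolding A_def by blast
  then show ?thesis using e(2) unfolding X_def by (intro bexI[of _ \<phi>]) force+
qed

definition tc :: "nat \<Rightarrow> real \<Rightarrow> real" where
  "tc n = (SOME \<phi>. \<phi> \<in> time_changes \<and> (\<forall>t\<in>{0..1}. \<bar>\<phi> t - t\<bar> \<le> walk_error n \<and>
     \<bar>Wr n (nat \<lfloor>real n * \<phi> t\<rfloor>) / B n - Z t\<bar> \<le> walk_error n))"

definition idx :: "nat \<Rightarrow> real \<Rightarrow> nat" where "idx n t = nat \<lfloor>real n * tc n t\<rfloor>"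

lemma tc: "tc n \<in> time_changes"
  and tc_close: "t \<in> {0..1} \<Longrightarrow> \<bar>tc n t - t\<bar> \<le> walk_error n"
  and idx_walk: "t \<in> {0..1} \<Longrightarrow> \<bar>Wr n (idx n t) / B n - Z t\<bar> \<le> walk_error n"
  using someI_ex[OF time_change_exists[of n, unfolded Bex_def]] unfolding idx_def tc_def[symmetric] by blast+

lemma tc_less: "s \<in> {0..1} \<Longrightarrow> t \<in> {0..1} \<Longrightarrow> s < t \<Longrightarrow> tc n s < tc n t"
  using tc[of n] by (auto simp: time_changes_def strict_mono_on_def)

lemma tc_less_iff: "s \<in> {0..1} \<Longrightarrow> t \<in> {0..1} \<Longrightarrow> tc n s < tc n t \<longleftrightarrow> s < t"
  using tc_less[of s t n] tc_less[of t s n] by (cases s t rule: linorder_cases) auto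

lemma tc_range: "t \<in> {0..1} \<Longrightarrow> tc n t \<in> {0..1}"
  using tc[of n] unfolding time_changes_def by blast

lemma tc_surj: assumes "x \<in> {0..1}" obtains t where "t \<in> {0..1}" "tc n t = x"
proof -
  have "x \<in> tc n ` {0..1}" using tc[of n] assms unfolding time_changes_def by blast
  then show thesis using that by blast
qed

lemma idx_le: assumes "t \<in> {0..1}" shows "idx n t \<le> n"
proof -
  have "real n * tc n t \<le> real n" using tc_range[OF assms, of n] by (simp add: mult_left_le)
  then show ?thesis unfolding idx_def by (simp add: floor_le_iff nat_le_iff)
qed

lemma idx_bounds: assumes "t \<in> {0..1}" shows "real (idx n t) \<le> real n * tc n t" "real n * tc n t < real (idx n t) + 1"
proof -
  have "0 \<le> real n * tc n t" using tc_range[OF assms, of n] by simp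
  then show "real (idx n t) \<le> real n * tc n t" "real n * tc n t < real (idx n t) + 1"
    unfolding idx_def by (simp_all add: of_nat_nat) 
qed

lemma idx_mono: assumes "s \<in> {0..1}" "t \<in> {0..1}" "s \<le> t" shows "idx n s \<le> idx n t"
proof -
  have "tc n s \<le> tc n t" using tc_less[OF assms(1,2)] assms(3) by (cases "s = t") (auto simp: less_imp_le)
  then show ?thesis unfolding idx_def by (intro nat_mono floor_mono mult_left_mono) auto
qed

lemma idx_lim: assumes "t \<in> {0..1}" shows "(\<lambda>n. real (idx n t) / real n) \<longlonglongrightarrow> t"
proof -
  have "(\<lambda>n. real (idx n t) / real n - t) \<longlonglongrightarrow> 0"
  proof (rule Lim_null_comparison)
    show "(\<lambda>n. walk_error n + 1 / real n) \<longlonglongrightarrow> 0"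
      using tendsto_add[OF walk_error_lim lim_1_over_n] by simp
    have "norm (real (idx n t) / real n - t) \<le> walk_error n + 1 / real n" if n: "0 < n" for n
    proof -
      have "real (idx n t) / real n - tc n t = (real (idx n t) - real n * tc n t) / real n"
        using n by (simp add: diff_divide_distrib)
      then have "\<bar>real (idx n t) / real n - tc n t\<bar> = \<bar>real (idx n t) - real n * tc n t\<bar> / real n" by simp
      also have "\<dots> \<le> 1 / real n" using idx_bounds[OF assms, of n] by (intro divide_right_mono) auto
      finally have "\<bar>real (idx n t) / real n - tc n t\<bar> \<le> 1 / real n" .
      then show ?thesis using tc_close[OF assms, of n] by simp
    qed
    then show "\<forall>\<^sub>F n in sequentially. norm (real (idx n t) / real n - t) \<le> walk_error n + 1 / real n"
      using eventually_gt_at_top[of 0] by (rule eventually_mono[rotated])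
  qed
  then show ?thesis by (simp add: LIM_zero_iff)
qed

lemma B_pos: "\<forall>\<^sub>F n in sequentially. 0 < B n"
  using B_lim by (auto simp: filterlim_at_top_dense)

lemma walk_at_lim: assumes "t \<in> {0..1}" shows "(\<lambda>n. Wr n (idx n t) / B n) \<longlonglongrightarrow> Z t"
proof -
  have "(\<lambda>n. Wr n (idx n t) / B n - Z t) \<longlonglongrightarrow> 0"
    by (rule Lim_null_comparison[OF _ walk_error_lim]) (use idx_walk[OF assms] in auto)
  then show ?thesis by (simp add: LIM_zero_iff)
qed

lemma below_levelI:
  assumes "(\<lambda>n. real_of_int (f n) / B n) \<longlonglongrightarrow> z" "z < l"
  shows "\<forall>\<^sub>F n in sequentially. real_of_int (f n) < l * B n"
  using order_tendstoD(2)[OF assms] B_pos by eventually_elim (simp add: field_simps)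

lemma above_levelI:
  assumes "(\<lambda>n. real_of_int (f n) / B n) \<longlonglongrightarrow> z" "l < z"
  shows "\<forall>\<^sub>F n in sequentially. l * B n < real_of_int (f n)"
  using order_tendstoD(1)[OF assms] B_pos by eventually_elim (simp add: field_simps)

text \<open>Time changes are onto, so no rank between two compared ranks is skipped; this controls
  the walk at all of them.\<close>

lemma index_time:
  assumes n: "0 < n" and s: "s \<in> {0..1}" and t: "t \<in> {0..1}" "s \<le> t" and j: "idx n s \<le> j" "j \<le> idx n t"
  obtains v where "v \<in> {s..t}" "idx n v = j"
proof (cases "j = idx n s")
  case True
  then show ?thesis using that[of s] t by simp
next
  case False
  define x where "x = real j / real n"
  have jn: "j \<le> n" using j(2) idx_le[OF t(1), of n] by simp
  have nx: "real n * x = real j" using n by (simp add: x_def)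
  have "x \<in> {0..1}" using n jn by (simp add: x_def)
  then obtain v where v: "v \<in> {0..1}" "tc n v = x" by (rule tc_surj)
  have "idx n v = j" unfolding idx_def v(2) nx by simp
  have "real n * tc n s < real j" using idx_bounds(2)[OF s, of n] j(1) False by linarith
  then have "tc n s < tc n v" unfolding v(2) using n nx by (metis mult_less_cancel_left_pos of_nat_0_less_iff)
  then have "s < v" using tc_less_iff[OF s v(1)] by simp
  have "real j \<le> real n * tc n t" using idx_bounds(1)[OF t(1), of n] j(2) by linarith
  then have "tc n v \<le> tc n t" unfolding v(2) using n nx by (metis mult_le_cancel_left_pos of_nat_0_less_iff)
  then have "v \<le> t" using tc_less_iff[OF t(1) v(1)] by (simp add: not_less[symmetric])
  then show ?thesis using that[of v] \<open>s < v\<close> \<open>idx n v = j\<close> by simp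
qed

text \<open>The minimum of \<open>Z\<close> over the closed interval is attained, hence exceeds
  \<open>l\<close> by a fixed amount, which eventually dominates the error.\<close>

lemma walk_above_on_range:
  assumes "0 \<le> s" "s \<le> t" "t \<le> 1" "\<And>v. v \<in> {s..t} \<Longrightarrow> l < Z v"
  shows "\<forall>\<^sub>F n in sequentially. \<forall>j. idx n s \<le> j \<and> j \<le> idx n t \<longrightarrow> l * B n < Wr n j"
proof -
  have st: "s \<in> {0..1}" "t \<in> {0..1}" using assms by auto
  obtain q where q: "q \<in> {s..t}" "\<And>v. v \<in> {s..t} \<Longrightarrow> Z q \<le> Z v"
    using minimum_attained[OF assms(1-3)] by blast
  have "0 < Z q - l" using assms(4)[OF q(1)] by simp
  then have "\<forall>\<^sub>F n in sequentially. walk_error n < Z q - l" by (rule order_tendstoD(2)[OF walk_error_lim])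
  then show ?thesis using B_pos eventually_gt_at_top[of 0]
  proof eventually_elim
    case (elim n)
    show ?case
    proof (intro allI impI)
      fix j assume j: "idx n s \<le> j \<and> j \<le> idx n t"
      obtain v where v: "v \<in> {s..t}" "idx n v = j"
        using index_time[OF elim(3) st assms(2), of j] j by blast
      have "\<bar>Wr n j / B n - Z v\<bar> \<le> walk_error n"
        using idx_walk[of v n] v assms by auto
      then have "l < Wr n j / B n" using q(2)[OF v(1)] elim(1) by linarith
      then show "l * B n < Wr n j" using elim(2) by (simp add: field_simps)
    qed
  qed
qed

lemma height_gap:
  assumes "s \<in> {0..1}" "t \<in> {0..1}" "s < t"
  shows "\<forall>\<^sub>F n in sequentially. idx n s + Ht n < idx n t"
proof -
  have "(\<lambda>n. real (idx n t) / real n - real (idx n s) / real n - real (Ht n) / real n) \<longlonglongrightarrow> t - s - 0"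
    by (intro tendsto_diff idx_lim assms height)
  then have "\<forall>\<^sub>F n in sequentially. 0 < real (idx n t) / real n - real (idx n s) / real n - real (Ht n) / real n"
    by (rule order_tendstoD(1)) (use assms(3) in simp)
  then show ?thesis using eventually_gt_at_top[of 0]
  proof eventually_elim
    case (elim n)
    have "0 < (real (idx n t) - real (idx n s) - real (Ht n)) / real n"
      using elim(1) by (simp add: diff_divide_distrib)
    then have "0 < real (idx n t) - real (idx n s) - real (Ht n)" using elim(2) by (simp add: zero_less_divide_iff)
    then show ?case by linarith
  qed
qed

text \<open>The tolerance \<open>Suc (q + Ht n)\<close> covers both the discrepancy between ranks
  and labels and the extra unit of \<open>label_hitting_time\<close>; both vanish after division by
  \<open>n\<close>.\<close>

lemma label_position:
  assumes "s \<in> {0..1}" "t \<in> {0..1}" "x - \<delta> < s" "t < x + \<delta>"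
  shows "\<forall>\<^sub>F n in sequentially. \<forall>q. idx n s \<le> Suc (q + Ht n) \<and> q \<le> idx n t \<longrightarrow> \<bar>real q / real n - x\<bar> < \<delta>"
proof -
  have "(\<lambda>n. real (idx n s) / real n - real (Ht n) / real n - 1 / real n) \<longlonglongrightarrow> s - 0 - 0"
    by (intro tendsto_diff idx_lim assms height lim_1_over_n)
  then have 1: "\<forall>\<^sub>F n in sequentially. x - \<delta> < real (idx n s) / real n - real (Ht n) / real n - 1 / real n"
    by (rule order_tendstoD(1)) (use assms(3) in simp)
  have 2: "\<forall>\<^sub>F n in sequentially. real (idx n t) / real n < x + \<delta>"
    using order_tendstoD(2)[OF idx_lim[OF assms(2)] assms(4)] .
  from 1 2 eventually_gt_at_top[of 0] show ?thesis
  proof eventually_elim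
    case (elim n)
    show ?case
    proof (intro allI impI)
      fix q assume q: "idx n s \<le> Suc (q + Ht n) \<and> q \<le> idx n t"
      have "real q / real n \<le> real (idx n t) / real n" using q by (intro divide_right_mono) auto
      moreover have "(real (idx n s) - real (Ht n) - 1) / real n \<le> real q / real n"
        using q by (intro divide_right_mono) linarith+
      ultimately show "\<bar>real q / real n - x\<bar> < \<delta>" using elim(1,2) by (simp add: diff_divide_distrib abs_less_iff)
    qed
  qed
qed

text \<open>The increasing time changes turn a jump of \<open>Z\<close> into a single step of the walk.\<close>

lemma walk_before_jump:
  assumes n: "0 < n" and u: "u \<in> {0<..1}"
  obtains k where "\<bar>Wr n k / B n - zl u\<bar> \<le> walk_error n" "k = idx n u \<or> Suc k = idx n u"
proof -
  have u01: "u \<in> {0..1}" "0 \<in> {0..1::real}" using u by auto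
  have pos: "0 < tc n u" using tc_less[OF u01(2,1), of n] tc_range[OF u01(2), of n] u by auto
  \<comment> \<open>The last integer strictly below \<open>real n * tc n u\<close>. All times just
    before \<open>u\<close> have rank \<open>k\<close>, so the walk at \<open>k\<close> is within
    the error of their values, hence of the left limit.\<close>
  define k where "k = nat (\<lceil>real n * tc n u\<rceil> - 1)"
  have np: "0 < real n * tc n u" using n pos by simp
  then have k: "real k < real n * tc n u" "real n * tc n u \<le> real k + 1"
    unfolding k_def by (simp_all add: of_nat_nat) linarith+
  have "real n * tc n u \<le> real n" using tc_range[OF u01(1), of n] by (simp add: mult_left_le)
  then have kn: "real k < real n" using k(1) by simp
  have "real k / real n \<in> {0..1}" using kn n by simp
  then obtain t where t: "t \<in> {0..1}" "tc n t = real k / real n" by (rule tc_surj)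
  have "tc n t < tc n u" unfolding t(2) using k(1) n by (simp add: field_simps)
  then have tu: "t < u" using tc_less_iff[OF t(1) u01(1)] by simp
  have close: "\<bar>Wr n k / B n - Z v\<bar> \<le> walk_error n" if v: "t < v" "v < u" for v
  proof -
    have v01: "v \<in> {0..1}" using v t u by auto
    have "real k / real n < tc n v" using tc_less[OF t(1) v01 v(1), of n] t(2) by simp
    then have 1: "real k < real n * tc n v" using n by (simp add: field_simps)
    have "real n * tc n v < real n * tc n u" using tc_less[OF v01 u01(1) v(2), of n] n by simp
    then have 2: "real n * tc n v < real k + 1" using k(2) by simp
    have "\<lfloor>real n * tc n v\<rfloor> = int k" using 1 2 by (intro floor_unique) auto
    then have "idx n v = k" by (simp add: idx_def)
    then show ?thesis using idx_walk[OF v01, of n] by simp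
  qed
  have "\<bar>Wr n k / B n - zl u\<bar> \<le> walk_error n"
  proof (rule ccontr)
    assume n': "\<not> ?thesis"
    consider "zl u < Wr n k / B n - walk_error n" | "Wr n k / B n + walk_error n < zl u"
      using n' by linarith
    then show False
    proof cases
      case 1
      obtain a where a: "a < u" "\<forall>v\<in>{a<..<u}. Z v < Wr n k / B n - walk_error n"
        using near_left(1)[OF u 1] by blast
      obtain v where v: "max a t < v" "v < u" using dense[of "max a t" u] a tu by auto
      then have "Z v < Wr n k / B n - walk_error n" using a(2) by simp
      then show False using close[of v] v by simp
    next
      case 2
      obtain a where a: "a < u" "\<forall>v\<in>{a<..<u}. Wr n k / B n + walk_error n < Z v"
        using near_left(2)[OF u 2] by blast
      obtain v where v: "max a t < v" "v < u" using dense[of "max a t" u] a tu by auto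
      then have "Wr n k / B n + walk_error n < Z v" using a(2) by simp
      then show False using close[of v] v by simp
    qed
  qed
  moreover have "k = idx n u \<or> Suc k = idx n u"
    using k idx_bounds[OF u01(1), of n] by linarith
  ultimately show thesis using that by blast
qed

text \<open>The truncated subtraction keeps it a valid rank for every positive \<open>n\<close>, as
  hypothesis \<open>left\<close> demands; eventually it is the true predecessor.\<close>

definition jump_index :: "real \<Rightarrow> nat \<Rightarrow> nat" where "jump_index u n = idx n u - 1"

lemma jump_index:
  assumes "u \<in> jump_times Z"
  shows "\<And>n. 1 \<le> n \<Longrightarrow> jump_index u n < n"
    and "\<forall>\<^sub>F n in sequentially. Suc (jump_index u n) = idx n u"
    and "(\<lambda>n. Wr n (jump_index u n) / B n) \<longlonglongrightarrow> zl u"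
    and "(\<lambda>n. real (jump_index u n) / real n) \<longlonglongrightarrow> u"
proof -
  note u = jump_timeD[OF assms]
  have u0: "u \<in> {0<..1}" using u by auto
  show "jump_index u n < n" if "1 \<le> n" for n using idx_le[OF u(2), of n] that by (simp add: jump_index_def)
  have "0 < (Z u - zl u) / 2" using u by simp
  then have "\<forall>\<^sub>F n in sequentially. walk_error n < (Z u - zl u) / 2" by (rule order_tendstoD(2)[OF walk_error_lim])
  then have ev: "\<forall>\<^sub>F n in sequentially. Suc (jump_index u n) = idx n u \<and>
      \<bar>Wr n (jump_index u n) / B n - zl u\<bar> \<le> walk_error n"
    using eventually_gt_at_top[of 0]
  proof eventually_elim
    case (elim n)
    obtain k where k: "\<bar>Wr n k / B n - zl u\<bar> \<le> walk_error n" "k = idx n u \<or> Suc k = idx n u"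
      using walk_before_jump[OF elim(2) u0] .
    \<comment> \<open>One value of the walk cannot be close to both \<open>zl u\<close> and
      \<open>Z u\<close> once the error is less than half the jump.\<close>
    have "k \<noteq> idx n u"
    proof
      assume "k = idx n u"
      then show False using k(1) idx_walk[OF u(2), of n] elim(1) by (simp add: field_simps abs_le_iff)
    qed
    then have "Suc k = idx n u" using k(2) by simp
    then have "jump_index u n = k" by (simp add: jump_index_def)
    then show ?case using k(1) \<open>Suc k = idx n u\<close> by simp
  qed
  then show ev1: "\<forall>\<^sub>F n in sequentially. Suc (jump_index u n) = idx n u" by (rule eventually_mono) simp
  have "(\<lambda>n. Wr n (jump_index u n) / B n - zl u) \<longlonglongrightarrow> 0"
    by (rule Lim_null_comparison[OF _ walk_error_lim]) (use ev in \<open>auto elim: eventually_mono\<close>)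
  then show "(\<lambda>n. Wr n (jump_index u n) / B n) \<longlonglongrightarrow> zl u" by (simp add: LIM_zero_iff)
  have "(\<lambda>n. real (idx n u) / real n - 1 / real n) \<longlonglongrightarrow> u - 0"
    by (intro tendsto_diff idx_lim u lim_1_over_n)
  moreover have "\<forall>\<^sub>F n in sequentially. real (idx n u) / real n - 1 / real n = real (jump_index u n) / real n"
    using ev1 by (rule eventually_mono) (simp flip: diff_divide_distrib)
  ultimately show "(\<lambda>n. real (jump_index u n) / real n) \<longlonglongrightarrow> u"
    by (simp add: tendsto_cong)
qed

end

section \<open>Edges that approximate the chords\<close>

context tree_limit
begin

lemma walk_after_jump:
  assumes "u \<in> jump_times Z"
  shows "(\<lambda>n. Wr n (Suc (jump_index u n)) / B n) \<longlonglongrightarrow> Z u"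
proof (rule Lim_transform_eventually[OF walk_at_lim[OF jump_timeD(2)[OF assms]]])
  show "\<forall>\<^sub>F n in sequentially. Wr n (idx n u) / B n = Wr n (Suc (jump_index u n)) / B n"
    using jump_index(2)[OF assms] by (rule eventually_mono) metis
qed

abbreviation jump_vertex :: "real \<Rightarrow> nat \<Rightarrow> nat list" where
  "jump_vertex u n \<equiv> lex_vertex (shape (\<theta> n)) (jump_index u n)"

lemma jump_children:
  assumes "u \<in> jump_times Z"
  shows "(\<lambda>n. real (num_children (shape (\<theta> n)) (jump_vertex u n)) / B n) \<longlonglongrightarrow> jump Z u"
proof -
  have "(\<lambda>n. Wr n (Suc (jump_index u n)) / B n - Wr n (jump_index u n) / B n + 1 / B n)
      \<longlonglongrightarrow> Z u - zl u + 0"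
    by (intro tendsto_add tendsto_diff walk_after_jump jump_index(3) assms tendsto_divide_0[OF tendsto_const]
        filterlim_at_top_imp_at_infinity B_lim)
  moreover have "Wr n (Suc (jump_index u n)) / B n - Wr n (jump_index u n) / B n + 1 / B n
      = real (num_children (shape (\<theta> n)) (jump_vertex u n)) / B n" for n
    by (simp add: add_divide_distrib diff_divide_distrib)
  ultimately show ?thesis by (simp add: jump_def)
qed

text \<open>Each complete subtree of a child lowers the walk by one, so this is its level when the
  left children have been explored; by \<open>label_hitting_time\<close> its first passage locates
  the label of the vertex.\<close>

definition apex_level :: "real \<Rightarrow> nat \<Rightarrow> int" where
  "apex_level u n = W n (Suc (jump_index u n)) - int (num_left_children (\<theta> n) (jump_vertex u n))"

lemma apex_level_lim:
  assumes "u \<in> jump_times Z"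
  shows "(\<lambda>n. real_of_int (apex_level u n) / B n) \<longlonglongrightarrow> Z (ap u)"
proof -
  note u = jump_timeD[OF assms]
  have J: "0 < jump Z u" using u by (simp add: jump_pos_iff)
  define K where "K n = real (num_children (shape (\<theta> n)) (jump_vertex u n))" for n
  define L where "L n = real (num_left_children (\<theta> n) (jump_vertex u n))" for n
  have K: "(\<lambda>n. K n / B n) \<longlonglongrightarrow> jump Z u" unfolding K_def by (rule jump_children[OF assms])
  have "(\<lambda>n. L n / K n) \<longlonglongrightarrow> lab u"
    unfolding L_def K_def
    by (rule left[OF u(1) jump_index(1)[OF assms] jump_children[OF assms] J jump_index(4)[OF assms]])
  then have "(\<lambda>n. L n / K n * (K n / B n)) \<longlonglongrightarrow> lab u * jump Z u" using K by (rule tendsto_mult)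
  moreover have "\<forall>\<^sub>F n in sequentially. L n / K n * (K n / B n) = L n / B n"
    using order_tendstoD(1)[OF K J] by (rule eventually_mono) auto
  ultimately have "(\<lambda>n. L n / B n) \<longlonglongrightarrow> lab u * jump Z u" by (rule Lim_transform_eventually)
  then have "(\<lambda>n. Wr n (Suc (jump_index u n)) / B n - L n / B n) \<longlonglongrightarrow> Z u - lab u * jump Z u"
    by (intro tendsto_diff walk_after_jump assms)
  moreover have "Z (ap u) = Z u - lab u * jump Z u" using face_apex(3)[OF assms] by simp
  ultimately show ?thesis by (simp add: apex_level_def L_def diff_divide_distrib)
qed

text \<open>The rescaled level tends to the level of the apex. The first passage cannot come too
  early, as the minimum of \<open>Z\<close> from \<open>u\<close> to a time shortly before the apex
  is strictly higher, nor too late, by \<open>below_after_apex\<close>.\<close>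

lemma apex_label:
  assumes "u \<in> jump_times Z" "0 < \<delta>"
  shows "\<forall>\<^sub>F n in sequentially. \<bar>real (label_of (\<theta> n) (jump_vertex u n)) / real n - ap u\<bar> < \<delta>"
proof -
  note u = jump_timeD[OF assms(1)]
  note p = face_apex[OF assms(1)]
  have p1: "ap u < 1" using p(2) face_end(2)[OF assms(1)] by simp
  obtain d where d: "ap u < d" "d < ap u + \<delta>" "d \<le> 1" "Z d < Z (ap u)" using below_after_apex[OF assms] .
  have d01: "d \<in> {0..1}" "u \<le> d" using d p u by auto
  obtain l where l: "Z d < l" "l < Z (ap u)" using dense[OF d(4)] by blast
  obtain b where b: "u \<le> b" "ap u - \<delta> < b" "b \<le> 1"
    and before: "\<forall>\<^sub>F n in sequentially. \<forall>j. idx n u \<le> j \<and> j < idx n b \<longrightarrow> apex_level u n < W n j"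
  proof (cases "ap u = u")
    case True
    \<comment> \<open>The strict bound \<open>j < idx n b\<close> makes the condition void for
      \<open>b = u\<close>.\<close>
    show thesis by (rule that[of u]) (use u True assms(2) in auto)
  next
    case False
    obtain b where b: "max u (ap u - \<delta>) < b" "b < ap u"
      using dense[of "max u (ap u - \<delta>)" "ap u"] False p(1) assms(2) by auto
    have ub: "0 \<le> u" "u \<le> b" "b \<le> 1" using u b p1 by auto
    obtain q where q: "q \<in> {u..b}" "\<And>v. v \<in> {u..b} \<Longrightarrow> Z q \<le> Z v" using minimum_attained[OF ub] by blast
    have "Z (ap u) < Z q" using p(5)[of q] q(1) b by simp
    then obtain k where k: "Z (ap u) < k" "k < Z q" using dense by blast
    have "\<forall>\<^sub>F n in sequentially. \<forall>j. idx n u \<le> j \<and> j < idx n b \<longrightarrow> apex_level u n < W n j"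
    proof (rule eventually_elim2[OF below_levelI[OF apex_level_lim[OF assms(1)] k(1)] walk_above_on_range[OF ub]])
      show "k < Z v" if "v \<in> {u..b}" for v using q(2)[OF that] k by simp
      fix n assume n: "real_of_int (apex_level u n) < k * B n"
        "\<forall>j. idx n u \<le> j \<and> j \<le> idx n b \<longrightarrow> k * B n < Wr n j"
      show "\<forall>j. idx n u \<le> j \<and> j < idx n b \<longrightarrow> apex_level u n < W n j"
      proof (intro allI impI)
        fix j assume "idx n u \<le> j \<and> j < idx n b"
        then have "k * B n < Wr n j" using n(2) by simp
        then show "apex_level u n < W n j" using n(1) by linarith
      qed
    qed
    then show thesis using that[of b] b ub by auto
  qed
  have b01: "b \<in> {0..1}" using b u by auto
  show ?thesis
    using before below_levelI[OF walk_at_lim[OF d01(1)] l(1)] above_levelI[OF apex_level_lim[OF assms(1)] l(2)]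
      jump_index(2)[OF assms(1)] label_position[OF b01 d01(1) b(2) d(2)] eventually_gt_at_top[of 0]
  proof eventually_elim
    case (elim n)
    interpret nc_tree n "\<theta> n" using nc elim(6) by simp
    let ?i = "jump_index u n"
    have i: "?i < n" using jump_index(1)[OF assms(1), of n] elim(6) by simp
    obtain T where T: "?i < T" "T \<le> n" "W n T = W n (Suc ?i) - int (num_left_children (\<theta> n) (jump_vertex u n))"
      "\<And>m. ?i < m \<Longrightarrow> m < T \<Longrightarrow> W n T < W n m" "vlab ?i < T" "T \<le> Suc (vlab ?i + Ht n)"
      by (rule label_hitting_time[OF i]) blast
    have WT: "W n T = apex_level u n" using T(3) by (simp add: apex_level_def)
    have "T \<le> idx n d"
    proof (rule ccontr)
      assume "\<not> T \<le> idx n d"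
      moreover have "?i < idx n d" using elim(4) idx_mono[OF u(2) d01] by (metis Suc_le_lessD)
      ultimately have "W n T < W n (idx n d)" using T(4) by simp
      then show False using WT elim(2,3) by linarith
    qed
    moreover have "idx n b \<le> T"
    proof (rule ccontr)
      assume "\<not> idx n b \<le> T"
      moreover have "idx n u \<le> T" using elim(4) T(1) by simp
      ultimately show False using elim(1) WT by force
    qed
    ultimately show ?case using elim(5) T by force
  qed
qed

abbreviation edge_near :: "nat \<Rightarrow> real \<Rightarrow> real \<Rightarrow> real \<Rightarrow> bool" where
  "edge_near n a b \<delta> \<equiv> \<exists>p q. {p, q} \<in> \<theta> n \<and> \<bar>real p / real n - a\<bar> < \<delta> \<and> \<bar>real q / real n - b\<bar> < \<delta>"

lemma face_chord_approx:
  assumes "u \<in> jump_times Z" "r \<in> face_times Z u" "0 < \<delta>"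
  shows "\<forall>\<^sub>F n in sequentially. edge_near n (ap u) r \<delta>"
proof -
  note u = jump_timeD[OF assms(1)]
  obtain a d l l' where ad: "u \<le> a" "a < d" "d \<le> 1" "r - \<delta> < a" "d < r + \<delta>"
    and l: "Z d < l" "zl u < l" "l < l'" and l': "\<And>v. u \<le> v \<Longrightarrow> v \<le> a \<Longrightarrow> l' < Z v"
    by (rule face_time_descent[OF assms]) blast
  have a01: "a \<in> {0..1}" and d01: "d \<in> {0..1}" "u \<le> d" and u0: "0 \<le> u" and a1: "a \<le> 1" using ad u by auto
  have Bl: "\<forall>\<^sub>F n in sequentially. 1 / (l' - l) < B n" using B_lim by (auto simp: filterlim_at_top_dense)
  have above: "\<forall>\<^sub>F n in sequentially. \<forall>j. idx n u \<le> j \<and> j \<le> idx n a \<longrightarrow> l' * B n < Wr n j"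
    by (rule walk_above_on_range[OF u0 ad(1) a1]) (use l' in auto)
  show ?thesis
    using apex_label[OF assms(1,3)] Bl above below_levelI[OF walk_at_lim[OF d01(1)] l(1)]
      below_levelI[OF jump_index(3)[OF assms(1)] l(2)]
      jump_index(2)[OF assms(1)] label_position[OF a01 d01(1) ad(4,5)] eventually_gt_at_top[of 0]
  proof eventually_elim
    case (elim n)
    interpret nc_tree n "\<theta> n" using nc elim(8) by simp
    let ?i = "jump_index u n"
    have i: "?i < n" using jump_index(1)[OF assms(1), of n] elim(8) by simp
    \<comment> \<open>An integer level, so that the walk attains it exactly. It exceeds
      \<open>l * B n\<close> since the gap between the two levels, scaled by \<open>B n\<close>, is
      more than 1.\<close>
    define M where "M = \<lfloor>l' * B n\<rfloor>"
    have "1 < (l' - l) * B n" using elim(2) l(3) by (simp add: field_simps)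
    then have "l * B n + 1 < l' * B n" by (simp add: algebra_simps)
    then have M: "l * B n < real_of_int M" "real_of_int M \<le> l' * B n" unfolding M_def by linarith+
    have ua: "idx n u \<le> idx n a" using idx_mono[OF u(2) a01 ad(1)] .
    have "l' * B n < Wr n (Suc ?i)" using elim(3,6) ua by (metis order.refl)
    then have wu: "M \<le> W n (Suc ?i)" using M by linarith
    have wl: "W n ?i \<le> M" using elim(5) M by linarith
    obtain c q where c: "?i < c" "W n c = M" "\<And>m. ?i < m \<Longrightarrow> m < c \<Longrightarrow> M < W n m"
      "{vlab ?i, q} \<in> \<theta> n" "c \<le> q + Ht n" "\<And>j. c < j \<Longrightarrow> j \<le> n \<Longrightarrow> W n j < M \<Longrightarrow> q < j"
      by (rule child_at_level[OF i wl wu]) blast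
    have Wd: "W n (idx n d) < M" using elim(4) M by linarith
    have "idx n a < c"
    proof (rule ccontr)
      assume "\<not> idx n a < c"
      then have "l' * B n < Wr n c" using elim(3,6) c(1) by (metis Suc_leI not_less)
      then show False using M c(2) by linarith
    qed
    moreover have "?i < idx n d" using elim(6) idx_mono[OF u(2) d01] by (metis Suc_le_lessD)
    then have "c < idx n d" using c(2) c(3)[of "idx n d"] Wd by (metis linorder_neqE_nat not_less_iff_gr_or_eq)
    then have "q < idx n d" using c(6) Wd idx_le[OF d01(1)] by blast
    ultimately have "\<bar>real q / real n - r\<bar> < \<delta>" using elim(7) c(5) by simp
    then show ?case using c(4) elim(1) by blast
  qed
qed

text \<open>The vertex \<open>i\<close> is the last minimum of the walk from \<open>idx n c\<close>
  to \<open>idx n b\<close>. Level \<open>l\<close> puts it before \<open>idx n a\<close>; the walk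
  stays strictly higher up to \<open>idx n b\<close>, so the subtree ends later; and it ends by
  \<open>idx n d\<close>, where the walk is below \<open>m\<close>, hence below its value at
  \<open>i\<close>.\<close>

lemma window_subtree:
  assumes "window c a b d"
  shows "\<forall>\<^sub>F n in sequentially. \<exists>i<n. idx n c \<le> i \<and> i < idx n a \<and>
    idx n b < i + nc_tree.sub_size n (\<theta> n) i \<and> i + nc_tree.sub_size n (\<theta> n) i \<le> idx n d"
proof -
  obtain l m where w: "0 \<le> c" "c < a" "a < b" "b < d" "d \<le> 1" "Z c < l" "\<forall>v\<in>{a..b}. l < Z v"
    "Z d < m" "\<forall>v\<in>{c..b}. m < Z v" using assms unfolding window_def by blast
  have in01: "c \<in> {0..1}" "a \<in> {0..1}" "b \<in> {0..1}" "d \<in> {0..1}" using w by auto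
  have 1: "\<forall>\<^sub>F n in sequentially. \<forall>j. idx n a \<le> j \<and> j \<le> idx n b \<longrightarrow> l * B n < Wr n j"
    by (rule walk_above_on_range) (use w in auto)
  have 2: "\<forall>\<^sub>F n in sequentially. \<forall>j. idx n c \<le> j \<and> j \<le> idx n b \<longrightarrow> m * B n < Wr n j"
    by (rule walk_above_on_range) (use w in auto)
  show ?thesis
    using 1 2 below_levelI[OF walk_at_lim[OF in01(1)] w(6)] below_levelI[OF walk_at_lim[OF in01(4)] w(8)]
      eventually_gt_at_top[of 0]
  proof eventually_elim
    case (elim n)
    interpret nc_tree n "\<theta> n" using nc elim(5) by simp
    have mono: "idx n c \<le> idx n a" "idx n a \<le> idx n b" "idx n b \<le> idx n d"
      using idx_mono in01 w by auto
    define V where "V = W n ` {idx n c..idx n b}"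
    have "finite V" "V \<noteq> {}" using mono by (auto simp: V_def)
    define S where "S = {j \<in> {idx n c..idx n b}. W n j = Min V}"
    have "Min V \<in> V" using \<open>finite V\<close> \<open>V \<noteq> {}\<close> by simp
    then have S: "finite S" "S \<noteq> {}" by (auto simp: S_def V_def)
    define i where "i = Max S"
    have "i \<in> S" using S by (simp add: i_def)
    then have i: "idx n c \<le> i" "i \<le> idx n b" "W n i = Min V" by (auto simp: S_def)
    have minV: "W n i \<le> W n j" if "idx n c \<le> j" "j \<le> idx n b" for j
      unfolding i(3) using that \<open>finite V\<close> by (intro Min_le) (auto simp: V_def)
    have last: "W n i < W n j" if "i < j" "j \<le> idx n b" for j
    proof -
      have "j \<notin> S" using that S Max_ge[of S j] by (auto simp: i_def)
      then have "W n j \<noteq> W n i" using that i by (auto simp: S_def)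
      then show ?thesis using minV[of j] that i by simp
    qed
    have "Wr n i < l * B n" using minV[of "idx n c"] mono elim(3) by fastforce
    then have ia: "i < idx n a" using elim(1) i by (metis not_le order.asym)
    have "i < n" using ia idx_le[OF in01(2), of n] by simp
    note sub = subtree_walk[OF this]
    have "idx n b < i + sub_size i" using last[of "i + sub_size i"] sub(1,3) by force
    moreover have "i + sub_size i \<le> idx n d"
    proof (rule ccontr)
      assume "\<not> i + sub_size i \<le> idx n d"
      then have "W n i \<le> W n (idx n d)" using sub(4)[of "idx n d"] ia mono by simp
      moreover have "m * B n < Wr n i" using elim(2) i(1,2) by simp
      ultimately show False using elim(4) by linarith
    qed
    ultimately show ?case using i ia \<open>i < n\<close> by blast
  qed
qed

lemma lam_less_approx:
  assumes "lam_less Z s t" "0 < s" "0 < \<delta>"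
  shows "\<forall>\<^sub>F n in sequentially. edge_near n s t \<delta>"
proof -
  obtain c a b d c' a' b' d' where w: "window c a b d" and w': "window c' a' b' d'" and ord: "a < c'" "d' < b"
    "s - \<delta> < c" "a' < s + \<delta>" "t - \<delta> < b'" "d < t + \<delta>"
    by (rule nested_windows[OF assms])
  have in01: "c \<in> {0..1}" "a \<in> {0..1}" "b \<in> {0..1}" "d \<in> {0..1}"
    "c' \<in> {0..1}" "a' \<in> {0..1}" "b' \<in> {0..1}" "d' \<in> {0..1}"
    using w w' unfolding window_def by auto
  show ?thesis
    using window_subtree[OF w] window_subtree[OF w'] height_gap[OF in01(2,5) ord(1)]
      height_gap[OF in01(8,3) ord(2)] label_position[OF in01(1,6) ord(3,4)]
      label_position[OF in01(7,4) ord(5,6)] eventually_gt_at_top[of 0]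
  proof eventually_elim
    case (elim n)
    interpret nc_tree n "\<theta> n" using nc elim(7) by simp
    obtain i where i: "i < n" "idx n c \<le> i" "i < idx n a" "idx n b < i + sub_size i" "i + sub_size i \<le> idx n d"
      using elim(1) by blast
    obtain j where j: "j < n" "idx n c' \<le> j" "j < idx n a'" "idx n b' < j + sub_size j" "j + sub_size j \<le> idx n d'"
      using elim(2) by blast
    obtain q r where "{q, r} \<in> \<theta> n" "i \<le> q + Ht n" "q < j" "j + sub_size j \<le> r + Ht n" "r < i + sub_size i"
      by (rule edge_between_subtrees[of i j]) (use i j elim(3,4) in auto)
    moreover have "\<bar>real q / real n - s\<bar> < \<delta>" using elim(5) calculation i j by simp
    moreover have "\<bar>real r / real n - t\<bar> < \<delta>" using elim(6) calculation i j by simp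
    ultimately show ?case by blast
  qed
qed

text \<open>A chord ending at 0 or 1 joins these two times, which are the same point of the circle;
  it needs no approximating edge beyond those near circle points.\<close>

lemma lam_chord_interior:
  assumes "lam_chord a b" shows "(a = 0 \<and> b = 1) \<or> (0 < a \<and> a < 1 \<and> 0 < b \<and> b < 1)"
proof -
  consider "lam_less Z a b" | u r where "u \<in> jump_times Z" "r \<in> face_times Z u" "(a = ap u \<and> b = r) \<or> (a = r \<and> b = ap u)"
    using assms unfolding lam_chord_def by blast
  then show ?thesis
  proof cases
    case 1
    show ?thesis
    proof (cases "a = 0")
      case True
      then have "Z b = 0" "0 < b" "b \<le> 1" using 1 by (auto simp: lam_less_iff left_lim_def Z_0)
      then show ?thesis using Z_pos[of b] True by (cases "b = 1") auto
    next
      case False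
      then have "0 < a" using 1 by (auto simp: lam_less_iff)
      then show ?thesis using lam_less_end[OF 1] 1 by (auto simp: lam_less_iff)
    qed
  next
    case 2
    then show ?thesis
      using jump_timeD(1)[OF 2(1)] face_end(2)[OF 2(1)] face_apex(1,2)[OF 2(1)] by (auto simp: face_times_iff)
  qed
qed

lemma lam_chord_approx:
  assumes "lam_chord a b" "0 < a" "0 < \<delta>"
  shows "\<forall>\<^sub>F n in sequentially. edge_near n a b \<delta>"
proof -
  consider "lam_less Z a b" | u where "u \<in> jump_times Z" "b \<in> face_times Z u" "a = ap u"
    | u where "u \<in> jump_times Z" "a \<in> face_times Z u" "b = ap u"
    using assms(1) unfolding lam_chord_def by blast
  then show ?thesis
  proof cases
    case 1 then show ?thesis using lam_less_approx assms by blast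
  next
    case 2 then show ?thesis using face_chord_approx[OF 2(1,2) assms(3)] by simp
  next
    case 3
    show ?thesis using face_chord_approx[OF 3(1,2) assms(3)]
    proof (rule eventually_mono)
      fix n assume "edge_near n (ap u) a \<delta>"
      then obtain p q where "{q, p} \<in> \<theta> n" "\<bar>real p / real n - b\<bar> < \<delta>" "\<bar>real q / real n - a\<bar> < \<delta>"
        using 3 by (auto simp: insert_commute)
      then show "edge_near n a b \<delta>" by blast
    qed
  qed
qed

lemma limit_of_edges:
  fixes m p q :: "nat \<Rightarrow> nat"
  assumes m: "filterlim m at_top sequentially" and e: "\<And>k. {p k, q k} \<in> \<theta> (m k)"
    and p: "(\<lambda>k. real (p k) / real (m k)) \<longlonglongrightarrow> s" and q: "(\<lambda>k. real (q k) / real (m k)) \<longlonglongrightarrow> t"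
    and st: "0 \<le> s" "s < t" "t \<le> 1"
  shows "lam_chord s t"
proof (rule lam_chord_maximal[OF st])
  have no_interleaving: False
    if c: "lam_chord a b" and ord: "(a < s \<and> s < b \<and> b < t) \<or> (s < a \<and> a < t \<and> t < b)" for a b
  proof -
    have a0: "0 < a" using lam_chord_interior[OF c] ord st by auto
    \<comment> \<open>Half the least distance between ends of the two chords: edges this close to
      them interleave in the same way.\<close>
    define \<delta> where "\<delta> = min (min \<bar>a - s\<bar> \<bar>a - t\<bar>) (min \<bar>b - s\<bar> \<bar>b - t\<bar>) / 2"
    have \<delta>: "0 < \<delta>" using ord by (auto simp: \<delta>_def)
    have d2: "2 * \<delta> \<le> \<bar>a - s\<bar>" "2 * \<delta> \<le> \<bar>a - t\<bar>" "2 * \<delta> \<le> \<bar>b - s\<bar>" "2 * \<delta> \<le> \<bar>b - t\<bar>"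
      by (auto simp: \<delta>_def)
    have ev: "\<forall>\<^sub>F k in sequentially. edge_near (m k) a b \<delta>"
      using eventually_compose_filterlim[OF lam_chord_approx[OF c a0 \<delta>] m] .
    have ev0: "\<forall>\<^sub>F k in sequentially. 0 < m k"
      using eventually_compose_filterlim[OF eventually_gt_at_top[of 0] m] .
    have evp: "\<forall>\<^sub>F k in sequentially. \<bar>real (p k) / real (m k) - s\<bar> < \<delta>"
      and evq: "\<forall>\<^sub>F k in sequentially. \<bar>real (q k) / real (m k) - t\<bar> < \<delta>"
      using tendstoD[OF p \<delta>] tendstoD[OF q \<delta>] by (simp_all add: dist_real_def)
    obtain k where k: "edge_near (m k) a b \<delta>"
      "0 < m k" "\<bar>real (p k) / real (m k) - s\<bar> < \<delta>" "\<bar>real (q k) / real (m k) - t\<bar> < \<delta>"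
      using eventually_happens[OF eventually_conj[OF ev eventually_conj[OF ev0 eventually_conj[OF evp evq]]]] by auto
    obtain p' q' where pq: "{p', q'} \<in> \<theta> (m k)" "\<bar>real p' / real (m k) - a\<bar> < \<delta>" "\<bar>real q' / real (m k) - b\<bar> < \<delta>"
      using k(1) by blast
    have lt: "i < j" if "\<bar>real i / real (m k) - x\<bar> < \<delta>" "\<bar>real j / real (m k) - y\<bar> < \<delta>" "x < y" "2 * \<delta> \<le> \<bar>x - y\<bar>"
      for i j :: nat and x y :: real
    proof -
      have "real i / real (m k) < real j / real (m k)" using that by (simp add: abs_less_iff)
      then show ?thesis using k(2) by (simp add: divide_less_cancel)
    qed
    interpret nc_tree "m k" "\<theta> (m k)" by (rule nc) (use k(2) in simp)
    show False using ord
    proof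
      assume o: "a < s \<and> s < b \<and> b < t"
      have "p' < p k" by (rule lt[OF pq(2) k(3)]) (use o d2 in auto)
      moreover have "p k < q'" by (rule lt[OF k(3) pq(3)]) (use o d2 in auto)
      moreover have "q' < q k" by (rule lt[OF pq(3) k(4)]) (use o d2 in auto)
      ultimately show False by (rule edges_not_crossing[OF pq(1) e])
    next
      assume o: "s < a \<and> a < t \<and> t < b"
      have "p k < p'" by (rule lt[OF k(3) pq(2)]) (use o d2 in auto)
      moreover have "p' < q k" by (rule lt[OF pq(2) k(4)]) (use o d2 in auto)
      moreover have "q k < q'" by (rule lt[OF k(4) pq(3)]) (use o d2 in auto)
      ultimately show False by (rule edges_not_crossing[OF e pq(1)])
    qed
  qed
  show False if "lam_chord a b" "a < s" "s < b" "b < t" for a b using no_interleaving that by blast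
  show False if "lam_chord a b" "s < a" "a < t" "t < b" for a b using no_interleaving that by blast
qed

end

section \<open>Hausdorff convergence\<close>

lemma hausdorff_dist_tendsto_0:
  fixes S :: "nat \<Rightarrow> 'a::metric_space set"
  assumes "T \<noteq> {}"
    and S: "\<And>\<epsilon>. 0 < \<epsilon> \<Longrightarrow> \<forall>\<^sub>F n in sequentially. \<forall>x\<in>S n. infdist x T < \<epsilon>"
    and T: "\<And>\<epsilon>. 0 < \<epsilon> \<Longrightarrow> \<forall>\<^sub>F n in sequentially. \<forall>y\<in>T. infdist y (S n) < \<epsilon>"
    and ne: "\<forall>\<^sub>F n in sequentially. S n \<noteq> {}"
  shows "(\<lambda>n. hausdorff_dist (S n) T) \<longlonglongrightarrow> 0"
proof (rule tendstoI)
  fix \<epsilon> :: real assume "0 < \<epsilon>"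
  then have "0 < \<epsilon> / 2" by simp
  from S[OF this] T[OF this] ne show "\<forall>\<^sub>F n in sequentially. dist (hausdorff_dist (S n) T) 0 < \<epsilon>"
  proof eventually_elim
    case (elim n)
    have 1: "(SUP x\<in>S n. infdist x T) \<le> \<epsilon> / 2"
      by (rule cSUP_least[OF elim(3)]) (use elim(1) in force)
    have 2: "(SUP y\<in>T. infdist y (S n)) \<le> \<epsilon> / 2"
      by (rule cSUP_least[OF assms(1)]) (use elim(2) in force)
    obtain x where x: "x \<in> S n" using elim(3) by blast
    have "bdd_above ((\<lambda>x. infdist x T) ` S n)" 
      by (rule bdd_aboveI2[of _ _ "\<epsilon> / 2"]) (use elim(1) in force)
    then have "infdist x T \<le> (SUP x\<in>S n. infdist x T)" using x by (intro cSUP_upper)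
    then have "0 \<le> (SUP x\<in>S n. infdist x T)" using infdist_nonneg[of x T] by linarith
    then show ?case using 1 2 \<open>0 < \<epsilon>\<close> by (simp add: hausdorff_dist_def dist_real_def)
  qed
qed

lemma unity_vertex_eq: "unity_vertex n p = circle_pt (real p / real n)"
  by (simp add: unity_vertex_def circle_pt_def)

lemma continuous_circle_pt: "continuous_on UNIV circle_pt"
  unfolding circle_pt_def[abs_def] by (intro continuous_intros)

lemma tendsto_circle_pt: "(f \<longlongrightarrow> x) F \<Longrightarrow> ((\<lambda>k. circle_pt (f k)) \<longlongrightarrow> circle_pt x) F"
  by (rule continuous_on_tendsto_compose[OF continuous_circle_pt]) auto

lemma circle_pt_1: "circle_pt 1 = circle_pt 0"
  by (simp add: circle_pt_def complex_eq_iff)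

lemma norm_circle_pt [simp]: "norm (circle_pt s) = 1" by (simp add: circle_pt_def)

lemma chord_commute: "chord s t = chord t s"
  by (simp add: chord_def closed_segment_commute)

lemma edge_in_drawing: "{p, q} \<in> E \<Longrightarrow> edge_segment n p q \<subseteq> drawing n E"
  by (auto simp: drawing_def adjacent_def)

section \<open>Points of the drawings and points of the lamination\<close>

context tree_limit
begin

abbreviation "L \<equiv> triangulated_lamination Z lab"
abbreviation "D n \<equiv> drawing n (\<theta> n)"

lemma lamination_iff:
  "x \<in> L \<longleftrightarrow> (\<exists>s\<in>{0..1}. x = circle_pt s) \<or> (\<exists>a b. lam_chord a b \<and> x \<in> chord a b)"
proof
  assume "x \<in> L"
  then consider s t where "lam_rel Z s t" "x \<in> chord s t"
    | u r where "u \<in> jump_times Z" "r \<in> face_times Z u" "x \<in> chord (ap u) r"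
    unfolding triangulated_lamination_def lamination_def face_chords_def by blast
  then show "(\<exists>s\<in>{0..1}. x = circle_pt s) \<or> (\<exists>a b. lam_chord a b \<and> x \<in> chord a b)"
  proof cases
    case 1
    then consider "lam_less Z s t" | "lam_less Z t s" | "s = t" "s \<in> {0..1}" unfolding lam_rel_def by blast
    then show ?thesis
    proof cases
      case 1 then show ?thesis using \<open>x \<in> chord s t\<close> lam_chord_lam by blast
    next
      case 2 then show ?thesis using \<open>x \<in> chord s t\<close> lam_chord_lam[of t s] chord_commute by blast
    next
      case 3 then show ?thesis using \<open>x \<in> chord s t\<close> by (auto simp: chord_def)
    qed
  next
    case 2 then show ?thesis using lam_chord_face by blast
  qed
next
  assume "(\<exists>s\<in>{0..1}. x = circle_pt s) \<or> (\<exists>a b. lam_chord a b \<and> x \<in> chord a b)"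
  then consider s where "s \<in> {0..1}" "x = circle_pt s" | a b where "lam_chord a b" "x \<in> chord a b" by blast
  then show "x \<in> L"
  proof cases
    case 1
    then have "lam_rel Z s s" "x \<in> chord s s" by (auto simp: lam_rel_def chord_def)
    then show ?thesis unfolding triangulated_lamination_def lamination_def by blast
  next
    case 2
    from 2(1) consider "lam_less Z a b" | u where "u \<in> jump_times Z" "b \<in> face_times Z u" "a = ap u"
      | u where "u \<in> jump_times Z" "a \<in> face_times Z u" "b = ap u"
      unfolding lam_chord_def by blast
    then show ?thesis
    proof cases
      case 1
      then have "lam_rel Z a b" by (simp add: lam_rel_def)
      then show ?thesis using 2(2) unfolding triangulated_lamination_def lamination_def by blast
    next
      case (2 u)
      then have "x \<in> face_chords Z lab u" using \<open>x \<in> chord a b\<close> unfolding face_chords_def by blast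
      then show ?thesis using 2 unfolding triangulated_lamination_def by blast
    next
      case (3 u)
      have "x \<in> chord (ap u) a" using \<open>x \<in> chord a b\<close> 3 by (simp add: chord_commute)
      then have "x \<in> face_chords Z lab u" using 3 unfolding face_chords_def by blast
      then show ?thesis using 3 unfolding triangulated_lamination_def by blast
    qed
  qed
qed

lemma circle_point_approx:
  assumes s: "s \<in> {0..1}" and "0 < \<epsilon>"
  shows "\<forall>\<^sub>F n in sequentially. \<exists>y\<in>D n. dist (circle_pt s) y < \<epsilon>"
proof -
  \<comment> \<open>For \<open>s = 1\<close> the floor is \<open>n\<close>, which is not a
    label.\<close>
  define p where "p n = min (nat \<lfloor>real n * s\<rfloor>) (n - 1)" for n
  have "(\<lambda>n. real (p n) / real n - s) \<longlonglongrightarrow> 0"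
  proof (rule Lim_null_comparison[OF _ lim_1_over_n])
    have "norm (real (p n) / real n - s) \<le> 1 / real n" if n: "0 < n" for n
    proof -
      have 0: "0 \<le> real n * s" "real n * s \<le> real n" using s by (auto simp: mult_left_le)
      then have f: "real (nat \<lfloor>real n * s\<rfloor>) \<le> real n * s" "real n * s < real (nat \<lfloor>real n * s\<rfloor>) + 1"
        by (simp_all add: of_nat_nat)
      have "real (p n) \<le> real n * s" using f unfolding p_def by linarith
      moreover have "real n * s \<le> real (p n) + 1" using f 0 n unfolding p_def by (cases "nat \<lfloor>real n * s\<rfloor> \<le> n - 1") auto
      ultimately have "\<bar>real (p n) - real n * s\<bar> / real n \<le> 1 / real n" by (intro divide_right_mono) auto
      moreover have "real (p n) / real n - s = (real (p n) - real n * s) / real n" using n by (simp add: diff_divide_distrib)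
      ultimately show ?thesis by simp
    qed
    then show "\<forall>\<^sub>F n in sequentially. norm (real (p n) / real n - s) \<le> 1 / real n"
      using eventually_gt_at_top[of 0] by (rule eventually_mono[rotated])
  qed
  then have "(\<lambda>n. real (p n) / real n) \<longlonglongrightarrow> s" by (simp add: LIM_zero_iff)
  then have "(\<lambda>n. circle_pt (real (p n) / real n)) \<longlonglongrightarrow> circle_pt s" by (rule tendsto_circle_pt)
  from tendstoD[OF this assms(2)] eventually_ge_at_top[of 2] show ?thesis
  proof eventually_elim
    case (elim n)
    interpret nc_tree n "\<theta> n" using nc elim(2) by simp
    have "p n < n" using elim(2) by (simp add: p_def)
    then obtain q where "{p n, q} \<in> \<theta> n" using edge_at_vertex elim(2) by blast
    then have "unity_vertex n (p n) \<in> D n" using edge_in_drawing[of "p n" q "\<theta> n" n]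
      by (auto simp: edge_segment_def)
    then show ?case using elim(1) by (intro bexI[of _ "unity_vertex n (p n)"]) (auto simp: unity_vertex_eq dist_commute)
  qed
qed

lemma lamination_approx:
  assumes "x \<in> L" "0 < \<epsilon>"
  shows "\<forall>\<^sub>F n in sequentially. \<exists>y\<in>D n. dist x y < \<epsilon>"
proof -
  consider s where "s \<in> {0..1}" "x = circle_pt s" | a b where "lam_chord a b" "x \<in> chord a b" "0 < a"
  proof -
    note cases = that
    from assms(1)[unfolded lamination_iff] show thesis
    proof
      assume "\<exists>s\<in>{0..1}. x = circle_pt s"
      then show thesis using cases(1) by blast
    next
      assume "\<exists>a b. lam_chord a b \<and> x \<in> chord a b"
      then obtain a b where ab: "lam_chord a b" "x \<in> chord a b" by blast
      from lam_chord_interior[OF ab(1)] show thesis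
      proof
        assume "a = 0 \<and> b = 1"
        then have "x = circle_pt 0" using ab(2) by (simp add: chord_def circle_pt_1)
        then show thesis using cases(1)[of 0] by simp
      next
        assume "0 < a \<and> a < 1 \<and> 0 < b \<and> b < 1"
        then show thesis using cases(2)[OF ab] by blast
      qed
    qed
  qed
  then show ?thesis
  proof cases
    case 1 then show ?thesis using circle_point_approx assms(2) by simp
  next
    case 2
    obtain l where l: "0 \<le> l" "l \<le> 1" "x = (1 - l) *\<^sub>R circle_pt a + l *\<^sub>R circle_pt b"
      using 2(2) by (auto simp: chord_def closed_segment_def)
    have e2: "0 < \<epsilon>" by (rule assms(2))
    have cont: "\<exists>d>0. \<forall>z. \<bar>z - y\<bar> < d \<longrightarrow> norm (circle_pt z - circle_pt y) < \<epsilon>" for y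
      using continuous_circle_pt e2 unfolding continuous_on_iff by (metis UNIV_I dist_norm dist_real_def)
    obtain d1 d2 where d: "0 < d1" "\<And>z. \<bar>z - a\<bar> < d1 \<Longrightarrow> norm (circle_pt z - circle_pt a) < \<epsilon>"
      "0 < d2" "\<And>z. \<bar>z - b\<bar> < d2 \<Longrightarrow> norm (circle_pt z - circle_pt b) < \<epsilon>"
      using cont[of a] cont[of b] by blast
    have "0 < min d1 d2" using d by simp
    from lam_chord_approx[OF 2(1,3) this] show ?thesis
    proof (rule eventually_mono)
      fix n assume "edge_near n a b (min d1 d2)"
      then obtain p q where pq: "{p, q} \<in> \<theta> n" "\<bar>real p / real n - a\<bar> < d1" "\<bar>real q / real n - b\<bar> < d2" by auto
      \<comment> \<open>The point of the edge with the same weights as \<open>x\<close> on its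
        chord: its error is a convex combination of those at the ends.\<close>
      define y where "y = (1 - l) *\<^sub>R unity_vertex n p + l *\<^sub>R unity_vertex n q"
      have "y \<in> edge_segment n p q" using l by (auto simp: y_def edge_segment_def closed_segment_def)
      then have "y \<in> D n" using edge_in_drawing[OF pq(1)] by blast
      have n1: "norm (unity_vertex n p - circle_pt a) < \<epsilon>" "norm (unity_vertex n q - circle_pt b) < \<epsilon>"
        using d pq by (simp_all add: unity_vertex_eq)
      have "y - x = (1 - l) *\<^sub>R (unity_vertex n p - circle_pt a) + l *\<^sub>R (unity_vertex n q - circle_pt b)"
        by (simp add: y_def l algebra_simps)
      then have "norm (y - x) \<le> (1 - l) * norm (unity_vertex n p - circle_pt a) + l * norm (unity_vertex n q - circle_pt b)"
        using norm_triangle_ineq[of "(1 - l) *\<^sub>R (unity_vertex n p - circle_pt a)" "l *\<^sub>R (unity_vertex n q - circle_pt b)"] l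
        by simp
      also have "\<dots> < \<epsilon>" by (rule convex_bound_lt[OF n1]) (use l in auto)
      finally show "\<exists>y\<in>D n. dist x y < \<epsilon>" using \<open>y \<in> D n\<close> by (intro bexI[of _ y]) (auto simp: dist_norm norm_minus_commute)
    qed
  qed
qed

text \<open>Each point is coded by the two labels of its edge, divided by the number of vertices,
  and its weight on the edge. These codes lie in a compact cube, so a subsequence converges and
  \<open>limit_of_edges\<close> identifies the limiting edge.\<close>

lemma limit_point_in_lamination:
  assumes m: "filterlim m at_top sequentially" and x: "\<And>k. x k \<in> D (m k)" and lim: "x \<longlonglongrightarrow> z"
  shows "z \<in> L"
proof -
  \<comment> \<open>The sequence is shifted because the trees are specified only for positive
    \<open>n\<close>.\<close>
  obtain k0 where k0: "\<And>k. k0 \<le> k \<Longrightarrow> 1 \<le> m k"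
    using m by (auto simp: filterlim_at_top eventually_sequentially)
  define M where "M k = m (k + k0)" for k
  have M1: "1 \<le> M k" for k using k0[of "k + k0"] by (simp add: M_def)
  have "\<exists>p q l. {p, q} \<in> \<theta> (M k) \<and> 0 \<le> l \<and> l \<le> 1 \<and>
      x (k + k0) = (1 - l) *\<^sub>R unity_vertex (M k) p + l *\<^sub>R unity_vertex (M k) q" for k
    using x[of "k + k0"] unfolding M_def drawing_def adjacent_def edge_segment_def closed_segment_def by auto
  then obtain p q l where pql: "\<And>k. {p k, q k} \<in> \<theta> (M k)" "\<And>k. 0 \<le> l k" "\<And>k. l k \<le> 1"
    "\<And>k. x (k + k0) = (1 - l k) *\<^sub>R unity_vertex (M k) (p k) + l k *\<^sub>R unity_vertex (M k) (q k)"
    by metis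
  have pq1: "real (p k) / real (M k) \<in> {0..1}" "real (q k) / real (M k) \<in> {0..1}" for k
  proof -
    interpret nc_tree "M k" "\<theta> (M k)" by (rule nc[OF M1])
    show "real (p k) / real (M k) \<in> {0..1}" "real (q k) / real (M k) \<in> {0..1}"
      using edgeD[OF pql(1)[of k]] by simp_all
  qed
  define f where "f k = (real (p k) / real (M k), real (q k) / real (M k), l k)" for k
  have "compact ({0..1::real} \<times> {0..1::real} \<times> {0..1::real})" by (intro compact_Times compact_Icc)
  moreover have "f k \<in> {0..1} \<times> {0..1} \<times> {0..1}" for k using pq1 pql(2,3) by (auto simp: f_def)
  ultimately obtain w r where w: "w \<in> {0..1} \<times> {0..1} \<times> {0..1}" "strict_mono r" "(f \<circ> r) \<longlonglongrightarrow> w"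
    unfolding compact_def by blast
  obtain s t \<kappa> where wst: "w = (s, t, \<kappa>)" by (cases w) auto
  have st: "s \<in> {0..1}" "t \<in> {0..1}" "0 \<le> \<kappa>" "\<kappa> \<le> 1" using w wst by auto
  have ps: "(\<lambda>k. real (p (r k)) / real (M (r k))) \<longlonglongrightarrow> s"
    using tendsto_fst[OF w(3)] by (simp add: f_def wst comp_def)
  have qt: "(\<lambda>k. real (q (r k)) / real (M (r k))) \<longlonglongrightarrow> t"
    using tendsto_fst[OF tendsto_snd[OF w(3)]] by (simp add: f_def wst comp_def)
  have ll: "(\<lambda>k. l (r k)) \<longlonglongrightarrow> \<kappa>"
    using tendsto_snd[OF tendsto_snd[OF w(3)]] by (simp add: f_def wst comp_def)
  have "(\<lambda>k. x (r k + k0)) \<longlonglongrightarrow> (1 - \<kappa>) *\<^sub>R circle_pt s + \<kappa> *\<^sub>R circle_pt t"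
    unfolding pql(4) unity_vertex_eq
    by (intro tendsto_intros tendsto_circle_pt ps qt ll)
  moreover have "(\<lambda>k. x (r k + k0)) \<longlonglongrightarrow> z"
    using LIMSEQ_subseq_LIMSEQ[OF LIMSEQ_ignore_initial_segment[OF lim, of k0] w(2)] by (simp add: comp_def)
  ultimately have "z = (1 - \<kappa>) *\<^sub>R circle_pt s + \<kappa> *\<^sub>R circle_pt t" by (rule LIMSEQ_unique[rotated])
  then have z: "z \<in> chord s t" using st by (auto simp: chord_def closed_segment_def)
  have Mlim: "filterlim (\<lambda>k. M (r k)) at_top sequentially"
    unfolding M_def
    by (rule filterlim_compose[OF m])
      (intro filterlim_compose[OF filterlim_add_const_nat_at_top] filterlim_subseq w(2))
  have e: "{p (r k), q (r k)} \<in> \<theta> (M (r k))" "{q (r k), p (r k)} \<in> \<theta> (M (r k))" for k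
    using pql(1)[of "r k"] by (simp_all add: insert_commute)
  consider "s = t" | "s < t" | "t < s" by linarith
  then show ?thesis
  proof cases
    case 1 then show ?thesis unfolding lamination_iff using z st by (auto simp: chord_def)
  next
    case 2
    have "lam_chord s t" by (rule limit_of_edges[OF Mlim e(1) ps qt]) (use st 2 in auto)
    then show ?thesis unfolding lamination_iff using z by blast
  next
    case 3
    have "lam_chord t s" by (rule limit_of_edges[OF Mlim e(2) qt ps]) (use st 3 in auto)
    moreover have "z \<in> chord t s" using z by (simp add: chord_commute)
    ultimately show ?thesis unfolding lamination_iff by blast
  qed
qed

lemma drawing_subset_disc: "D n \<subseteq> cball 0 1"
proof -
  have "edge_segment n p q \<subseteq> cball 0 1" for p q
    unfolding edge_segment_def by (rule closed_segment_subset) (auto simp: unity_vertex_eq)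
  then show ?thesis unfolding drawing_def by blast
qed

lemma lamination_subset_disc: "L \<subseteq> cball 0 1"
proof -
  have "chord a b \<subseteq> cball 0 1" for a b
    unfolding chord_def by (rule closed_segment_subset) auto
  then show ?thesis using lamination_iff by fastforce
qed

text \<open>By a diagonal choice, a limit of points of \<open>L\<close> is a limit of points of
  drawings with indices tending to infinity.\<close>

lemma closed_lamination: "closed L"
  unfolding closed_sequential_limits
proof (intro allI impI)
  fix x z assume xz: "(\<forall>k. x k \<in> L) \<and> x \<longlonglongrightarrow> z"
  have "\<exists>n y. k \<le> n \<and> y \<in> D n \<and> dist (x k) y < 1 / real (Suc k)" for k
    using eventually_happens[OF eventually_conj[OF lamination_approx[of "x k" "1 / real (Suc k)"] eventually_ge_at_top[of k]]]
      xz by auto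
  then obtain m y where my: "\<And>k. k \<le> m k" "\<And>k. y k \<in> D (m k)" "\<And>k. dist (x k) (y k) < 1 / real (Suc k)"
    by metis
  have "filterlim m at_top sequentially"
    by (rule filterlim_at_top_mono[OF filterlim_ident]) (use my in auto)
  moreover have "(\<lambda>k. y k - x k) \<longlonglongrightarrow> 0"
    by (rule Lim_null_comparison[OF _ LIMSEQ_Suc[OF lim_1_over_n]])
      (use my(3) in \<open>auto intro!: always_eventually less_imp_le simp: dist_norm norm_minus_commute\<close>)
  then have "y \<longlonglongrightarrow> z" by (rule Lim_transform[rotated]) (use xz in simp)
  ultimately show "z \<in> L" using my(2) by (intro limit_point_in_lamination[of m y]) auto
qed

lemma compact_lamination: "compact L"
  using closed_lamination lamination_subset_disc by (meson bounded_cball bounded_subset compact_eq_bounded_closed)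

lemma drawing_near_lamination:
  assumes "0 < \<epsilon>" shows "\<forall>\<^sub>F n in sequentially. \<forall>x\<in>D n. infdist x L < \<epsilon>"
proof (rule ccontr)
  assume "\<not> ?thesis"
  then have "\<exists>n\<ge>k. \<exists>x\<in>D n. \<epsilon> \<le> infdist x L" for k
    unfolding eventually_sequentially by (metis not_less)
  then obtain m x where m: "\<And>k. k \<le> m k" and x: "\<And>k. x k \<in> D (m k)" "\<And>k. \<epsilon> \<le> infdist (x k) L" by metis
  have "compact (cball (0::complex) 1)" by simp
  moreover have "\<forall>k. x k \<in> cball 0 1" using x drawing_subset_disc by blast
  ultimately obtain z r where z: "strict_mono r" "(x \<circ> r) \<longlonglongrightarrow> z" unfolding compact_def by metis
  have "filterlim (\<lambda>k. m (r k)) at_top sequentially"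
    by (rule filterlim_at_top_mono[OF filterlim_subseq[OF z(1)]]) (use m in auto)
  then have "z \<in> L" by (rule limit_point_in_lamination[OF _ _ z(2)]) (use x in auto)
  have "\<forall>\<^sub>F k in sequentially. dist ((x \<circ> r) k) z < \<epsilon>" by (rule tendstoD[OF z(2) assms])
  then obtain k where "dist (x (r k)) z < \<epsilon>" by (auto dest: eventually_happens)
  then show False using infdist_le[OF \<open>z \<in> L\<close>, of "x (r k)"] x(2)[of "r k"] by simp
qed

text \<open>The compactness of \<open>L\<close> makes the pointwise approximation of
  \<open>lamination_approx\<close> uniform: points that stay far from the drawings would accumulate
  at a point of \<open>L\<close>.\<close>

lemma lamination_near_drawing:
  assumes "0 < \<epsilon>" shows "\<forall>\<^sub>F n in sequentially. \<forall>y\<in>L. infdist y (D n) < \<epsilon>"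
proof (rule ccontr)
  assume "\<not> ?thesis"
  then have "\<exists>n\<ge>k. \<exists>y\<in>L. \<epsilon> \<le> infdist y (D n)" for k
    unfolding eventually_sequentially by (metis not_less)
  then obtain m y where m: "\<And>k. k \<le> m k" and y: "\<And>k. y k \<in> L" "\<And>k. \<epsilon> \<le> infdist (y k) (D (m k))" by metis
  obtain z r where z: "z \<in> L" "strict_mono r" "(y \<circ> r) \<longlonglongrightarrow> z"
    using compact_lamination y(1) unfolding compact_def by metis
  have "filterlim (\<lambda>k. m (r k)) at_top sequentially"
    by (rule filterlim_at_top_mono[OF filterlim_subseq[OF z(2)]]) (use m in auto)
  moreover have e2: "0 < \<epsilon> / 2" using assms by simp
  ultimately have "\<forall>\<^sub>F k in sequentially. \<exists>v\<in>D (m (r k)). dist z v < \<epsilon> / 2"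
    using eventually_compose_filterlim[OF lamination_approx[OF z(1)]] by blast
  moreover have "\<forall>\<^sub>F k in sequentially. dist ((y \<circ> r) k) z < \<epsilon> / 2" by (rule tendstoD[OF z(3) e2])
  ultimately obtain k v where "v \<in> D (m (r k))" "dist z v < \<epsilon> / 2" "dist (y (r k)) z < \<epsilon> / 2"
    using eventually_happens[OF eventually_conj] by fastforce
  then show False using infdist_le[of v "D (m (r k))" "y (r k)"] dist_triangle[of "y (r k)" v z] y(2)[of "r k"] by simp
qed

lemma tree_limit_hausdorff: "(\<lambda>n. hausdorff_dist (D n) L) \<longlonglongrightarrow> 0"
proof (rule hausdorff_dist_tendsto_0[OF _ drawing_near_lamination lamination_near_drawing])
  have c: "circle_pt 0 \<in> L" unfolding lamination_iff by (auto intro!: bexI[of _ 0])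
  then show "L \<noteq> {}" by blast
  show "\<forall>\<^sub>F n in sequentially. D n \<noteq> {}"
    using lamination_approx[OF c zero_less_one] by (rule eventually_mono) blast
qed

end

theorem proposition16:
  fixes \<theta> :: "nat \<Rightarrow> nat set set"
    and Z :: "real \<Rightarrow> real"
    and B :: "nat \<Rightarrow> real"
    and lab :: "real \<Rightarrow> real"
  assumes tree: "\<And>n. 1 \<le> n \<Longrightarrow> noncrossing_tree n (\<theta> n)"
    and Z_cadlag: "cadlag Z"
    and Z_ends: "Z 0 = 0" "Z 1 = 0"
    and Z_pos: "\<And>t. t \<in> {0<..<1} \<Longrightarrow> Z t > 0"
    and Z_jumps: "\<And>t. t \<in> {0<..1} \<Longrightarrow> jump Z t \<ge> 0"
    and H1: "\<And>s t. 0 \<le> s \<Longrightarrow> s < t \<Longrightarrow> t \<le> 1 \<Longrightarrow>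
               \<exists>\<^sub>\<le>\<^sub>1 r. r \<in> {s<..<t} \<and> Z r = Inf (Z ` {s..t})"
    and H2: "\<And>t \<epsilon>. t \<in> {0<..<1} \<Longrightarrow> jump Z t > 0 \<Longrightarrow> 0 < \<epsilon> \<Longrightarrow> \<epsilon> \<le> 1 - t \<Longrightarrow>
               Inf (Z ` {t..t + \<epsilon>}) < Z t"
    and H3: "\<And>t \<epsilon>. t \<in> {0<..<1} \<Longrightarrow> jump Z t > 0 \<Longrightarrow> 0 < \<epsilon> \<Longrightarrow> \<epsilon> \<le> t \<Longrightarrow>
               Inf (Z ` {t - \<epsilon>..t}) < left_lim Z t"
    and H4: "\<And>t s. t \<in> {0<..<1} \<Longrightarrow> local_min_at Z t \<Longrightarrow> s = Sup {u\<in>{0..t}. Z u < Z t} \<Longrightarrow>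
               jump Z s > 0 \<and> left_lim Z s < Z t \<and> Z t < Z s"
    and B_lim: "filterlim B at_top sequentially"
    and labelling: "jumps_labelling Z lab"
    and height: "(\<lambda>n. real (height (shape (\<theta> n))) / real n) \<longlonglongrightarrow> 0"
    and luka: "(\<lambda>n. skorokhod_dist
                 (\<lambda>s. real_of_int (luka_path (shape (\<theta> n)) (nat \<lfloor>real n * s\<rfloor>)) / B n) Z) \<longlonglongrightarrow> 0"
    and left: "\<And>s i c. s \<in> {0<..<1} \<Longrightarrow> (\<And>n. 1 \<le> n \<Longrightarrow> i n < n) \<Longrightarrow>
                 (\<lambda>n. real (num_children (shape (\<theta> n)) (lex_vertex (shape (\<theta> n)) (i n))) / B n)
                    \<longlonglongrightarrow> c \<Longrightarrow> c > 0 \<Longrightarrow>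
                 (\<lambda>n. real (i n) / real n) \<longlonglongrightarrow> s \<Longrightarrow>
                 (\<lambda>n. real (num_left_children (\<theta> n) (lex_vertex (shape (\<theta> n)) (i n))) /
                      real (num_children (shape (\<theta> n)) (lex_vertex (shape (\<theta> n)) (i n))))
                    \<longlonglongrightarrow> lab s"
    and apex: "\<And>s. s \<in> jump_times Z \<Longrightarrow> \<not> local_min_at Z (face_apex Z lab s)"
  shows "compact (triangulated_lamination Z lab) \<and>
         triangulated_lamination Z lab \<subseteq> cball 0 1 \<and>
         (\<lambda>n. hausdorff_dist (drawing n (\<theta> n)) (triangulated_lamination Z lab)) \<longlonglongrightarrow> 0"
proof -
  interpret tree_limit Z lab \<theta> B
    by unfold_locales
      (fact Z_cadlag Z_ends Z_pos Z_jumps H1 H2 H3 H4 labelling apex tree B_lim height luka left)+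
  show ?thesis
    using compact_lamination lamination_subset_disc tree_limit_hausdorff by blast
qed

end
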